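(* Let $2\le p\le\infty$, $T>0$, $s>3/2$. Let $\phi$ be a locally absolutely continuous function with $|\phi'(x)|\le A|\phi(x)|$ for a.e. $x$ (some $A>0$), which is $v$-moderate for some sub-multiplicative weight $v$ with $\inf_{\mathbb{R}}v>0$ and $v(x)e^{-|x|}\in L^p(\mathbb{R})$ (the condition $\int v e^{-|x|}dx<\infty$ is not assumed). Let $u_0$ satisfy \[ u_0\phi\in L^p(\mathbb{R}),\quad u_0\phi^{1/2}\in L^2(\mathbb{R}),\quad (\partial_xu_0)\phi\in L^p(\mathbb{R}),\quad (\partial_xu_0)\phi^{1/2}\in L^2(\mathbb{R}), \] and let $u\in C([0,T],H^s(\mathbb{R}))$ be the strong solution of the Cauchy problem for the Camassa--Holm equation $\partial_t u+u\partial_x u=-\partial_x(1-\partial_x^2)^{-1}\bigl(u^2+\tfrac12(\partial_x u)^2\bigr)$ with $u|_{t=0}=u_0$. Then \[ \sup_{t\in[0,T]}\bigl(\|u(t)\phi\|_p+\|\partial_xu(t)\phi\|_p\bigr)<\infty \quad\text{and}\quad \sup_{t\in[0,T]}\bigl(\|u(t)\phi^{1/2}\|_2+\|\partial_xu(t)\phi^{1/2}\|_2\bigr)<\infty. \]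
   Context: A weight $v$ (nonnegative, continuous) is sub-multiplicative if $v(x+y)\le v(x)v(y)$ for all $x,y\in\mathbb{R}$. Given a sub-multiplicative $v$, a positive continuous function $\phi$ is $v$-moderate if there is $C_0>0$ with $\phi(x+y)\le C_0 v(x)\phi(y)$ for all $x,y\in\mathbb{R}$. $\|\cdot\|_p$ is the $L^p(\mathbb{R})$ norm. *)

theory Defs
  imports "HOL-Analysis.Analysis"
begin

definition abs_cont_on :: "real \<Rightarrow> real \<Rightarrow> (real \<Rightarrow> real) \<Rightarrow> bool" where
  "abs_cont_on a b f \<longleftrightarrow>
     (\<forall>\<epsilon>>0. \<exists>\<delta>>0. \<forall>(I::nat set) l r.
        finite I \<longrightarrow>
        (\<forall>i\<in>I. a \<le> l i \<and> l i \<le> r i \<and> r i \<le> b) \<longrightarrow>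
        (\<forall>i\<in>I. \<forall>j\<in>I. i \<noteq> j \<longrightarrow> r i \<le> l j \<or> r j \<le> l i) \<longrightarrow>
        (\<Sum>i\<in>I. r i - l i) < \<delta> \<longrightarrow>
        (\<Sum>i\<in>I. \<bar>f (r i) - f (l i)\<bar>) < \<epsilon>)"

definition loc_abs_cont :: "(real \<Rightarrow> real) \<Rightarrow> bool" where
  "loc_abs_cont f \<longleftrightarrow> (\<forall>a b. a \<le> b \<longrightarrow> abs_cont_on a b f)"

definition submultiplicative :: "(real \<Rightarrow> real) \<Rightarrow> bool" where
  "submultiplicative v \<longleftrightarrow> (\<forall>x. 0 \<le> v x) \<and> continuous_on UNIV v \<and>
      (\<forall>x y. v (x + y) \<le> v x * v y)"

definition moderate :: "(real \<Rightarrow> real) \<Rightarrow> (real \<Rightarrow> real) \<Rightarrow> bool" where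
  "moderate v \<phi> \<longleftrightarrow> (\<forall>x. 0 < \<phi> x) \<and> continuous_on UNIV \<phi> \<and>
      (\<exists>C0>0. \<forall>x y. \<phi> (x + y) \<le> C0 * v x * \<phi> y)"

definition memLp :: "ennreal \<Rightarrow> (real \<Rightarrow> real) \<Rightarrow> bool" where
  "memLp p f \<longleftrightarrow> f \<in> borel_measurable lborel \<and>
     (if p = top then (\<exists>C. AE x in lborel. \<bar>f x\<bar> \<le> C)
      else integrable lborel (\<lambda>x. \<bar>f x\<bar> powr enn2real p))"

definition Lp_norm :: "ennreal \<Rightarrow> (real \<Rightarrow> real) \<Rightarrow> real" where
  "Lp_norm p f =
     (if p = top then Inf {C. AE x in lborel. \<bar>f x\<bar> \<le> C}
      else (\<integral>x. \<bar>f x\<bar> powr enn2real p \<partial>lborel) powr (1 / enn2real p))"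

definition L2_fourier :: "(real \<Rightarrow> real) \<Rightarrow> (real \<Rightarrow> complex) \<Rightarrow> bool" where
  "L2_fourier f g \<longleftrightarrow> g \<in> borel_measurable lborel \<and>
     ((\<lambda>R. \<integral>\<^sup>+ \<xi>. ennreal ((cmod (g \<xi> -
          (\<integral>x. indicator {-R..R} x *\<^sub>R (of_real (f x) * cis (- x * \<xi>)) \<partial>lborel)))\<^sup>2) \<partial>lborel)
       \<longlongrightarrow> 0) at_top"

definition in_Hs :: "real \<Rightarrow> (real \<Rightarrow> real) \<Rightarrow> bool" where
  "in_Hs s f \<longleftrightarrow> memLp 2 f \<and>
     (\<exists>g. L2_fourier f g \<and> integrable lborel (\<lambda>\<xi>. (1 + \<xi>\<^sup>2) powr s * (cmod (g \<xi>))\<^sup>2))"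

definition Hs_norm :: "real \<Rightarrow> (real \<Rightarrow> real) \<Rightarrow> real" where
  "Hs_norm s f = sqrt (\<integral>\<xi>. (1 + \<xi>\<^sup>2) powr s * (cmod ((SOME g. L2_fourier f g) \<xi>))\<^sup>2 \<partial>lborel)"

definition C_Hs :: "real \<Rightarrow> real \<Rightarrow> (real \<Rightarrow> real \<Rightarrow> real) \<Rightarrow> bool" where
  "C_Hs T s u \<longleftrightarrow> (\<forall>t\<in>{0..T}. in_Hs s (u t)) \<and>
     (\<forall>t0\<in>{0..T}. ((\<lambda>t. Hs_norm s (\<lambda>x. u t x - u t0 x)) \<longlongrightarrow> 0) (at t0 within {0..T}))"

text \<open>The nonlocal term P = (1 - dx^2)^(-1) (u^2 + (dx u)^2/2), written as
  convolution with the Green kernel exp(-|x|)/2.\<close>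
definition CH_P :: "(real \<Rightarrow> real \<Rightarrow> real) \<Rightarrow> real \<Rightarrow> real \<Rightarrow> real" where
  "CH_P u t x = (\<integral>y. (1/2) * exp (- \<bar>x - y\<bar>) *
        ((u t y)\<^sup>2 + (1/2) * (deriv (u t) y)\<^sup>2) \<partial>lborel)"

text \<open>Strong solution on [0,T] of the Camassa--Holm equation
  u_t + u u_x = - dx (1 - dx^2)^(-1) (u^2 + u_x^2/2) in C([0,T],H^s),
  with each u(t) taken as its C^1 representative (H^s in C^1 for s > 3/2).\<close>
definition CH_strong_solution :: "real \<Rightarrow> real \<Rightarrow> (real \<Rightarrow> real) \<Rightarrow> (real \<Rightarrow> real \<Rightarrow> real) \<Rightarrow> bool" where
  "CH_strong_solution T s u0 u \<longleftrightarrow>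
     C_Hs T s u \<and> u 0 = u0 \<and>
     (\<forall>t\<in>{0..T}. (u t) C1_differentiable_on UNIV) \<and>
     (\<forall>t\<in>{0..T}. \<forall>x.
        ((\<lambda>\<tau>. u \<tau> x) has_real_derivative
           (- u t x * deriv (u t) x - deriv (CH_P u t) x)) (at t within {0..T}))"

end

theory Submission
  imports Defs "HOL-Probability.Characteristic_Functions" "HOL-Probability.Sinc_Integral"
begin

text \<open>The estimate is pointwise in Lagrangian coordinates. Let \<open>q\<close> be the flow of \<open>u\<close>, let
  \<open>P\<close> be the nonlocal term and \<open>W t x = \<bar>u\<bar> + \<bar>u_x\<bar>\<close> at \<open>q t x\<close>. Along the flow \<open>u\<close> changes at
  rate \<open>- P_x\<close> and \<open>u_x\<close> at rate \<open>u\<^sup>2 - u_x\<^sup>2 / 2 - P\<close>; the latter is obtained from difference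
  quotients of \<open>u\<close> between two particles, because \<open>u_xx\<close> need not exist. Displacement and Jacobian
  of the flow are bounded, so \<open>P\<close> at \<open>q t x\<close> is at most a multiple of \<open>(exp (- \<bar>\<cdot>\<bar>) * W\<^sup>2) x\<close>. Hence
  \<open>W t \<le> W 0 + c \<integral> (W + exp (- \<bar>\<cdot>\<bar>) * W)\<close>, and comparison with the supersolution
  \<open>exp (\<kappa> t) (W 0 + exp (- 3 \<bar>\<cdot>\<bar> / 4) * W 0)\<close> bounds \<open>W t\<close> by a function \<open>B\<close> not depending on \<open>t\<close>.
  Keeping the quadratic source gives moreover \<open>W t \<le> C (W 0 + exp (- \<bar>\<cdot>\<bar>) * B\<^sup>2)\<close>.

  The weights enter only through \<open>B\<close>. Submultiplicativity and \<open>v exp (- \<bar>\<cdot>\<bar>) \<in> L\<^sup>p\<close> force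
  \<open>v \<le> C exp \<bar>\<cdot>\<bar>\<close>, so the square root of \<open>\<phi>\<close> is moderate for \<open>exp (\<bar>\<cdot>\<bar> / 2)\<close> and \<open>\<phi> B\<^sup>2\<close> is
  integrable. Finally \<open>\<phi> (exp (- \<bar>\<cdot>\<bar>) * B\<^sup>2)\<close> is at most a multiple of
  \<open>(v exp (- \<bar>\<cdot>\<bar>)) * (\<phi> B\<^sup>2)\<close>, a convolution of \<open>L\<^sup>p\<close> with \<open>L\<^sup>1\<close>.\<close>

subsection \<open>Sobolev embedding\<close>

text \<open>The obstacle is that \<open>v exp (- \<bar>\<cdot>\<bar>)\<close> is only in L^p: with
  the weight \<open>\<phi>\<close>, a linear estimate would convolve with a kernel that may lie
  outside L^1. The quadratic source removes this. Once \<open>\<phi> B\<^sup>2\<close> is in L^1,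
  the kernel may be merely in L^p. Hence two comparisons: the first gives the L^2 estimate together
  with \<open>B\<close>, the second the L^p estimate. The exponent 3/4 has to lie strictly between
  1/2 and 1. Below 1, convolving exp(-|x|) with exp(-3|x|/4) gives at most a multiple of the latter,
  whereas exp(-|x|) convolved with itself gains a factor 1 + |x|. Above 1/2, the kernel still decays
  faster than the square root of \<open>\<phi>\<close> can grow. Because the comparison is pointwise
  and precedes the weights, no weighted norm has to be known finite beforehand and no weight has to
  be truncated. Continuity in time with values in H^s enters only through uniform bounds on u and
  u_x and their continuity in time, uniform in x.\<close>

lemma integrable_mult_of_squares:
  fixes f g :: "'a \<Rightarrow> real"
  assumes [measurable]: "f \<in> borel_measurable M" "g \<in> borel_measurable M"
    and "integrable M (\<lambda>x. (f x)\<^sup>2)" "integrable M (\<lambda>x. (g x)\<^sup>2)"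
  shows "integrable M (\<lambda>x. f x * g x)"
proof (rule Bochner_Integration.integrable_bound)
  show "integrable M (\<lambda>x. (f x)\<^sup>2 + (g x)\<^sup>2)" using assms by auto
  have "\<bar>a * b\<bar> \<le> a\<^sup>2 + b\<^sup>2" for a b :: real
  proof -
    have "0 \<le> (\<bar>a\<bar> - \<bar>b\<bar>)\<^sup>2" "0 \<le> a\<^sup>2" "0 \<le> b\<^sup>2" by auto
    then show ?thesis unfolding power2_diff abs_mult power2_abs by linarith
  qed
  then show "AE x in M. norm (f x * g x) \<le> norm ((f x)\<^sup>2 + (g x)\<^sup>2)" by simp
qed simp

lemma Cauchy_Schwarz_integral:
  fixes f g :: "'a \<Rightarrow> real"
  assumes [measurable]: "f \<in> borel_measurable M" "g \<in> borel_measurable M"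
    and i: "integrable M (\<lambda>x. (f x)\<^sup>2)" "integrable M (\<lambda>x. (g x)\<^sup>2)"
  shows "(\<integral>x. f x * g x \<partial>M)\<^sup>2 \<le> (\<integral>x. (f x)\<^sup>2 \<partial>M) * (\<integral>x. (g x)\<^sup>2 \<partial>M)"
proof -
  define a b c where "a = (\<integral>x. (f x)\<^sup>2 \<partial>M)" and "b = (\<integral>x. f x * g x \<partial>M)" and "c = (\<integral>x. (g x)\<^sup>2 \<partial>M)"
  note fg = integrable_mult_of_squares[OF assms]
  have q: "0 \<le> a - 2 * t * b + t\<^sup>2 * c" for t
  proof -
    have "0 \<le> (\<integral>x. (f x - t * g x)\<^sup>2 \<partial>M)" by simp
    also have "\<dots> = (\<integral>x. (f x)\<^sup>2 - 2 * t * (f x * g x) + t\<^sup>2 * (g x)\<^sup>2 \<partial>M)"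
      by (intro Bochner_Integration.integral_cong refl) (auto simp: power2_eq_square algebra_simps)
    also have "\<dots> = a - 2 * t * b + t\<^sup>2 * c"
      unfolding a_def b_def c_def using i fg by simp
    finally show ?thesis .
  qed
  have c: "0 \<le> c" unfolding c_def by simp
  have "b\<^sup>2 \<le> a * c"
  proof (cases "c = 0")
    case True
    have "b = 0"
    proof (rule ccontr)
      assume "b \<noteq> 0"
      \<comment> \<open>With \<open>c = 0\<close> the quadratic is the affine function a - 2 t b,
        and this t gives it the value -1.\<close>
      then show False using q[of "(a + 1) / (2 * b)"] True by (simp add: field_simps)
    qed
    then show ?thesis using True by simp
  next
    case False
    then show ?thesis using q[of "b / c"] c by (simp add: field_simps power2_eq_square)
  qed
  then show ?thesis unfolding a_def b_def c_def .
qed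

section \<open>Truncated Fourier integrals tested against Gaussians\<close>

lemma gaussian_fourier_transform:
  fixes e z :: real
  assumes e: "e > 0"
  shows "(\<integral>\<xi>. of_real (exp (- (e * \<xi>)\<^sup>2 / 2)) * cis (z * \<xi>) \<partial>lborel) =
    complex_of_real (2 * pi * normal_density 0 e z)"
proof -
  have "complex_of_real (exp (- ((z / e)\<^sup>2) / 2)) = char std_normal_distribution (z / e)"
    by (simp add: char_std_normal_distribution)
  also have "\<dots> = (\<integral>x. std_normal_density x *\<^sub>R cis (z / e * x) \<partial>lborel)"
    unfolding char_def by (subst integral_density) (auto simp: cis_conv_exp)
  also have "\<dots> = e *\<^sub>R (\<integral>x. std_normal_density (e * x) *\<^sub>R cis (z * x) \<partial>lborel)"
    using e lborel_integral_real_affine[of e "\<lambda>x. std_normal_density x *\<^sub>R cis (z / e * x)" 0] by simp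
  also have "\<dots> = (e / sqrt (2 * pi)) *\<^sub>R (\<integral>\<xi>. of_real (exp (- (e * \<xi>)\<^sup>2 / 2)) * cis (z * \<xi>) \<partial>lborel)"
  proof -
    have "(\<integral>x. std_normal_density (e * x) *\<^sub>R cis (z * x) \<partial>lborel) =
      (\<integral>\<xi>. (1 / sqrt (2 * pi)) *\<^sub>R (of_real (exp (- (e * \<xi>)\<^sup>2 / 2)) * cis (z * \<xi>)) \<partial>lborel)"
      by (intro Bochner_Integration.integral_cong refl) (simp add: std_normal_density_def scaleR_conv_of_real)
    then show ?thesis by simp
  qed
  finally have "(\<integral>\<xi>. of_real (exp (- (e * \<xi>)\<^sup>2 / 2)) * cis (z * \<xi>) \<partial>lborel) = (sqrt (2 * pi) / e) *\<^sub>R complex_of_real (exp (- ((z / e)\<^sup>2) / 2))"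
    using e by simp
  also have "\<dots> = complex_of_real (2 * pi * normal_density 0 e z)"
  proof -
    have "sqrt (2 * pi) / e = 2 * pi / sqrt (2 * pi * e\<^sup>2)"
      using e by (simp add: real_sqrt_mult field_simps)
    moreover have "- ((z / e)\<^sup>2) / 2 = - ((z - 0)\<^sup>2) / (2 * e\<^sup>2)"
      using e by (simp add: field_simps)
    ultimately show ?thesis unfolding normal_density_def by (simp add: scaleR_conv_of_real)
  qed
  finally show ?thesis .
qed

text \<open>The inner integral of \<open>L2_fourier\<close>. A square-integrable f need not be
  integrable on the line, so only its truncations have a pointwise Fourier integral; the transform
  is their L^2 limit.\<close>

definition trunc_fourier :: "(real \<Rightarrow> real) \<Rightarrow> real \<Rightarrow> real \<Rightarrow> complex" where
  "trunc_fourier f R \<xi> = (\<integral>x. indicator {-R..R} x *\<^sub>R (of_real (f x) * cis (- x * \<xi>)) \<partial>lborel)"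

lemma cis_measurable [measurable]: "cis \<in> borel_measurable borel"
  by (intro borel_measurable_continuous_onI continuous_intros)

lemma trunc_fourier_measurable [measurable]:
  assumes [measurable]: "f \<in> borel_measurable borel"
  shows "trunc_fourier f R \<in> borel_measurable borel"
  unfolding trunc_fourier_def[abs_def] by measurable

lemma L2_fourier_alt:
  "L2_fourier f g \<longleftrightarrow> g \<in> borel_measurable borel \<and>
    ((\<lambda>R. \<integral>\<^sup>+ \<xi>. ennreal ((cmod (g \<xi> - trunc_fourier f R \<xi>))\<^sup>2) \<partial>lborel) \<longlongrightarrow> 0) at_top"
  unfolding L2_fourier_def trunc_fourier_def by simp

lemma integrable_trunc:
  fixes f :: "real \<Rightarrow> real"
  assumes [measurable]: "f \<in> borel_measurable borel" and "integrable lborel (\<lambda>x. (f x)\<^sup>2)"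
  shows "integrable lborel (\<lambda>x. indicator {-R..R} x * f x)"
proof (rule integrable_mult_of_squares)
  have "(\<lambda>x. (indicator {-R..R} x :: real)\<^sup>2) = indicator {-R..R}" by (auto simp: indicator_def)
  then show "integrable lborel (\<lambda>x. (indicator {-R..R} x :: real)\<^sup>2)"
    by (simp add: integrable_indicator_iff emeasure_lborel_Icc_eq)
qed (use assms in auto)

lemma gauss_integrable:
  fixes e :: real
  assumes "e > 0"
  shows "integrable lborel (\<lambda>\<xi>. exp (- (e * \<xi>)\<^sup>2 / 2))" "integrable lborel (\<lambda>\<xi>. (exp (- (e * \<xi>)\<^sup>2 / 2))\<^sup>2)"
proof -
  have 1: "integrable lborel (\<lambda>\<xi>. exp (- (e * \<xi>)\<^sup>2 / 2))" if "e > 0" for e :: real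
  proof -
    have "(\<lambda>\<xi>. exp (- (e * \<xi>)\<^sup>2 / 2)) = (\<lambda>\<xi>. sqrt (2 * pi) * normal_density 0 1 (0 + e * \<xi>))"
      by (auto simp: normal_density_def)
    moreover have "integrable lborel (\<lambda>\<xi>. normal_density 0 1 (0 + e * \<xi>))"
      using that by (intro lborel_integrable_real_affine) auto
    ultimately show ?thesis by simp
  qed
  then show "integrable lborel (\<lambda>\<xi>. exp (- (e * \<xi>)\<^sup>2 / 2))" using assms .
  have "(exp (- (e * \<xi>)\<^sup>2 / 2))\<^sup>2 = exp (- ((sqrt 2 * e) * \<xi>)\<^sup>2 / 2)" for \<xi>
    by (simp add: exp_double[symmetric] power_mult_distrib)
  then show "integrable lborel (\<lambda>\<xi>. (exp (- (e * \<xi>)\<^sup>2 / 2))\<^sup>2)" using 1[of "sqrt 2 * e"] assms by simp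
qed

text \<open>Truncated f and the Gaussian in \<open>\<xi>\<close> are both integrable, so Fubini
  applies; integrating in \<open>\<xi>\<close> first leaves the Gaussian transform at x - y, hence a
  convolution with a normal density of width e.\<close>

lemma trunc_fourier_gauss:
  fixes f :: "real \<Rightarrow> real"
  assumes [measurable]: "f \<in> borel_measurable borel" and f2: "integrable lborel (\<lambda>x. (f x)\<^sup>2)"
    and e: "e > 0"
  shows "(\<integral>\<xi>. trunc_fourier f R \<xi> * (of_real (exp (- (e * \<xi>)\<^sup>2 / 2)) * cis (x * \<xi>)) \<partial>lborel) =
    complex_of_real (2 * pi * (\<integral>y. indicator {-R..R} y * f y * normal_density 0 e (x - y) \<partial>lborel))"
proof -
  let ?m = "\<lambda>\<xi>. exp (- (e * \<xi>)\<^sup>2 / 2)" and ?h = "\<lambda>y. indicator {-R..R} y * f y"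
  have im: "integrable lborel ?m" by (rule gauss_integrable(1)[OF e])
  have ih: "integrable lborel ?h" by (rule integrable_trunc) (use f2 in auto)
  let ?H = "\<lambda>\<xi> y. (of_real (?h y * ?m \<xi>) * cis ((x - y) * \<xi>) :: complex)"
  have "integrable (lborel \<Otimes>\<^sub>M lborel) (case_prod (\<lambda>\<xi> y. ?m \<xi> * ?h y))"
  proof (rule lborel_pair.Fubini_integrable)
    show "integrable lborel (\<lambda>\<xi>. \<integral>y. norm (case (\<xi>, y) of (\<xi>, y) \<Rightarrow> ?m \<xi> * ?h y) \<partial>lborel)"
      using im by (simp add: abs_mult)
    show "AE \<xi> in lborel. integrable lborel (\<lambda>y. case (\<xi>, y) of (\<xi>, y) \<Rightarrow> ?m \<xi> * ?h y)"
      using ih by simp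
  qed measurable
  then have I: "integrable (lborel \<Otimes>\<^sub>M lborel) (case_prod ?H)"
    by (rule Bochner_Integration.integrable_bound) (auto simp: norm_mult abs_mult)
  have "(\<integral>\<xi>. trunc_fourier f R \<xi> * (of_real (?m \<xi>) * cis (x * \<xi>)) \<partial>lborel) = (\<integral>\<xi>. (\<integral>y. ?H \<xi> y \<partial>lborel) \<partial>lborel)"
  proof (intro Bochner_Integration.integral_cong refl)
    fix \<xi>
    have "trunc_fourier f R \<xi> * (of_real (?m \<xi>) * cis (x * \<xi>)) =
      (\<integral>y. indicator {-R..R} y *\<^sub>R (of_real (f y) * cis (- y * \<xi>)) * (of_real (?m \<xi>) * cis (x * \<xi>)) \<partial>lborel)"
      unfolding trunc_fourier_def by (rule integral_mult_left_zero[symmetric])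
    also have "\<dots> = (\<integral>y. ?H \<xi> y \<partial>lborel)"
    proof (intro Bochner_Integration.integral_cong refl)
      fix y
      have "cis ((x - y) * \<xi>) = cis (x * \<xi>) * cis (- y * \<xi>)" by (simp add: cis_mult algebra_simps)
      then show "indicator {-R..R} y *\<^sub>R (of_real (f y) * cis (- y * \<xi>)) * (of_real (?m \<xi>) * cis (x * \<xi>)) = ?H \<xi> y"
        by (auto simp: scaleR_conv_of_real indicator_def)
    qed
    finally show "trunc_fourier f R \<xi> * (of_real (?m \<xi>) * cis (x * \<xi>)) = (\<integral>y. ?H \<xi> y \<partial>lborel)" .
  qed
  also have "\<dots> = (\<integral>y. (\<integral>\<xi>. ?H \<xi> y \<partial>lborel) \<partial>lborel)"
    using lborel_pair.Fubini_integral[OF I] by simp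
  also have "\<dots> = (\<integral>y. complex_of_real (2 * pi * (?h y * normal_density 0 e (x - y))) \<partial>lborel)"
  proof (intro Bochner_Integration.integral_cong refl)
    fix y
    have "(\<integral>\<xi>. ?H \<xi> y \<partial>lborel) = (\<integral>\<xi>. of_real (?h y) * (of_real (?m \<xi>) * cis ((x - y) * \<xi>)) \<partial>lborel)"
      by (intro Bochner_Integration.integral_cong refl) simp
    also have "\<dots> = of_real (?h y) * (\<integral>\<xi>. of_real (?m \<xi>) * cis ((x - y) * \<xi>) \<partial>lborel)" by simp
    also have "\<dots> = complex_of_real (2 * pi * (?h y * normal_density 0 e (x - y)))"
      unfolding gaussian_fourier_transform[OF e] by simp
    finally show "(\<integral>\<xi>. ?H \<xi> y \<partial>lborel) = complex_of_real (2 * pi * (?h y * normal_density 0 e (x - y)))" .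
  qed
  also have "\<dots> = complex_of_real (2 * pi * (\<integral>y. ?h y * normal_density 0 e (x - y) \<partial>lborel))"
    by (simp only: integral_complex_of_real integral_mult_right_zero)
  finally show ?thesis .
qed

text \<open>A Bochner integral is 0 when its integrand is not integrable, so the limit of the
  integrals alone would say little. Integrability comes from the indices at which the extended
  integral is below 1.\<close>

lemma nn_integral_tendsto_0_imp_integral:
  fixes f :: "nat \<Rightarrow> 'a \<Rightarrow> real"
  assumes [measurable]: "\<And>n. f n \<in> borel_measurable M" and nn: "\<And>n x. 0 \<le> f n x"
    and lim: "(\<lambda>n. \<integral>\<^sup>+x. ennreal (f n x) \<partial>M) \<longlonglongrightarrow> 0"
  shows "eventually (\<lambda>n. integrable M (f n)) sequentially" "(\<lambda>n. \<integral>x. f n x \<partial>M) \<longlonglongrightarrow> 0"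
proof -
  have "eventually (\<lambda>n. (\<integral>\<^sup>+x. ennreal (f n x) \<partial>M) < 1) sequentially"
    using lim by (rule order_tendstoD) simp
  then show I: "eventually (\<lambda>n. integrable M (f n)) sequentially"
  proof eventually_elim
    case (elim n)
    then show ?case using nn by (intro integrableI_nonneg) (auto intro: less_trans ennreal_one_less_top)
  qed
  have "(\<lambda>n. enn2real (\<integral>\<^sup>+x. ennreal (f n x) \<partial>M)) \<longlonglongrightarrow> enn2real 0"
    using lim by (intro tendsto_enn2real) auto
  moreover have "enn2real (\<integral>\<^sup>+x. ennreal (f n x) \<partial>M) = (\<integral>x. f n x \<partial>M)" for n
    using nn by (subst integral_eq_nn_integral) auto
  ultimately show "(\<lambda>n. \<integral>x. f n x \<partial>M) \<longlonglongrightarrow> 0" by simp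
qed

lemma L2_fourier_sequence:
  assumes [measurable]: "f \<in> borel_measurable borel" and "L2_fourier f g"
  shows "eventually (\<lambda>n. integrable lborel (\<lambda>\<xi>. (cmod (g \<xi> - trunc_fourier f (real n) \<xi>))\<^sup>2)) sequentially"
    "(\<lambda>n. \<integral>\<xi>. (cmod (g \<xi> - trunc_fourier f (real n) \<xi>))\<^sup>2 \<partial>lborel) \<longlonglongrightarrow> 0"
proof -
  have [measurable]: "g \<in> borel_measurable borel" using assms(2) by (simp add: L2_fourier_alt)
  have "(\<lambda>n. \<integral>\<^sup>+ \<xi>. ennreal ((cmod (g \<xi> - trunc_fourier f (real n) \<xi>))\<^sup>2) \<partial>lborel) \<longlonglongrightarrow> 0"
    using assms(2) unfolding L2_fourier_alt
    by (auto elim: filterlim_compose[OF _ filterlim_real_sequentially])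
  from nn_integral_tendsto_0_imp_integral[OF _ _ this]
  show "eventually (\<lambda>n. integrable lborel (\<lambda>\<xi>. (cmod (g \<xi> - trunc_fourier f (real n) \<xi>))\<^sup>2)) sequentially"
    "(\<lambda>n. \<integral>\<xi>. (cmod (g \<xi> - trunc_fourier f (real n) \<xi>))\<^sup>2 \<partial>lborel) \<longlonglongrightarrow> 0" by auto
qed

lemma cmod_add_sq_le: "(cmod (a - b))\<^sup>2 \<le> 2 * (cmod (a - c))\<^sup>2 + 2 * (cmod (b - c))\<^sup>2"
proof -
  have "cmod (a - b) \<le> cmod (a - c) + cmod (b - c)"
    using norm_triangle_ineq4[of "a - c" "b - c"] by simp
  then have "(cmod (a - b))\<^sup>2 \<le> (cmod (a - c) + cmod (b - c))\<^sup>2" by (intro power_mono) auto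
  also have "\<dots> \<le> 2 * (cmod (a - c))\<^sup>2 + 2 * (cmod (b - c))\<^sup>2"
    using zero_le_power2[of "cmod (a - c) - cmod (b - c)"] by (simp add: power2_sum power2_diff)
  finally show ?thesis .
qed

text \<open>\<open>Hs_norm\<close> picks a transform by \<open>SOME\<close>, and this frees its
  value from the choice. Both candidates are L^2 limits of the same truncations.\<close>

lemma L2_fourier_unique:
  assumes [measurable]: "f \<in> borel_measurable borel" and g: "L2_fourier f g" and h: "L2_fourier f h"
  shows "AE \<xi> in lborel. g \<xi> = h \<xi>"
proof -
  have [measurable]: "g \<in> borel_measurable borel" "h \<in> borel_measurable borel"
    using g h by (simp_all add: L2_fourier_alt)
  let ?I = "\<lambda>g n. (\<integral>\<xi>. (cmod (g \<xi> - trunc_fourier f (real n) \<xi>))\<^sup>2 \<partial>lborel)"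
  let ?d = "\<lambda>\<xi>. (cmod (g \<xi> - h \<xi>))\<^sup>2"
  have ev: "eventually (\<lambda>n. integrable lborel ?d \<and> (\<integral>\<xi>. ?d \<xi> \<partial>lborel) \<le> 2 * ?I g n + 2 * ?I h n) sequentially"
    using L2_fourier_sequence(1)[OF assms(1) g] L2_fourier_sequence(1)[OF assms(1) h]
  proof eventually_elim
    case (elim n)
    let ?b = "\<lambda>\<xi>. 2 * (cmod (g \<xi> - trunc_fourier f (real n) \<xi>))\<^sup>2 + 2 * (cmod (h \<xi> - trunc_fourier f (real n) \<xi>))\<^sup>2"
    have b: "integrable lborel ?b" using elim by simp
    have i: "integrable lborel ?d"
      by (rule Bochner_Integration.integrable_bound[OF b]) (auto simp: cmod_add_sq_le)
    have "(\<integral>\<xi>. ?d \<xi> \<partial>lborel) \<le> (\<integral>\<xi>. ?b \<xi> \<partial>lborel)"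
      by (intro integral_mono i b cmod_add_sq_le)
    then show ?case using i elim by simp
  qed
  then have i: "integrable lborel ?d" by (auto dest: eventually_happens)
  have "(\<lambda>n. 2 * ?I g n + 2 * ?I h n) \<longlonglongrightarrow> 2 * 0 + 2 * 0"
    by (intro tendsto_intros L2_fourier_sequence(2) g h) auto
  then have "(\<lambda>n. 2 * ?I g n + 2 * ?I h n) \<longlonglongrightarrow> 0" by simp
  then have "(\<integral>\<xi>. ?d \<xi> \<partial>lborel) \<le> 0"
    by (rule tendsto_lowerbound) (use ev in \<open>auto elim: eventually_mono\<close>)
  then have "(\<integral>\<xi>. ?d \<xi> \<partial>lborel) = 0" by (simp add: order_antisym)
  then have "AE \<xi> in lborel. ?d \<xi> = 0"
    using integral_nonneg_eq_0_iff_AE[OF i] by simp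
  then show ?thesis by simp
qed

lemma integrable_normal_density_sq:
  assumes "e > 0"
  shows "integrable lborel (\<lambda>y. normal_density 0 e (x - y))" "(\<integral>y. normal_density 0 e (x - y) \<partial>lborel) = 1"
    "integrable lborel (\<lambda>y. (normal_density 0 e (x - y))\<^sup>2)"
proof -
  show 1: "integrable lborel (\<lambda>y. normal_density 0 e (x - y))"
    using lborel_integrable_real_affine[of "normal_density 0 e" "-1" x] assms by simp
  show "(\<integral>y. normal_density 0 e (x - y) \<partial>lborel) = 1"
    using lborel_integral_real_affine[of "-1" "normal_density 0 e" x] assms by simp
  let ?c = "1 / sqrt (2 * pi * e\<^sup>2)"
  have b: "normal_density 0 e z \<le> ?c" for z
  proof -
    have "?c * exp (- ((z - 0)\<^sup>2) / (2 * e\<^sup>2)) \<le> ?c * 1" by (intro mult_left_mono) auto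
    then show ?thesis unfolding normal_density_def by (simp only: mult_1_right)
  qed
  show "integrable lborel (\<lambda>y. (normal_density 0 e (x - y))\<^sup>2)"
  proof (rule Bochner_Integration.integrable_bound)
    show "integrable lborel (\<lambda>y. ?c * normal_density 0 e (x - y))" using 1 by simp
    have "(normal_density 0 e z)\<^sup>2 \<le> ?c * normal_density 0 e z" for z
      unfolding power2_eq_square[of "normal_density 0 e z"] by (rule mult_right_mono[OF b]) simp
    then show "AE y in lborel. norm ((normal_density 0 e (x - y))\<^sup>2) \<le> norm (?c * normal_density 0 e (x - y))"
      by (auto simp: abs_mult)
  qed simp
qed

text \<open>Testing against a Gaussian replaces the Fourier inversion theorem.\<close>
lemma L2_fourier_gauss:
  fixes f :: "real \<Rightarrow> real"
  assumes f[measurable]: "f \<in> borel_measurable borel" and f2: "integrable lborel (\<lambda>x. (f x)\<^sup>2)"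
    and g: "L2_fourier f g" and g2: "integrable lborel (\<lambda>x. (cmod (g x))\<^sup>2)" and e: "e > 0"
  shows "(\<integral>\<xi>. g \<xi> * (of_real (exp (- (e * \<xi>)\<^sup>2 / 2)) * cis (x * \<xi>)) \<partial>lborel) =
    complex_of_real (2 * pi * (\<integral>y. f y * normal_density 0 e (x - y) \<partial>lborel))"
\<comment> \<open>Both sides are limits of the truncated transforms tested against the Gaussian: the
  left one by L^2 convergence and Cauchy-Schwarz, the right one by
  \<open>trunc_fourier_gauss\<close> and dominated convergence.\<close>
proof (rule LIMSEQ_unique)
  let ?m = "\<lambda>\<xi>. exp (- (e * \<xi>)\<^sup>2 / 2)" and ?k = "\<lambda>y. normal_density 0 e (x - y)"
  let ?M = "\<lambda>\<xi>. complex_of_real (?m \<xi>) * cis (x * \<xi>)" and ?F = "\<lambda>n. trunc_fourier f (real n)"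
  have [measurable]: "g \<in> borel_measurable borel" using g by (simp add: L2_fourier_alt)
  have nM: "cmod (?M \<xi>) = ?m \<xi>" for \<xi> by (simp add: norm_mult)
  have igM: "integrable lborel (\<lambda>\<xi>. g \<xi> * ?M \<xi>)"
  proof (rule Bochner_Integration.integrable_bound)
    show "integrable lborel (\<lambda>\<xi>. cmod (g \<xi>) * ?m \<xi>)"
      by (rule integrable_mult_of_squares) (use g2 gauss_integrable[OF e] in auto)
  qed (auto simp: norm_mult)
  let ?D = "\<lambda>n. (\<integral>\<xi>. (cmod (g \<xi> - ?F n \<xi>))\<^sup>2 \<partial>lborel)" and ?c = "(\<integral>\<xi>. (?m \<xi>)\<^sup>2 \<partial>lborel)"
  have ev: "eventually (\<lambda>n. cmod ((\<integral>\<xi>. ?F n \<xi> * ?M \<xi> \<partial>lborel) - (\<integral>\<xi>. g \<xi> * ?M \<xi> \<partial>lborel)) \<le> sqrt (?D n * ?c)) sequentially"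
    using L2_fourier_sequence(1)[OF f g]
  proof eventually_elim
    case (elim n)
    have a: "integrable lborel (\<lambda>\<xi>. cmod (g \<xi> - ?F n \<xi>) * ?m \<xi>)"
      by (rule integrable_mult_of_squares) (use elim gauss_integrable[OF e] in auto)
    have b: "integrable lborel (\<lambda>\<xi>. (g \<xi> - ?F n \<xi>) * ?M \<xi>)"
      by (rule Bochner_Integration.integrable_bound[OF a]) (auto simp: norm_mult)
    have "integrable lborel (\<lambda>\<xi>. g \<xi> * ?M \<xi> - (g \<xi> - ?F n \<xi>) * ?M \<xi>)" using igM b by simp
    then have F: "integrable lborel (\<lambda>\<xi>. ?F n \<xi> * ?M \<xi>)" by (simp add: algebra_simps)
    have "cmod ((\<integral>\<xi>. ?F n \<xi> * ?M \<xi> \<partial>lborel) - (\<integral>\<xi>. g \<xi> * ?M \<xi> \<partial>lborel)) = cmod (\<integral>\<xi>. (g \<xi> - ?F n \<xi>) * ?M \<xi> \<partial>lborel)"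
      using F igM by (simp add: left_diff_distrib norm_minus_commute)
    also have "\<dots> \<le> (\<integral>\<xi>. cmod ((g \<xi> - ?F n \<xi>) * ?M \<xi>) \<partial>lborel)" by (rule integral_norm_bound)
    also have "\<dots> = (\<integral>\<xi>. cmod (g \<xi> - ?F n \<xi>) * ?m \<xi> \<partial>lborel)" by (simp add: norm_mult)
    also have "\<dots> \<le> sqrt (?D n * ?c)"
      by (rule real_le_rsqrt, rule Cauchy_Schwarz_integral) (use elim gauss_integrable[OF e] in auto)
    finally show ?case .
  qed
  have "(\<lambda>n. sqrt (?D n * ?c)) \<longlonglongrightarrow> sqrt (0 * ?c)"
    by (intro tendsto_intros L2_fourier_sequence(2)[OF f g])
  then have "(\<lambda>n. sqrt (?D n * ?c)) \<longlonglongrightarrow> 0" by simp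
  then have "(\<lambda>n. (\<integral>\<xi>. ?F n \<xi> * ?M \<xi> \<partial>lborel) - (\<integral>\<xi>. g \<xi> * ?M \<xi> \<partial>lborel)) \<longlonglongrightarrow> 0"
    by (rule Lim_null_comparison[OF ev])
  then show "(\<lambda>n. \<integral>\<xi>. ?F n \<xi> * ?M \<xi> \<partial>lborel) \<longlonglongrightarrow> (\<integral>\<xi>. g \<xi> * ?M \<xi> \<partial>lborel)"
    by (simp add: LIM_zero_iff)
  have fk: "integrable lborel (\<lambda>y. f y * ?k y)"
    by (rule integrable_mult_of_squares) (use f2 integrable_normal_density_sq[OF e] in auto)
  have "(\<lambda>n. \<integral>y. indicator {-real n..real n} y * f y * ?k y \<partial>lborel) \<longlonglongrightarrow> (\<integral>y. f y * ?k y \<partial>lborel)"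
  proof (rule integral_dominated_convergence)
    show "integrable lborel (\<lambda>y. \<bar>f y * ?k y\<bar>)" using fk by simp
    show "AE y in lborel. (\<lambda>n. indicator {-real n..real n} y * f y * ?k y) \<longlonglongrightarrow> f y * ?k y"
    proof (rule AE_I2, rule tendsto_eventually)
      fix y :: real
      obtain N where "\<bar>y\<bar> \<le> real N" using real_arch_simple by blast
      then show "eventually (\<lambda>n. indicator {-real n..real n} y * f y * ?k y = f y * ?k y) sequentially"
        by (auto simp: eventually_sequentially indicator_def intro!: exI[of _ N])
    qed
  qed (auto simp: indicator_def)
  then have "(\<lambda>n. complex_of_real (2 * pi * (\<integral>y. indicator {-real n..real n} y * f y * ?k y \<partial>lborel)))
     \<longlonglongrightarrow> complex_of_real (2 * pi * (\<integral>y. f y * ?k y \<partial>lborel))"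
    by (intro tendsto_intros)
  then show "(\<lambda>n. \<integral>\<xi>. ?F n \<xi> * ?M \<xi> \<partial>lborel) \<longlonglongrightarrow> complex_of_real (2 * pi * (\<integral>y. f y * ?k y \<partial>lborel))"
    unfolding trunc_fourier_gauss[OF f f2 e] .
qed

section \<open>Recovering point values from Gaussian averages\<close>

lemma integrable_inverse_1_plus_square_real: "integrable lborel (\<lambda>x::real. inverse (1 + x\<^sup>2))"
  using integrable_inverse_1_plus_square(1) 
  by (simp add: set_integrable_def einterval_def)

text \<open>From exp(-w) <= 1/w at w = z^2 / (2 e^2). This gains e^2 against the 1/e of the
  normalisation, and the factor e left over sends the far part of a Gaussian average to 0.\<close>

lemma gauss_kernel_tail:
  fixes e z :: real
  assumes e: "e > 0" and z: "z \<noteq> 0"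
  shows "normal_density 0 e z \<le> e / z\<^sup>2"
proof -
  let ?w = "z\<^sup>2 / (2 * e\<^sup>2)"
  have w: "?w > 0" using e z by simp
  have "?w \<le> exp ?w" using exp_ge_add_one_self[of ?w] by linarith
  then have "1 / exp ?w \<le> 1 / ?w" using w by (intro frac_le) auto
  then have "exp (- ?w) \<le> 1 / ?w" by (simp only: exp_minus inverse_eq_divide)
  moreover have "1 / sqrt (2 * pi * e\<^sup>2) \<le> 1 / (2 * e)"
  proof -
    have "2 \<le> sqrt (2 * pi)" using pi_gt3 by (intro real_le_rsqrt) simp
    then have "2 * e \<le> sqrt (2 * pi * e\<^sup>2)" using e by (simp add: real_sqrt_mult)
    then show ?thesis using e by (intro frac_le) auto
  qed
  ultimately have "1 / sqrt (2 * pi * e\<^sup>2) * exp (- ?w) \<le> 1 / (2 * e) * (1 / ?w)"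
    using e by (intro mult_mono) auto
  also have "\<dots> = e / z\<^sup>2" using e z by (simp add: power2_eq_square)
  finally show ?thesis by (simp add: normal_density_def)
qed

text \<open>f is continuous at x and square-integrable but possibly unbounded elsewhere. Far from x,
  |f| / z^2 is therefore split as at most f^2 + 1/z^4, both integrable there; the bound is e times a
  fixed integral.\<close>

lemma gauss_approximation:
  fixes f :: "real \<Rightarrow> real"
  assumes f[measurable]: "f \<in> borel_measurable borel" and f2: "integrable lborel (\<lambda>x. (f x)\<^sup>2)" and c: "isCont f x"
  shows "(\<lambda>n. \<integral>y. f y * normal_density 0 (1 / real (Suc n)) (x - y) \<partial>lborel) \<longlonglongrightarrow> f x"
proof (rule LIMSEQ_I)
  fix r :: real assume r: "r > 0"
  define \<eta> where "\<eta> = r / 2"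
  have \<eta>: "\<eta> > 0" using r by (simp add: \<eta>_def)
  from c[unfolded continuous_at_eps_delta, rule_format, OF \<eta>]
  obtain \<delta> where \<delta>: "\<delta> > 0" and d: "\<And>y. \<bar>y - x\<bar> < \<delta> \<Longrightarrow> \<bar>f y - f x\<bar> < \<eta>"
    by (auto simp: dist_real_def)
  \<comment> \<open>For |z| >= \<open>\<delta>\<close>, 1/z^2 = (1 + 1/z^2) / (1 + z^2) is at most c
    / (1 + z^2). In \<open>c'\<close>, the part \<open>c\<^sup>2\<close> pays for 1/z^4 and the
    other for |f x| / z^2.\<close>
  define c where "c = 1 + 1 / \<delta>\<^sup>2"
  define c' where "c' = c\<^sup>2 + \<bar>f x\<bar> * c"
  have c1: "c \<ge> 1" using \<delta> by (simp add: c_def)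
  let ?q = "\<lambda>y. inverse (1 + (x - y)\<^sup>2)"
  have iq: "integrable lborel ?q"
    using lborel_integrable_real_affine[OF integrable_inverse_1_plus_square_real, of "-1" x] by simp
  define K where "K = (\<integral>y. (f y)\<^sup>2 + c' * ?q y \<partial>lborel)"
  have ptw: "\<bar>(f y - f x) * normal_density 0 e (x - y)\<bar> \<le> \<eta> * normal_density 0 e (x - y) + e * ((f y)\<^sup>2 + c' * ?q y)"
    if e: "e > 0" for e y
  proof (cases "\<bar>y - x\<bar> < \<delta>")
    case True
    have "\<bar>f y - f x\<bar> * normal_density 0 e (x - y) \<le> \<eta> * normal_density 0 e (x - y)"
      using d[OF True] by (intro mult_right_mono) auto
    moreover have "0 \<le> e * ((f y)\<^sup>2 + c' * ?q y)" using e c1 by (simp add: c'_def)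
    ultimately show ?thesis by (simp add: abs_mult)
  next
    case False
    let ?z = "x - y"
    have zd: "\<delta> \<le> \<bar>?z\<bar>" using False by simp
    then have z: "?z \<noteq> 0" using \<delta> by auto
    have zd2: "\<delta>\<^sup>2 \<le> ?z\<^sup>2" using power_mono[OF zd, of 2] \<delta> by simp
    have iz: "1 / ?z\<^sup>2 \<le> 1 / \<delta>\<^sup>2" using zd2 \<delta> z by (intro frac_le) auto
    have w: "1 / w = (1 + 1 / w) * inverse (1 + w)" if "w > 0" for w :: real
      using that by (simp add: field_simps)
    have "1 / ?z\<^sup>2 = (1 + 1 / ?z\<^sup>2) * ?q y" by (rule w) (use z in simp)
    also have "\<dots> \<le> c * ?q y" unfolding c_def using iz by (intro mult_right_mono) auto
    finally have a: "1 / ?z\<^sup>2 \<le> c * ?q y" .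
    have "(1 / ?z\<^sup>2)\<^sup>2 \<le> c * (c * ?q y)" unfolding power2_eq_square
      using a iz c1 by (intro mult_mono) (auto simp: c_def power2_eq_square)
    then have b: "(1 / ?z\<^sup>2)\<^sup>2 \<le> c\<^sup>2 * ?q y" by (simp add: power2_eq_square mult.assoc)
    have y: "\<bar>f y\<bar> * (1 / ?z\<^sup>2) \<le> (f y)\<^sup>2 + (1 / ?z\<^sup>2)\<^sup>2"
    proof -
      have "2 * (\<bar>f y\<bar> * (1 / ?z\<^sup>2)) \<le> (f y)\<^sup>2 + (1 / ?z\<^sup>2)\<^sup>2"
        using zero_le_power2[of "\<bar>f y\<bar> - 1 / ?z\<^sup>2"] unfolding power2_diff power2_abs by linarith
      moreover have "0 \<le> \<bar>f y\<bar> * (1 / ?z\<^sup>2)" by simp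
      ultimately show ?thesis by linarith
    qed
    have "\<bar>f y - f x\<bar> * normal_density 0 e ?z \<le> (\<bar>f y\<bar> + \<bar>f x\<bar>) * (e / ?z\<^sup>2)"
      using gauss_kernel_tail[OF e z] by (intro mult_mono) auto
    also have "\<dots> = e * (\<bar>f y\<bar> * (1 / ?z\<^sup>2) + \<bar>f x\<bar> * (1 / ?z\<^sup>2))" by (simp add: algebra_simps add_divide_distrib)
    also have "\<dots> \<le> e * (((f y)\<^sup>2 + c\<^sup>2 * ?q y) + \<bar>f x\<bar> * (c * ?q y))"
      using y b a e by (intro mult_left_mono add_mono) auto
    also have "\<dots> = e * ((f y)\<^sup>2 + c' * ?q y)" by (simp add: c'_def algebra_simps)
    finally have "\<bar>f y - f x\<bar> * normal_density 0 e ?z \<le> e * ((f y)\<^sup>2 + c' * ?q y)" .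
    moreover have "0 \<le> \<eta> * normal_density 0 e (x - y)" using \<eta> by simp
    ultimately show ?thesis by (simp add: abs_mult)
  qed
  have main: "\<bar>(\<integral>y. f y * normal_density 0 e (x - y) \<partial>lborel) - f x\<bar> \<le> \<eta> + e * K" if e: "e > 0" for e
  proof -
    note k = integrable_normal_density_sq[OF e, of x]
    have fk: "integrable lborel (\<lambda>y. f y * normal_density 0 e (x - y))"
      by (rule integrable_mult_of_squares) (use f2 k in auto)
    have "(\<integral>y. f y * normal_density 0 e (x - y) \<partial>lborel) - f x = (\<integral>y. (f y - f x) * normal_density 0 e (x - y) \<partial>lborel)"
      using fk k by (simp add: left_diff_distrib)
    also have "\<bar>\<dots>\<bar> \<le> (\<integral>y. \<eta> * normal_density 0 e (x - y) + e * ((f y)\<^sup>2 + c' * ?q y) \<partial>lborel)"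
    proof (rule order_trans[OF integral_abs_bound], rule integral_mono)
      show "integrable lborel (\<lambda>y. \<bar>(f y - f x) * normal_density 0 e (x - y)\<bar>)"
        using fk k by (simp add: left_diff_distrib)
      show "integrable lborel (\<lambda>y. \<eta> * normal_density 0 e (x - y) + e * ((f y)\<^sup>2 + c' * ?q y))"
        using k iq f2 by simp
    qed (rule ptw[OF e])
    also have "\<dots> = \<eta> + e * K"
      unfolding K_def using k iq f2 by simp
    finally show ?thesis .
  qed
  have K0: "K \<ge> 0" unfolding K_def using c1 by (intro Bochner_Integration.integral_nonneg) (auto simp: c'_def)
  have "(\<lambda>n. \<eta> + 1 / real (Suc n) * K) \<longlonglongrightarrow> \<eta> + 0 * K"
    by (intro tendsto_intros LIMSEQ_Suc lim_1_over_n)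
  then have "eventually (\<lambda>n. \<eta> + 1 / real (Suc n) * K < r) sequentially"
    by (rule order_tendstoD) (use r in \<open>simp add: \<eta>_def\<close>)
  then obtain N where N: "\<And>n. n \<ge> N \<Longrightarrow> \<eta> + 1 / real (Suc n) * K < r" by (auto simp: eventually_sequentially)
  show "\<exists>N. \<forall>n\<ge>N. norm ((\<integral>y. f y * normal_density 0 (1 / real (Suc n)) (x - y) \<partial>lborel) - f x) < r"
  proof (intro exI allI impI)
    fix n assume "n \<ge> N"
    have "0 < 1 / real (Suc n)" by simp
    from main[OF this] N[OF \<open>n \<ge> N\<close>]
    show "norm ((\<integral>y. f y * normal_density 0 (1 / real (Suc n)) (x - y) \<partial>lborel) - f x) < r"
      unfolding real_norm_def by (rule le_less_trans)
  qed
qed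

section \<open>Pointwise Sobolev bounds\<close>

lemma integrable_japanese_bracket:
  fixes a :: real
  assumes a: "a > 1/2"
  shows "integrable lborel (\<lambda>\<xi>::real. (1 + \<xi>\<^sup>2) powr (- a))"
proof -
  let ?h = "\<lambda>x::real. indicator {1..} x * x powr (- 2 * a)"
  have "((\<lambda>x::real. x powr (- 2 * a)) has_integral -(1 powr (- 2 * a + 1)) / (- 2 * a + 1)) {1..}"
    by (rule has_integral_powr_to_inf) (use a in auto)
  then have "(\<lambda>x::real. x powr (- 2 * a)) absolutely_integrable_on {1..}"
    by (intro nonnegative_absolutely_integrable_1) auto
  then have "set_integrable lborel {1..} (\<lambda>x::real. x powr (- 2 * a))"
    unfolding set_integrable_def by (subst (asm) integrable_completion) auto
  then have h: "integrable lborel ?h" by (simp add: set_integrable_def)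
  then have h': "integrable lborel (\<lambda>x. ?h (- x))"
    using lborel_integrable_real_affine[of ?h "-1" 0] by simp
  have i: "integrable lborel (indicator {-1..1::real} :: real \<Rightarrow> real)"
    by (simp add: integrable_indicator_iff emeasure_lborel_Icc_eq)
  show ?thesis
  proof (rule Bochner_Integration.integrable_bound)
    show "integrable lborel (\<lambda>x. ?h x + ?h (- x) + indicator {-1..1} x)" using h h' i by simp
    have key: "(1 + x\<^sup>2) powr (- a) \<le> \<bar>x\<bar> powr (- 2 * a)" if "\<bar>x\<bar> \<ge> 1" for x :: real
    proof -
      have "(1 + x\<^sup>2) powr (- a) \<le> (\<bar>x\<bar>\<^sup>2) powr (- a)"
        using a that by (intro powr_mono2') auto
      also have "\<bar>x\<bar>\<^sup>2 = \<bar>x\<bar> powr 2" using that by simp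
      also have "(\<bar>x\<bar> powr 2) powr (- a) = \<bar>x\<bar> powr (- 2 * a)" by (simp only: powr_powr mult_minus_right mult_minus_left)
      finally show ?thesis .
    qed
    have "(1 + x\<^sup>2) powr (- a) \<le> ?h x + ?h (- x) + indicator {-1..1} x" for x :: real
    proof (cases "\<bar>x\<bar> \<ge> 1")
      case True
      then have "\<bar>x\<bar> powr (- 2 * a) \<le> ?h x + ?h (- x) + indicator {-1..1} x"
        by (cases "x \<ge> 0") (auto simp: indicator_def)
      then show ?thesis using key[OF True] by linarith
    next
      case False
      then have "(1 + x\<^sup>2) powr (- a) \<le> 1" using a powr_mono2'[of "- a" 1 "1 + x\<^sup>2"] by simp
      moreover have "1 \<le> ?h x + ?h (- x) + indicator {-1..1} x" using False by (auto simp: indicator_def)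
      ultimately show ?thesis by linarith
    qed
    then show "AE x in lborel. norm ((1 + x\<^sup>2) powr (- a)) \<le> norm (?h x + ?h (- x) + indicator {-1..1} x)"
      by (auto intro!: AE_I2 order_trans[OF _ abs_ge_self])
  qed simp
qed

lemma cmod_cis_diff_le: "cmod (cis a - cis b) \<le> \<bar>a - b\<bar>"
proof -
  have "cis a - cis b = cis b * (cis (a - b) - 1)" by (simp add: algebra_simps cis_mult)
  then have "cmod (cis a - cis b) = cmod (iexp (a - b) - 1)" by (simp add: norm_mult cis_conv_exp)
  also have "\<dots> \<le> \<bar>a - b\<bar>" using iexp_approx1[of "a - b" 0] by simp
  finally show ?thesis .
qed

text \<open>The function sqrt(1 + xi^2) |g| is a product of (1 + xi^2)^((1-s)/2) and (1 +
  xi^2)^(s/2) |g|; the first factor is in L^2 exactly when s > 3/2. The Gaussian averages of f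
  satisfy both bounds uniformly, and the bounds pass to the limit. A Lipschitz bound stands in for
  one on f', so that nothing is differentiated under the integral.\<close>

lemma sobolev_embedding_pointwise:
  fixes f :: "real \<Rightarrow> real" and s :: real
  assumes s: "s > 3/2" and cont: "continuous_on UNIV f" and f2: "integrable lborel (\<lambda>x. (f x)\<^sup>2)"
    and g: "L2_fourier f g" and w: "integrable lborel (\<lambda>\<xi>. (1 + \<xi>\<^sup>2) powr s * (cmod (g \<xi>))\<^sup>2)"
  defines "B \<equiv> sqrt ((integral\<^sup>L lborel (\<lambda>\<xi>::real. (1 + \<xi>\<^sup>2) powr (1 - s))) * (\<integral>\<xi>. (1 + \<xi>\<^sup>2) powr s * (cmod (g \<xi>))\<^sup>2 \<partial>lborel))"
  shows "\<bar>f x\<bar> \<le> B" "\<bar>f x - f y\<bar> \<le> B * \<bar>x - y\<bar>"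
proof -
  have [measurable]: "f \<in> borel_measurable borel" using cont by (rule borel_measurable_continuous_onI)
  have [measurable]: "g \<in> borel_measurable borel" using g by (simp add: L2_fourier_alt)
  have pos: "0 < 1 + \<xi>\<^sup>2" for \<xi> :: real by (simp add: add_pos_nonneg)
  let ?a = "\<lambda>\<xi>::real. (1 + \<xi>\<^sup>2) powr ((1 - s) / 2)" and ?b = "\<lambda>\<xi>. (1 + \<xi>\<^sup>2) powr (s / 2) * cmod (g \<xi>)"
  have a2: "(?a \<xi>)\<^sup>2 = (1 + \<xi>\<^sup>2) powr (1 - s)" for \<xi>
    by (simp add: power2_eq_square powr_add[symmetric])
  have b2: "(?b \<xi>)\<^sup>2 = (1 + \<xi>\<^sup>2) powr s * (cmod (g \<xi>))\<^sup>2" for \<xi>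
    by (simp add: power_mult_distrib) (simp add: power2_eq_square powr_add[symmetric])
  have ab: "?a \<xi> * ?b \<xi> = sqrt (1 + \<xi>\<^sup>2) * cmod (g \<xi>)" for \<xi>
  proof -
    have "?a \<xi> * (1 + \<xi>\<^sup>2) powr (s / 2) = (1 + \<xi>\<^sup>2) powr (1/2)"
      by (simp add: powr_add[symmetric] field_simps)
    then show ?thesis using pos[of \<xi>] by (simp add: powr_half_sqrt mult.assoc[symmetric])
  qed
  have ia: "integrable lborel (\<lambda>\<xi>. (?a \<xi>)\<^sup>2)"
    unfolding a2 using integrable_japanese_bracket[of "s - 1"] s by simp
  have ib: "integrable lborel (\<lambda>\<xi>. (?b \<xi>)\<^sup>2)" unfolding b2 by (rule w)
  let ?G = "\<lambda>\<xi>. sqrt (1 + \<xi>\<^sup>2) * cmod (g \<xi>)"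
  have iG: "integrable lborel ?G"
    unfolding ab[symmetric] by (rule integrable_mult_of_squares) (use ia ib in auto)
  have "(\<integral>\<xi>. ?a \<xi> * ?b \<xi> \<partial>lborel)\<^sup>2 \<le> (\<integral>\<xi>. (?a \<xi>)\<^sup>2 \<partial>lborel) * (\<integral>\<xi>. (?b \<xi>)\<^sup>2 \<partial>lborel)"
    by (rule Cauchy_Schwarz_integral) (use ia ib in auto)
  then have GB: "(\<integral>\<xi>. ?G \<xi> \<partial>lborel) \<le> B"
    unfolding ab a2 b2 B_def by (rule real_le_rsqrt)
  have g2: "integrable lborel (\<lambda>\<xi>. (cmod (g \<xi>))\<^sup>2)"
  proof (rule Bochner_Integration.integrable_bound[OF w])
    have "1 \<le> (1 + \<xi>\<^sup>2) powr s" for \<xi> :: real using s by (intro ge_one_powr_ge_zero) auto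
    then have "1 * (cmod (g \<xi>))\<^sup>2 \<le> (1 + \<xi>\<^sup>2) powr s * (cmod (g \<xi>))\<^sup>2" for \<xi> by (intro mult_right_mono) auto
    then show "AE \<xi> in lborel. norm ((cmod (g \<xi>))\<^sup>2) \<le> norm ((1 + \<xi>\<^sup>2) powr s * (cmod (g \<xi>))\<^sup>2)" by simp
  qed simp
  define k where "k n x = (\<integral>y. f y * normal_density 0 (1 / real (Suc n)) (x - y) \<partial>lborel)" for n x
  have lim: "(\<lambda>n. k n x) \<longlonglongrightarrow> f x" for x
    unfolding k_def by (rule gauss_approximation) (use f2 cont in \<open>auto simp: continuous_on_eq_continuous_at\<close>)
  let ?M = "\<lambda>n x \<xi>. complex_of_real (exp (- (1 / real (Suc n) * \<xi>)\<^sup>2 / 2)) * cis (x * \<xi>)"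
  have k: "complex_of_real (2 * pi * k n x) = (\<integral>\<xi>. g \<xi> * ?M n x \<xi> \<partial>lborel)" for n x
    unfolding k_def by (rule L2_fourier_gauss[symmetric]) (use f2 g g2 in auto)
  have e1: "exp (- (1 / real (Suc n) * \<xi>)\<^sup>2 / 2) \<le> 1" for n \<xi> by simp
  have s1: "1 \<le> sqrt (1 + \<xi>\<^sup>2)" "\<bar>\<xi>\<bar> \<le> sqrt (1 + \<xi>\<^sup>2)" for \<xi> :: real
    by (auto intro!: real_le_rsqrt)
  have n1: "cmod (g \<xi> * ?M n x \<xi>) \<le> ?G \<xi>" for n x \<xi>
  proof -
    have "cmod (g \<xi> * ?M n x \<xi>) = exp (- (1 / real (Suc n) * \<xi>)\<^sup>2 / 2) * cmod (g \<xi>)" by (simp add: norm_mult)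
    also have "\<dots> \<le> ?G \<xi>" using e1[of n \<xi>] s1(1)[of \<xi>] by (intro mult_right_mono norm_ge_zero) linarith
    finally show ?thesis .
  qed
  have iM: "integrable lborel (\<lambda>\<xi>. g \<xi> * ?M n x \<xi>)" for n x
  proof (rule Bochner_Integration.integrable_bound[OF iG])
    show "AE \<xi> in lborel. norm (g \<xi> * ?M n x \<xi>) \<le> norm (?G \<xi>)"
      by (intro AE_I2 order_trans[OF n1]) simp
  qed measurable
  \<comment> \<open>The factor 1 / (2 pi) of Fourier inversion is at most 1 and is dropped.\<close>
  have pi2: "1 * \<bar>a\<bar> \<le> 2 * pi * \<bar>a\<bar>" for a using pi_gt3 by (intro mult_right_mono) auto
  have kb: "\<bar>k n x\<bar> \<le> B" for n x
  proof -
    have "\<bar>k n x\<bar> \<le> cmod (complex_of_real (2 * pi * k n x))"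
      using pi2[of "k n x"] by (simp only: norm_of_real abs_mult abs_numeral) simp
    also have "\<dots> \<le> (\<integral>\<xi>. ?G \<xi> \<partial>lborel)"
      unfolding k by (rule order_trans[OF integral_norm_bound], rule integral_mono)
        (use iM iG n1 in \<open>auto intro!: integrable_norm\<close>)
    finally show ?thesis using GB by linarith
  qed
  show "\<bar>f x\<bar> \<le> B"
    by (rule tendsto_upperbound[OF tendsto_rabs[OF lim]]) (use kb in auto)
  have n2: "cmod (g \<xi> * ?M n x \<xi> - g \<xi> * ?M n y \<xi>) \<le> ?G \<xi> * \<bar>x - y\<bar>" for n \<xi>
  proof -
    have "g \<xi> * ?M n x \<xi> - g \<xi> * ?M n y \<xi> = g \<xi> * (of_real (exp (- (1 / real (Suc n) * \<xi>)\<^sup>2 / 2)) * (cis (x * \<xi>) - cis (y * \<xi>)))"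
      by (simp only: right_diff_distrib)
    then have "cmod (g \<xi> * ?M n x \<xi> - g \<xi> * ?M n y \<xi>) =
       cmod (g \<xi>) * (exp (- (1 / real (Suc n) * \<xi>)\<^sup>2 / 2) * cmod (cis (x * \<xi>) - cis (y * \<xi>)))"
      by (simp only: norm_mult norm_of_real abs_exp_cancel)
    also have "\<dots> \<le> cmod (g \<xi>) * (1 * \<bar>x * \<xi> - y * \<xi>\<bar>)"
      by (intro mult_left_mono mult_mono e1 cmod_cis_diff_le) auto
    also have "\<dots> = cmod (g \<xi>) * (\<bar>\<xi>\<bar> * \<bar>x - y\<bar>)" by (simp add: abs_mult[symmetric] algebra_simps)
    also have "\<dots> \<le> cmod (g \<xi>) * (sqrt (1 + \<xi>\<^sup>2) * \<bar>x - y\<bar>)"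
      by (intro mult_left_mono mult_right_mono s1) auto
    finally show ?thesis by (simp add: mult_ac)
  qed
  have kd: "\<bar>k n x - k n y\<bar> \<le> B * \<bar>x - y\<bar>" for n
  proof -
    have "\<bar>k n x - k n y\<bar> \<le> cmod (complex_of_real (2 * pi * k n x) - complex_of_real (2 * pi * k n y))"
      using pi2[of "k n x - k n y"]
      by (simp only: of_real_diff[symmetric] right_diff_distrib[symmetric] norm_of_real abs_mult abs_numeral) simp
    also have "\<dots> = cmod (\<integral>\<xi>. g \<xi> * ?M n x \<xi> - g \<xi> * ?M n y \<xi> \<partial>lborel)"
      unfolding k using iM by (subst Bochner_Integration.integral_diff) auto
    also have "\<dots> \<le> (\<integral>\<xi>. ?G \<xi> * \<bar>x - y\<bar> \<partial>lborel)"
    proof (rule order_trans[OF integral_norm_bound], rule integral_mono)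
      show "integrable lborel (\<lambda>\<xi>. cmod (g \<xi> * ?M n x \<xi> - g \<xi> * ?M n y \<xi>))"
        by (intro integrable_norm Bochner_Integration.integrable_diff iM)
    qed (use iG n2 in auto)
    also have "\<dots> = (\<integral>\<xi>. ?G \<xi> \<partial>lborel) * \<bar>x - y\<bar>" by simp
    also have "\<dots> \<le> B * \<bar>x - y\<bar>" by (intro mult_right_mono GB) simp
    finally show ?thesis .
  qed
  show "\<bar>f x - f y\<bar> \<le> B * \<bar>x - y\<bar>"
    by (rule tendsto_upperbound[OF tendsto_rabs[OF tendsto_diff[OF lim lim]]]) (use kd in auto)
qed

section \<open>The H^s norm and differences of H^s functions\<close>

lemma memLp_2_iff: "memLp 2 f \<longleftrightarrow> f \<in> borel_measurable borel \<and> integrable lborel (\<lambda>x. (f x)\<^sup>2)"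
proof -
  have "\<bar>f x\<bar> powr 2 = (f x)\<^sup>2" for x by simp
  then show ?thesis by (simp add: memLp_def)
qed

lemma Hs_norm_eq:
  assumes [measurable]: "f \<in> borel_measurable borel" and g: "L2_fourier f g"
  shows "Hs_norm s f = sqrt (\<integral>\<xi>. (1 + \<xi>\<^sup>2) powr s * (cmod (g \<xi>))\<^sup>2 \<partial>lborel)"
proof -
  let ?h = "SOME g. L2_fourier f g"
  have h: "L2_fourier f ?h" by (rule someI[of "L2_fourier f", OF g])
  have [measurable]: "g \<in> borel_measurable borel" "?h \<in> borel_measurable borel" using g h by (simp_all add: L2_fourier_alt)
  have "(\<integral>\<xi>. (1 + \<xi>\<^sup>2) powr s * (cmod (?h \<xi>))\<^sup>2 \<partial>lborel) = (\<integral>\<xi>. (1 + \<xi>\<^sup>2) powr s * (cmod (g \<xi>))\<^sup>2 \<partial>lborel)"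
    by (rule integral_cong_AE) (use L2_fourier_unique[OF assms(1) h g] in auto)
  then show ?thesis by (simp add: Hs_norm_def)
qed

lemma trunc_fourier_diff:
  assumes "continuous_on UNIV f" "continuous_on UNIV h"
  shows "trunc_fourier (\<lambda>x. f x - h x) R \<xi> = trunc_fourier f R \<xi> - trunc_fourier h R \<xi>"
proof -
  have i: "integrable lborel (\<lambda>x. indicator {-R..R} x *\<^sub>R (complex_of_real (f x) * cis (- x * \<xi>)))"
    if "continuous_on UNIV f" for f :: "real \<Rightarrow> real"
    by (rule borel_integrable_compact)
      (auto intro!: continuous_intros continuous_on_subset[OF that])
  show ?thesis
    unfolding trunc_fourier_def using i[OF assms(1)] i[OF assms(2)]
    by (subst Bochner_Integration.integral_diff[symmetric]) (auto simp: algebra_simps)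
qed

lemma L2_fourier_diff:
  assumes cf: "continuous_on UNIV f" and ch: "continuous_on UNIV h"
    and g: "L2_fourier f g" and k: "L2_fourier h k"
  shows "L2_fourier (\<lambda>x. f x - h x) (\<lambda>\<xi>. g \<xi> - k \<xi>)"
proof -
  have [measurable]: "f \<in> borel_measurable borel" "h \<in> borel_measurable borel"
    using cf ch by (auto intro: borel_measurable_continuous_onI)
  have [measurable]: "g \<in> borel_measurable borel" "k \<in> borel_measurable borel" using g k by (simp_all add: L2_fourier_alt)
  let ?I = "\<lambda>f g R. \<integral>\<^sup>+ \<xi>. ennreal ((cmod (g \<xi> - trunc_fourier f R \<xi>))\<^sup>2) \<partial>lborel"
  have le: "?I (\<lambda>x. f x - h x) (\<lambda>\<xi>. g \<xi> - k \<xi>) R \<le> 2 * ?I f g R + 2 * ?I h k R" for R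
  proof -
    have "?I (\<lambda>x. f x - h x) (\<lambda>\<xi>. g \<xi> - k \<xi>) R
      \<le> (\<integral>\<^sup>+ \<xi>. 2 * ennreal ((cmod (g \<xi> - trunc_fourier f R \<xi>))\<^sup>2) + 2 * ennreal ((cmod (k \<xi> - trunc_fourier h R \<xi>))\<^sup>2) \<partial>lborel)"
    proof (rule nn_integral_mono)
      fix \<xi>
      have "(cmod (g \<xi> - k \<xi> - trunc_fourier (\<lambda>x. f x - h x) R \<xi>))\<^sup>2
         \<le> 2 * (cmod (g \<xi> - trunc_fourier f R \<xi>))\<^sup>2 + 2 * (cmod (k \<xi> - trunc_fourier h R \<xi>))\<^sup>2"
        using cmod_add_sq_le[of "g \<xi> - trunc_fourier f R \<xi>" "k \<xi> - trunc_fourier h R \<xi>" 0]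
        unfolding trunc_fourier_diff[OF cf ch] by (simp add: algebra_simps)
      then show "ennreal ((cmod (g \<xi> - k \<xi> - trunc_fourier (\<lambda>x. f x - h x) R \<xi>))\<^sup>2)
        \<le> 2 * ennreal ((cmod (g \<xi> - trunc_fourier f R \<xi>))\<^sup>2) + 2 * ennreal ((cmod (k \<xi> - trunc_fourier h R \<xi>))\<^sup>2)"
        by (simp add: ennreal_leI ennreal_plus[symmetric] ennreal_mult'[symmetric] ennreal_numeral[symmetric]
            del: ennreal_plus ennreal_numeral)
    qed
    also have "\<dots> = 2 * ?I f g R + 2 * ?I h k R"
      by (simp add: nn_integral_add nn_integral_cmult)
    finally show ?thesis .
  qed
  have "((\<lambda>R. 2 * ?I f g R + 2 * ?I h k R) \<longlongrightarrow> 2 * 0 + 2 * 0) at_top"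
    using g k unfolding L2_fourier_alt by (intro tendsto_add ennreal_tendsto_cmult) auto
  then have lim: "((\<lambda>R. 2 * ?I f g R + 2 * ?I h k R) \<longlongrightarrow> 0) at_top" by simp
  have "((\<lambda>R. ?I (\<lambda>x. f x - h x) (\<lambda>\<xi>. g \<xi> - k \<xi>) R) \<longlongrightarrow> 0) at_top"
    by (rule tendsto_sandwich[OF _ _ tendsto_const lim]) (rule always_eventually, simp, rule always_eventually, rule allI, rule le)
  then show ?thesis unfolding L2_fourier_alt by simp
qed

lemma in_Hs_diff:
  assumes cf: "continuous_on UNIV f" and ch: "continuous_on UNIV h" and f: "in_Hs s f" and h: "in_Hs s h"
  shows "in_Hs s (\<lambda>x. f x - h x)"
proof -
  obtain g k where g: "L2_fourier f g" "integrable lborel (\<lambda>\<xi>. (1 + \<xi>\<^sup>2) powr s * (cmod (g \<xi>))\<^sup>2)"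
    and k: "L2_fourier h k" "integrable lborel (\<lambda>\<xi>. (1 + \<xi>\<^sup>2) powr s * (cmod (k \<xi>))\<^sup>2)"
    using f h by (auto simp: in_Hs_def)
  have [measurable]: "f \<in> borel_measurable borel" "h \<in> borel_measurable borel"
    using cf ch by (auto intro: borel_measurable_continuous_onI)
  have [measurable]: "g \<in> borel_measurable borel" "k \<in> borel_measurable borel" using g k by (simp_all add: L2_fourier_alt)
  have fh: "integrable lborel (\<lambda>x. (f x)\<^sup>2)" "integrable lborel (\<lambda>x. (h x)\<^sup>2)"
    using f h by (auto simp: in_Hs_def memLp_2_iff)
  have "integrable lborel (\<lambda>x. (f x - h x)\<^sup>2)"
    unfolding power2_diff using integrable_mult_of_squares[OF _ _ fh] fh by (auto simp: mult.assoc)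
  moreover have "integrable lborel (\<lambda>\<xi>. (1 + \<xi>\<^sup>2) powr s * (cmod (g \<xi> - k \<xi>))\<^sup>2)"
  proof (rule Bochner_Integration.integrable_bound)
    let ?b = "\<lambda>\<xi>. 2 * ((1 + \<xi>\<^sup>2) powr s * (cmod (g \<xi>))\<^sup>2) + 2 * ((1 + \<xi>\<^sup>2) powr s * (cmod (k \<xi>))\<^sup>2)"
    show "integrable lborel ?b" using g(2) k(2) by simp
    have "(1 + \<xi>\<^sup>2) powr s * (cmod (g \<xi> - k \<xi>))\<^sup>2 \<le> (1 + \<xi>\<^sup>2) powr s * (2 * (cmod (g \<xi> - 0))\<^sup>2 + 2 * (cmod (k \<xi> - 0))\<^sup>2)" for \<xi>
      by (intro mult_left_mono cmod_add_sq_le) auto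
    then have "(1 + \<xi>\<^sup>2) powr s * (cmod (g \<xi> - k \<xi>))\<^sup>2 \<le> ?b \<xi>" for \<xi> by (simp add: algebra_simps)
    then show "AE \<xi> in lborel. norm ((1 + \<xi>\<^sup>2) powr s * (cmod (g \<xi> - k \<xi>))\<^sup>2) \<le> norm (?b \<xi>)"
      by (auto intro!: AE_I2 order_trans[OF _ abs_ge_self])
  qed simp
  ultimately show ?thesis
    unfolding in_Hs_def memLp_2_iff using L2_fourier_diff[OF cf ch g(1) k(1)] by auto
qed

text \<open>The constant is the same for every f. Applied to differences of u at two times, it turns
  continuity in H^s into uniform convergence of u and of its derivative; the derivative is bounded
  as a limit of difference quotients.\<close>

lemma sobolev_C1_bound:
  fixes s :: real
  assumes s: "s > 3/2"
  obtains C where "C \<ge> 0" "\<And>f x. f C1_differentiable_on UNIV \<Longrightarrow> in_Hs s f \<Longrightarrow> \<bar>f x\<bar> \<le> C * Hs_norm s f"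
    "\<And>f x. f C1_differentiable_on UNIV \<Longrightarrow> in_Hs s f \<Longrightarrow> \<bar>deriv f x\<bar> \<le> C * Hs_norm s f"
proof -
  define C where "C = sqrt (integral\<^sup>L lborel (\<lambda>\<xi>::real. (1 + \<xi>\<^sup>2) powr (1 - s)))"
  have *: "\<bar>f x\<bar> \<le> C * Hs_norm s f \<and> \<bar>f x - f y\<bar> \<le> C * Hs_norm s f * \<bar>x - y\<bar>" if f: "continuous_on UNIV f" "in_Hs s f" for f x y
  proof -
    obtain g where g: "L2_fourier f g" "integrable lborel (\<lambda>\<xi>. (1 + \<xi>\<^sup>2) powr s * (cmod (g \<xi>))\<^sup>2)"
      using f by (auto simp: in_Hs_def)
    have f2: "f \<in> borel_measurable borel" "integrable lborel (\<lambda>x. (f x)\<^sup>2)" using f(2) by (simp_all add: in_Hs_def memLp_2_iff)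
    show ?thesis using sobolev_embedding_pointwise[OF s f(1) f2(2) g, of x] Hs_norm_eq[OF f2(1) g(1), of s]
      by (simp add: C_def real_sqrt_mult)
  qed
  show thesis
  proof (rule that)
    show "C \<ge> 0" by (simp add: C_def)
    fix f :: "real \<Rightarrow> real" and x assume f: "f C1_differentiable_on UNIV" "in_Hs s f"
    have c: "continuous_on UNIV f" by (rule C1_differentiable_imp_continuous_on[OF f(1)])
    show "\<bar>f x\<bar> \<le> C * Hs_norm s f" using *[OF c f(2), of x x] by simp
    have "f differentiable at x" using f(1) by (simp add: C1_differentiable_on_eq)
    then have D: "(f has_real_derivative deriv f x) (at x)" by (simp add: DERIV_deriv_iff_real_differentiable)
    have "((\<lambda>y. \<bar>(f y - f x) / (y - x)\<bar>) \<longlongrightarrow> \<bar>deriv f x\<bar>) (at x)"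
      using D unfolding has_field_derivative_iff by (rule tendsto_rabs)
    moreover have "eventually (\<lambda>y. \<bar>(f y - f x) / (y - x)\<bar> \<le> C * Hs_norm s f) (at x)"
      unfolding eventually_at by (intro exI[of _ 1]) (use *[OF c f(2), of _ x] in \<open>auto simp: divide_le_eq\<close>)
    ultimately show "\<bar>deriv f x\<bar> \<le> C * Hs_norm s f" by (rule tendsto_upperbound) simp
  qed
qed

subsection \<open>The Green kernel\<close>

lemma has_bochner_integral_exp_abs:
  fixes a x :: real
  assumes a: "a > 0"
  shows "has_bochner_integral lborel (\<lambda>y. exp (- a * \<bar>x - y\<bar>)) (2 / a)"
proof -
  let ?h = "\<lambda>y::real. exp (- a * y) * indicator {0..} y"
  have h: "has_bochner_integral lborel ?h (1 / a)"
  proof (rule has_bochner_integral_nn_integral)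
    have "((\<lambda>y. - exp (- a * y) / a) \<longlongrightarrow> 0) at_top" using a by real_asymp
    then have "(\<integral>\<^sup>+ y. ennreal (exp (- a * y)) * indicator {0..} y \<partial>lborel) = ennreal (0 - (- exp (- a * 0) / a))"
      by (intro nn_integral_FTC_atLeast) (use a in \<open>auto intro!: derivative_eq_intros\<close>)
    then show "(\<integral>\<^sup>+ y. ennreal (?h y) \<partial>lborel) = ennreal (1 / a)"
      by (simp add: ennreal_mult'' ennreal_indicator)
  qed (use a in auto)
  have "has_bochner_integral lborel (\<lambda>y. ?h (0 + (-1) * y)) (1 / a)"
    using h lborel_has_bochner_integral_real_affine_iff[of "-1" ?h "1 / a" 0] by simp
  then have "has_bochner_integral lborel (\<lambda>y. ?h y + ?h (0 + (-1) * y)) (1 / a + 1 / a)"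
    by (intro has_bochner_integral_add h)
  then have "has_bochner_integral lborel (\<lambda>y. exp (- a * \<bar>y\<bar>)) (1 / a + 1 / a)"
  proof (rule has_bochner_integralI_AE)
    have "AE y in lborel. y \<noteq> (0::real)" by (rule AE_lborel_singleton)
    then show "AE y in lborel. ?h y + ?h (0 + (-1) * y) = exp (- a * \<bar>y\<bar>)"
      by eventually_elim (auto simp: indicator_def)
  qed auto
  then have "has_bochner_integral lborel (\<lambda>y. exp (- a * \<bar>y\<bar>)) (2 / a)" by simp
  then show ?thesis
    using lborel_has_bochner_integral_real_affine_iff[of "-1" "\<lambda>y. exp (- a * \<bar>y\<bar>)" "2 / a" x] by simp
qed

lemma integrable_exp_abs:
  "integrable lborel (\<lambda>y. exp (- \<bar>x - y\<bar>))" "(\<integral>y. exp (- \<bar>x - y\<bar>) \<partial>lborel) = 2" for x :: real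
  using has_bochner_integral_exp_abs[of 1 x] by (auto simp: has_bochner_integral_iff)

lemma integrable_mult_bounded:
  fixes k f :: "real \<Rightarrow> real"
  assumes k: "integrable lborel k" and [measurable]: "f \<in> borel_measurable borel" and b: "\<And>y. \<bar>f y\<bar> \<le> m"
  shows "integrable lborel (\<lambda>y. k y * f y)"
proof (rule Bochner_Integration.integrable_bound)
  show "integrable lborel (\<lambda>y. m * \<bar>k y\<bar>)" using k by simp
  have "\<bar>k y\<bar> * \<bar>f y\<bar> \<le> \<bar>k y\<bar> * \<bar>m\<bar>" for y
    using b[of y] by (intro mult_left_mono) auto
  then show "AE y in lborel. norm (k y * f y) \<le> norm (m * \<bar>k y\<bar>)" by (simp add: abs_mult mult.commute)
qed (use k in measurable)

lemma DERIV_lborel_integral_atMost: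
  fixes h :: "real \<Rightarrow> real"
  assumes c: "continuous_on UNIV h" and i: "\<And>x. integrable lborel (\<lambda>y. indicator {..x} y * h y)"
  shows "((\<lambda>x. \<integral>y. indicator {..x} y * h y \<partial>lborel) has_real_derivative h x) (at x)"
proof -
  let ?I = "\<lambda>x. \<integral>y. indicator {..x} y * h y \<partial>lborel"
  \<comment> \<open>The window {x - 1..x + 1} keeps x interior, so the derivative within it is the
    two-sided one.\<close>
  define a where "a = x - 1"
  have eq: "?I z = ?I a + integral {a..z} h" if "z \<in> {a..a + 2}" for z
  proof -
    have s: "set_integrable lborel {a..z} h"
      by (intro borel_integrable_atLeastAtMost' continuous_on_subset[OF c]) simp
    have "?I z = (\<integral>y. indicator {..a} y * h y + indicator {a..z} y *\<^sub>R h y \<partial>lborel)"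
    proof (rule integral_cong_AE)
      have [measurable]: "h \<in> borel_measurable borel" using c by (rule borel_measurable_continuous_onI)
      show "(\<lambda>y. indicator {..z} y * h y) \<in> borel_measurable lborel"
        "(\<lambda>y. indicator {..a} y * h y + indicator {a..z} y *\<^sub>R h y) \<in> borel_measurable lborel" by measurable
      have "AE y in lborel. y \<noteq> a" by (rule AE_lborel_singleton)
      then show "AE y in lborel. indicator {..z} y * h y = indicator {..a} y * h y + indicator {a..z} y *\<^sub>R h y"
        by eventually_elim (use that in \<open>auto simp: indicator_def\<close>)
    qed
    also have "\<dots> = ?I a + (LINT y:{a..z}|lborel. h y)"
      using i[of a] s unfolding set_integrable_def set_lebesgue_integral_def
      by (rule Bochner_Integration.integral_add)
    also have "(LINT y:{a..z}|lborel. h y) = integral {a..z} h"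
      by (rule set_borel_integral_eq_integral(2)[OF s])
    finally show ?thesis .
  qed
  have "((\<lambda>z. integral {a..z} h) has_real_derivative h x) (at x within {a..a + 2})"
    by (rule integral_has_real_derivative) (use c in \<open>auto simp: a_def intro: continuous_on_subset\<close>)
  then have "((\<lambda>z. ?I a + integral {a..z} h) has_real_derivative h x) (at x within {a..a + 2})"
    by (auto intro!: derivative_eq_intros)
  then have "(?I has_real_derivative h x) (at x within {a..a + 2})"
  proof (rule has_field_derivative_transform_within[of _ _ _ _ 1])
    show "x \<in> {a..a + 2}" by (simp add: a_def)
    show "?I a + integral {a..z} h = ?I z" if "z \<in> {a..a + 2}" for z using eq[OF that] by (rule sym)
  qed simp
  then show ?thesis
    by (simp add: a_def at_within_Icc_at)
qed

text \<open>The inverse of 1 - d^2/dx^2 on bounded continuous functions; \<open>CH_P u t\<close> has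
  this form.\<close>

definition green :: "(real \<Rightarrow> real) \<Rightarrow> real \<Rightarrow> real" where
  "green F x = (\<integral>y. (1/2) * exp (- \<bar>x - y\<bar>) * F y \<partial>lborel)"

definition green_deriv :: "(real \<Rightarrow> real) \<Rightarrow> real \<Rightarrow> real" where
  "green_deriv F x = (\<integral>y. (1/2) * exp (- \<bar>x - y\<bar>) * sgn (y - x) * F y \<partial>lborel)"

context
  fixes F :: "real \<Rightarrow> real" and m :: real
  assumes F: "continuous_on UNIV F" and m: "\<And>y. \<bar>F y\<bar> \<le> m"
begin

lemma green_integrable: "integrable lborel (\<lambda>y. (1/2) * exp (- \<bar>x - y\<bar>) * F y)"
proof -
  have [measurable]: "F \<in> borel_measurable borel" using F by (rule borel_measurable_continuous_onI)
  show ?thesis by (rule integrable_mult_bounded) (use m integrable_exp_abs in auto)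
qed

lemma green_abs_le: "\<bar>green F x\<bar> \<le> m"
proof -
  have "\<bar>green F x\<bar> \<le> (\<integral>y. (m / 2) * exp (- \<bar>x - y\<bar>) \<partial>lborel)"
    unfolding green_def
  proof (rule order_trans[OF integral_abs_bound], rule integral_mono)
    show "integrable lborel (\<lambda>y. \<bar>(1/2) * exp (- \<bar>x - y\<bar>) * F y\<bar>)" using green_integrable by (rule integrable_abs)
    fix y
    have "exp (- \<bar>x - y\<bar>) * \<bar>F y\<bar> \<le> exp (- \<bar>x - y\<bar>) * m" using m by (intro mult_left_mono) auto
    then show "\<bar>(1/2) * exp (- \<bar>x - y\<bar>) * F y\<bar> \<le> (m / 2) * exp (- \<bar>x - y\<bar>)" by (simp add: abs_mult mult.commute)
  qed (use integrable_exp_abs in simp)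
  also have "\<dots> = m" using integrable_exp_abs by simp
  finally show ?thesis .
qed

text \<open>The kernel has a corner at y = x. On either side it factors into an exponential in x
  times one in y, leaving integrals over half-lines with a moving endpoint, to which the fundamental
  theorem applies. \<open>I2\<close> is reflected so that its half-line is again unbounded to the
  left.\<close>

lemma green_split:
  fixes I1 I2
  defines "I1 \<equiv> \<lambda>x. \<integral>y. indicator {..x} y * (exp y * F y) \<partial>lborel"
    and "I2 \<equiv> \<lambda>x. \<integral>y. indicator {..-x} y * (exp y * F (- y)) \<partial>lborel"
  shows "green F x = (exp (- x) * I1 x + exp x * I2 x) / 2"
    and "green_deriv F x = (- exp (- x) * I1 x + exp x * I2 x) / 2"
    and "(I1 has_real_derivative exp x * F x) (at x)"
    and "(I2 has_real_derivative - exp (- x) * F x) (at x)"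
proof -
  have [measurable]: "F \<in> borel_measurable borel" using F by (rule borel_measurable_continuous_onI)
  have i1: "integrable lborel (\<lambda>y. indicator {..x} y * (exp y * G y))"
    if [measurable]: "G \<in> borel_measurable borel" and b: "\<And>y. \<bar>G y\<bar> \<le> m" for G x
  proof (rule Bochner_Integration.integrable_bound)
    show "integrable lborel (\<lambda>y. exp x * (exp (- \<bar>x - y\<bar>) * G y))"
      using integrable_mult_bounded[OF integrable_exp_abs(1)[of x] _ b] by simp
    show "AE y in lborel. norm (indicator {..x} y * (exp y * G y)) \<le> norm (exp x * (exp (- \<bar>x - y\<bar>) * G y))"
      by (auto simp: indicator_def abs_mult exp_add[symmetric] mult.assoc[symmetric])
  qed measurable
  have j1: "integrable lborel (\<lambda>y. indicator {..x} y * (exp y * F y))" for x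
    by (rule i1) (use m in auto)
  have j2: "integrable lborel (\<lambda>y. indicator {..x} y * (exp y * F (- y)))" for x
    by (rule i1) (use m in auto)
  show "(I1 has_real_derivative exp x * F x) (at x)"
    unfolding I1_def by (rule DERIV_lborel_integral_atMost) (use F j1 in \<open>auto intro!: continuous_intros\<close>)
  define J where "J z = (\<integral>y. indicator {..z} y * (exp y * F (- y)) \<partial>lborel)" for z
  have J: "(J has_real_derivative exp (- x) * F (- (- x))) (at (- x))"
    unfolding J_def[abs_def] by (rule DERIV_lborel_integral_atMost)
      (use j2 in \<open>auto intro!: continuous_intros continuous_on_compose2[OF F]\<close>)
  have "((\<lambda>x. J (- x)) has_real_derivative exp (- x) * F (- (- x)) * (- 1)) (at x)"
    by (rule DERIV_chain2[where g = uminus, OF J]) (auto intro!: derivative_eq_intros)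
  then show "(I2 has_real_derivative - exp (- x) * F x) (at x)"
    unfolding I2_def J_def by simp
  have I2': "integrable lborel (\<lambda>y. indicator {x..} y * (exp (- y) * F y))"
    "I2 x = (\<integral>y. indicator {x..} y * (exp (- y) * F y) \<partial>lborel)"
  proof -
    have e: "indicator {..-x} (0 + (-1) * y) * (exp (0 + (-1) * y) * F (- (0 + (-1) * y))) = indicator {x..} y * (exp (- y) * F y)" for y
      by (simp add: indicator_def)
    show "integrable lborel (\<lambda>y. indicator {x..} y * (exp (- y) * F y))"
      using lborel_integrable_real_affine[OF j2[of "-x"], of "-1" 0] unfolding e by simp
    show "I2 x = (\<integral>y. indicator {x..} y * (exp (- y) * F y) \<partial>lborel)"
      unfolding I2_def
      by (subst lborel_integral_real_affine[of "-1" _ 0]) (simp_all only: e, simp_all)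
  qed
  have ae: "AE y in lborel. y \<noteq> x" by (rule AE_lborel_singleton)
  let ?J1 = "\<lambda>y. (exp (- x) * (indicator {..x} y * (exp y * F y)) + exp x * (indicator {x..} y * (exp (- y) * F y))) / 2" and ?J2 = "\<lambda>y. (- exp (- x) * (indicator {..x} y * (exp y * F y)) + exp x * (indicator {x..} y * (exp (- y) * F y))) / 2"
  have g1: "(1/2) * exp (- \<bar>x - y\<bar>) * F y =
     ?J1 y"
    if "y \<noteq> x" for y
    using that by (auto simp: indicator_def exp_diff exp_minus field_simps)
  have g2: "(1/2) * exp (- \<bar>x - y\<bar>) * sgn (y - x) * F y =
     ?J2 y"
    if "y \<noteq> x" for y
    using that by (auto simp: indicator_def exp_diff exp_minus field_simps)
  have "green F x = (\<integral>y. ?J1 y \<partial>lborel)"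
    unfolding green_def
  proof (rule integral_cong_AE)
    show "AE y in lborel. (1/2) * exp (- \<bar>x - y\<bar>) * F y =
      ?J1 y"
      using ae by eventually_elim (rule g1)
  qed measurable
  also have "\<dots> = (exp (- x) * I1 x + exp x * I2 x) / 2"
    unfolding I2'(2) I1_def using j1[of x] I2'(1) by simp
  finally show "green F x = (exp (- x) * I1 x + exp x * I2 x) / 2" .
  have "green_deriv F x = (\<integral>y. ?J2 y \<partial>lborel)"
    unfolding green_deriv_def
  proof (rule integral_cong_AE)
    show "AE y in lborel. (1/2) * exp (- \<bar>x - y\<bar>) * sgn (y - x) * F y =
      ?J2 y"
      using ae by eventually_elim (rule g2)
  qed measurable
  also have "\<dots> = (- exp (- x) * I1 x + exp x * I2 x) / 2"
    unfolding I2'(2) I1_def using j1[of x] I2'(1) by simp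
  finally show "green_deriv F x = (- exp (- x) * I1 x + exp x * I2 x) / 2" .
qed

text \<open>Differentiating the two half-line integrals produces endpoint terms. They cancel for
  \<open>green\<close> and add up to -F for \<open>green_deriv\<close>: this is the corner of the
  kernel, and it gives P_xx = P - F without any derivative of F.\<close>

lemma green_has_derivative: "(green F has_real_derivative green_deriv F x) (at x)"
  and green_deriv_has_derivative: "(green_deriv F has_real_derivative green F x - F x) (at x)"
proof -
  define I1 where "I1 x = (\<integral>y. indicator {..x} y * (exp y * F y) \<partial>lborel)" for x
  define I2 where "I2 x = (\<integral>y. indicator {..-x} y * (exp y * F (- y)) \<partial>lborel)" for x
  note split = green_split[folded I1_def I2_def]
  have g: "green F = (\<lambda>x. (exp (- x) * I1 x + exp x * I2 x) / 2)"
    "green_deriv F = (\<lambda>x. (- exp (- x) * I1 x + exp x * I2 x) / 2)"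
    by (rule ext, rule split)+
  have D: "(I1 has_real_derivative exp x * F x) (at x)" "(I2 has_real_derivative - exp (- x) * F x) (at x)"
    using split(3,4)[of x] by (simp_all add: I1_def[abs_def] I2_def[abs_def])
  show "(green F has_real_derivative green_deriv F x) (at x)"
    unfolding g by (auto intro!: derivative_eq_intros D simp: field_simps exp_minus)
  show "(green_deriv F has_real_derivative green F x - F x) (at x)"
    unfolding g by (auto intro!: derivative_eq_intros D simp: field_simps exp_minus)
qed

end

lemma green_deriv_abs_le:
  assumes F: "continuous_on UNIV F" and m: "\<And>y. \<bar>F y\<bar> \<le> m" and nn: "\<And>y. 0 \<le> F y"
  shows "\<bar>green_deriv F x\<bar> \<le> green F x"
  unfolding green_deriv_def green_def
proof (rule order_trans[OF integral_abs_bound], rule integral_mono)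
  have [measurable]: "F \<in> borel_measurable borel" using F by (rule borel_measurable_continuous_onI)
  note i = green_integrable[OF F m, where x=x]
  have le: "\<bar>(1/2) * exp (- \<bar>x - y\<bar>) * sgn (y - x) * F y\<bar> \<le> (1/2) * exp (- \<bar>x - y\<bar>) * F y" for y
    using nn[of y] by (auto simp: abs_mult sgn_real_def)
  then show "\<bar>(1/2) * exp (- \<bar>x - y\<bar>) * sgn (y - x) * F y\<bar> \<le> (1/2) * exp (- \<bar>x - y\<bar>) * F y" for y .
  show "integrable lborel (\<lambda>y. (1/2) * exp (- \<bar>x - y\<bar>) * F y)" by (rule i) 
  show "integrable lborel (\<lambda>y. \<bar>(1/2) * exp (- \<bar>x - y\<bar>) * sgn (y - x) * F y\<bar>)"
    by (rule Bochner_Integration.integrable_bound[OF i]) (use le nn in \<open>auto simp: abs_mult sgn_real_def\<close>)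
qed

lemma green_diff:
  assumes F: "continuous_on UNIV F" "\<And>y. \<bar>F y\<bar> \<le> m" and H: "continuous_on UNIV H" "\<And>y. \<bar>H y\<bar> \<le> m"
    and d: "\<And>y. \<bar>F y - H y\<bar> \<le> d"
  shows "\<bar>green F x - green H x\<bar> \<le> d"
proof -
  have "green F x - green H x = green (\<lambda>y. F y - H y) x"
  proof -
    have "green (\<lambda>y. F y - H y) x = (\<integral>y. (1/2) * exp (- \<bar>x - y\<bar>) * F y - (1/2) * exp (- \<bar>x - y\<bar>) * H y \<partial>lborel)"
      unfolding green_def by (simp only: right_diff_distrib)
    also have "\<dots> = green F x - green H x"
      unfolding green_def by (rule Bochner_Integration.integral_diff[OF green_integrable[OF F] green_integrable[OF H]])
    finally show ?thesis ..
  qed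
  also have "\<bar>\<dots>\<bar> \<le> d"
    by (rule green_abs_le) (use F H d in \<open>auto intro!: continuous_intros\<close>)
  finally show ?thesis .
qed

subsection \<open>Global flows and change of variables\<close>

text \<open>The weight \<open>exp (2 * L * t)\<close> makes the Picard map a contraction on all of \<open>[0, T]\<close> at once.\<close>
lemma picard_global:
  fixes f :: "real \<Rightarrow> real \<Rightarrow> real" and x :: real
  assumes c: "continuous_on UNIV (\<lambda>(t, y). f t y)" and b: "\<And>t y. \<bar>f t y\<bar> \<le> M"
    and lip: "\<And>t y z. \<bar>f t y - f t z\<bar> \<le> L * \<bar>y - z\<bar>" and L: "L > 0" and T: "T \<ge> 0"
  shows "\<exists>q. q 0 = x \<and> (\<forall>t\<in>{0..T}. (q has_real_derivative f t (q t)) (at t within {0..T}))"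
proof -
  \<comment> \<open>The fixed point is sought among bounded continuous functions on the whole line,
    so time is clamped to {0..T}.\<close>
  define cl where "cl t = max 0 (min T t)" for t :: real
  have cl: "0 \<le> cl t" "cl t \<le> T" for t using T by (auto simp: cl_def)
  have cl_id: "cl t = t" if "t \<in> {0..T}" for t using that by (auto simp: cl_def)
  \<comment> \<open>The unknown is z(t) = exp(-2 L t) (q(t) - x), whose plain sup norm is the
    weighted norm of q - x. The factor 1/2 arises because L times the integral of exp(2 L r) over r
    in {0..t} is at most exp(2 L t) / 2.\<close>
  define h where "h z \<tau> = f \<tau> (x + exp (2 * L * \<tau>) * apply_bcontfun z \<tau>)" for z \<tau>
  have ch: "continuous_on A (h z)" for z A
  proof -
    have "continuous_on A ((\<lambda>(t, y). f t y) \<circ> (\<lambda>\<tau>. (\<tau>, x + exp (2 * L * \<tau>) * apply_bcontfun z \<tau>)))"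
      by (intro continuous_on_compose continuous_intros continuous_on_subset[OF c]) auto
    then show ?thesis by (simp add: h_def[abs_def] o_def)
  qed
  have ih: "h z integrable_on {a..b}" for z a b by (rule integrable_continuous_interval[OF ch])
  define P where "P z t = exp (- (2 * L * cl t)) * integral {0..cl t} (h z)" for z t
  have P_mem: "P z \<in> bcontfun" for z
  proof (rule bcontfun_normI)
    have ccl: "continuous_on UNIV cl" unfolding cl_def[abs_def] by (intro continuous_intros)
    have "continuous_on UNIV (\<lambda>t. integral {0..cl t} (h z))"
      by (rule continuous_on_compose2[OF indefinite_integral_continuous_1[OF ih[of z 0 T]] ccl]) (use cl in auto)
    with ccl show "continuous_on UNIV (P z)" unfolding P_def[abs_def] by (intro continuous_intros)
    fix t
    have M0: "0 \<le> M" using b[of 0 0] by linarith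
    have "norm (integral {0..cl t} (h z)) \<le> M * (cl t - 0)"
      by (rule integral_bound) (use cl ch b in \<open>auto simp: h_def\<close>)
    also have "\<dots> \<le> M * T" using cl[of t] M0 by (intro mult_left_mono) auto
    finally have *: "norm (integral {0..cl t} (h z)) \<le> M * T" .
    have "exp (- (2 * L * cl t)) * norm (integral {0..cl t} (h z)) \<le> 1 * (M * T)"
      using cl[of t] L by (intro mult_mono *) auto
    then show "norm (P z t) \<le> M * T" by (simp add: P_def abs_mult)
  qed
  define \<Psi> where "\<Psi> z = Bcontfun (P z)" for z
  have \<Psi>: "apply_bcontfun (\<Psi> z) t = P z t" for z t
    unfolding \<Psi>_def using Bcontfun_inverse[OF P_mem[of z]] by simp
  have "\<exists>!z. \<Psi> z = z"
  proof (rule banach_fix_type[of "1/2"], simp_all, intro allI)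
    fix z w
    show "dist (\<Psi> z) (\<Psi> w) * 2 \<le> dist z w"
    proof -
      have "dist (\<Psi> z) (\<Psi> w) \<le> dist z w / 2"
      proof (rule dist_bound)
        fix t
        let ?D = "dist z w"
        have hd: "\<bar>h z \<tau> - h w \<tau>\<bar> \<le> L * exp (2 * L * \<tau>) * ?D" for \<tau>
        proof -
          have "\<bar>h z \<tau> - h w \<tau>\<bar> \<le> L * \<bar>exp (2 * L * \<tau>) * (apply_bcontfun z \<tau> - apply_bcontfun w \<tau>)\<bar>"
            unfolding h_def using lip[of \<tau> "x + exp (2 * L * \<tau>) * apply_bcontfun z \<tau>" "x + exp (2 * L * \<tau>) * apply_bcontfun w \<tau>"]
            by (simp add: right_diff_distrib)
          also have "\<dots> \<le> L * (exp (2 * L * \<tau>) * ?D)"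
            using dist_bounded[of z \<tau> w] L by (intro mult_left_mono) (auto simp: abs_mult dist_real_def)
          finally show ?thesis by (simp add: mult_ac)
        qed
        have I: "((\<lambda>\<tau>. L * exp (2 * L * \<tau>) * ?D) has_integral (exp (2 * L * cl t) * ?D / 2 - exp (2 * L * 0) * ?D / 2)) {0..cl t}"
          using cl[of t] L
          by (intro fundamental_theorem_of_calculus)
            (auto intro!: derivative_eq_intros simp: has_real_derivative_iff_has_vector_derivative[symmetric])
        have "\<bar>integral {0..cl t} (h z) - integral {0..cl t} (h w)\<bar> = norm (integral {0..cl t} (\<lambda>\<tau>. h z \<tau> - h w \<tau>))"
          by (simp add: integral_diff[OF ih ih])
        also have "\<dots> \<le> integral {0..cl t} (\<lambda>\<tau>. L * exp (2 * L * \<tau>) * ?D)"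
          by (rule integral_norm_bound_integral) (use I hd ih in \<open>auto intro!: integrable_diff has_integral_integrable[OF I]\<close>)
        also have "\<dots> = exp (2 * L * cl t) * ?D / 2 - ?D / 2" using integral_unique[OF I] by simp
        finally have "\<bar>integral {0..cl t} (h z) - integral {0..cl t} (h w)\<bar> \<le> exp (2 * L * cl t) * ?D / 2"
          using zero_le_dist[of z w] by linarith
        then have "exp (- (2 * L * cl t)) * \<bar>integral {0..cl t} (h z) - integral {0..cl t} (h w)\<bar>
           \<le> exp (- (2 * L * cl t)) * (exp (2 * L * cl t) * ?D / 2)"
          by (intro mult_left_mono) auto
        also have "\<dots> = ?D / 2" by (simp add: exp_minus)
        finally show "dist (apply_bcontfun (\<Psi> z) t) (apply_bcontfun (\<Psi> w) t) \<le> ?D / 2"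
          unfolding \<Psi> P_def by (simp add: dist_real_def abs_mult right_diff_distrib[symmetric])
      qed
      then show ?thesis by simp
    qed
  qed
  then obtain z where z: "\<Psi> z = z" by blast
  define q where "q t = x + exp (2 * L * t) * apply_bcontfun z t" for t
  have hq: "h z = (\<lambda>\<tau>. f \<tau> (q \<tau>))" by (simp add: h_def[abs_def] q_def)
  have q: "q t = x + integral {0..t} (h z)" if t: "t \<in> {0..T}" for t
  proof -
    have "apply_bcontfun z t = exp (- (2 * L * t)) * integral {0..t} (h z)"
      using \<Psi>[of z t] unfolding z P_def cl_id[OF t] .
    then show ?thesis by (simp add: q_def exp_minus)
  qed
  show ?thesis
  proof (intro exI conjI ballI)
    show "q 0 = x" using q[of 0] T by simp
    fix t assume t: "t \<in> {0..T}"
    have "((\<lambda>t. x + integral {0..t} (h z)) has_real_derivative h z t) (at t within {0..T})"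
      by (auto intro!: derivative_eq_intros integral_has_real_derivative ch t)
    then have "(q has_real_derivative h z t) (at t within {0..T})"
      by (rule has_field_derivative_transform_within[of _ _ _ _ 1]) (use t q in auto)
    then show "(q has_real_derivative f t (q t)) (at t within {0..T})" by (simp add: hq)
  qed
qed

lemma continuous_on_prod_uniform:
  fixes w :: "real \<Rightarrow> real \<Rightarrow> real"
  assumes c: "\<And>t. t \<in> S \<Longrightarrow> continuous_on UNIV (w t)"
    and u: "\<And>t e. t \<in> S \<Longrightarrow> e > 0 \<Longrightarrow> \<exists>\<delta>>0. \<forall>s\<in>S. \<bar>s - t\<bar> < \<delta> \<longrightarrow> (\<forall>x. \<bar>w s x - w t x\<bar> \<le> e)"
  shows "continuous_on (S \<times> UNIV) (\<lambda>(t, x). w t x)"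
proof (unfold continuous_on_iff, intro ballI allI impI)
  fix p0 :: "real \<times> real" and e :: real assume p0: "p0 \<in> S \<times> UNIV" and e: "e > 0"
  obtain t x where [simp]: "p0 = (t, x)" by (cases p0)
  have t: "t \<in> S" using p0 by simp
  obtain d where d: "d > 0" "\<And>s y. s \<in> S \<Longrightarrow> \<bar>s - t\<bar> < d \<Longrightarrow> \<bar>w s y - w t y\<bar> \<le> e / 2"
    using u[OF t, of "e / 2"] e by auto
  have "isCont (w t) x" using c[OF t] by (simp add: continuous_on_eq_continuous_at)
  from this[unfolded continuous_at_eps_delta, rule_format, of "e / 2"] e
  obtain d' where d': "d' > 0" "\<And>y. \<bar>y - x\<bar> < d' \<Longrightarrow> \<bar>w t y - w t x\<bar> < e / 2"
    by (auto simp: dist_real_def)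
  show "\<exists>d>0. \<forall>x'\<in>S \<times> UNIV. dist x' p0 < d \<longrightarrow> dist (case x' of (t, x) \<Rightarrow> w t x) (case p0 of (t, x) \<Rightarrow> w t x) < e"
  proof (intro exI conjI ballI impI)
    show "min d d' > 0" using d d' by simp
    fix p assume p: "p \<in> S \<times> UNIV" "dist p p0 < min d d'"
    obtain s y where [simp]: "p = (s, y)" by (cases p)
    have "\<bar>s - t\<bar> < min d d'" "\<bar>y - x\<bar> < min d d'"
      using p(2) dist_fst_le[of p "(t, x)"] dist_snd_le[of p "(t, x)"] by (auto simp: dist_real_def)
    then have "\<bar>w s y - w t y\<bar> \<le> e / 2" "\<bar>w t y - w t x\<bar> < e / 2" using d d' p by auto
    then have "\<bar>w s y - w t x\<bar> < e" by linarith
    then show "dist (case p of (t, x) \<Rightarrow> w t x) (case p0 of (t, x) \<Rightarrow> w t x) < e"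
      by (simp add: dist_real_def)
  qed
qed

text \<open>Substitution is applied on bounded intervals. Since q displaces points by at most B, the
  images of these intervals exhaust the line, which stands in for a separate proof that q is onto;
  monotone convergence does the rest.\<close>

lemma nn_integral_le_comp:
  fixes q q' :: "real \<Rightarrow> real" and f :: "real \<Rightarrow> ennreal"
  assumes f[measurable]: "f \<in> borel_measurable borel"
    and q: "\<And>x. (q has_real_derivative q' x) (at x)" and c: "continuous_on UNIV q'"
    and q': "\<And>x. 0 \<le> q' x" "\<And>x. q' x \<le> L" and B: "\<And>x. \<bar>q x - x\<bar> \<le> B"
  shows "(\<integral>\<^sup>+y. f y \<partial>lborel) \<le> ennreal L * (\<integral>\<^sup>+x. f (q x) \<partial>lborel)"
proof -
  have cq: "continuous_on UNIV q" using q by (auto intro!: DERIV_isCont continuous_at_imp_continuous_on)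
  then have [measurable]: "q \<in> borel_measurable borel" by (rule borel_measurable_continuous_onI)
  have [measurable]: "q' \<in> borel_measurable borel" using c by (rule borel_measurable_continuous_onI)
  \<comment> \<open>\<open>Suc n\<close> keeps the interval of integration nondegenerate, also for n
    = 0.\<close>
  let ?J = "\<lambda>n y. f y * indicator {q (- real (Suc n))..q (real (Suc n))} y"
  have mono_q: "q x \<le> q y" if "x \<le> y" for x y
    by (rule DERIV_nonneg_imp_nondecreasing[OF that]) (use q q' in blast)
  have "(\<integral>\<^sup>+y. ?J n y \<partial>lborel) \<le> ennreal L * (\<integral>\<^sup>+x. f (q x) \<partial>lborel)" for n
  proof -
    have "(\<integral>\<^sup>+y. ?J n y \<partial>lborel) = (\<integral>\<^sup>+x. f (q x) * ennreal (q' x) * indicator {- real (Suc n)..real (Suc n)} x \<partial>lborel)"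
      by (rule nn_integral_substitution_aux) (use q q' in \<open>auto intro: continuous_on_subset[OF c]\<close>)
    also have "\<dots> \<le> (\<integral>\<^sup>+x. ennreal L * f (q x) \<partial>lborel)"
    proof (rule nn_integral_mono)
      fix x
      have "f (q x) * ennreal (q' x) * indicator {- real (Suc n)..real (Suc n)} x \<le> f (q x) * ennreal (q' x) * 1"
        by (intro mult_left_mono) (auto simp: indicator_def)
      also have "\<dots> \<le> ennreal L * f (q x)"
        unfolding mult_1_right mult.commute[of "f (q x)"] by (intro mult_right_mono ennreal_leI q') simp
      finally show "f (q x) * ennreal (q' x) * indicator {- real (Suc n)..real (Suc n)} x \<le> ennreal L * f (q x)" .
    qed
    also have "\<dots> = ennreal L * (\<integral>\<^sup>+x. f (q x) \<partial>lborel)" by (rule nn_integral_cmult) measurable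
    finally show ?thesis .
  qed
  moreover have "(\<integral>\<^sup>+y. f y \<partial>lborel) = (SUP n. \<integral>\<^sup>+y. ?J n y \<partial>lborel)"
  proof -
    have inc: "incseq ?J"
    proof (intro incseq_SucI le_funI mult_left_mono)
      fix n y
      have "q (- real (Suc (Suc n))) \<le> q (- real (Suc n))" "q (real (Suc n)) \<le> q (real (Suc (Suc n)))"
        by (intro mono_q; simp)+
      then show "(indicator {q (- real (Suc n))..q (real (Suc n))} y :: ennreal) \<le> indicator {q (- real (Suc (Suc n)))..q (real (Suc (Suc n)))} y"
        by (auto simp: indicator_def)
    qed simp
    have "f y = (SUP n. ?J n y)" for y
    proof (rule antisym)
      obtain n where n: "\<bar>y\<bar> + B \<le> real n" using real_arch_simple by blast
      have "q (- real (Suc n)) \<le> y" "y \<le> q (real (Suc n))"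
        using B[of "- real (Suc n)"] B[of "real (Suc n)"] n by auto
      then have "f y = ?J n y" by simp
      moreover have "?J n y \<le> (SUP n. ?J n y)" by (rule SUP_upper) simp
      ultimately show "f y \<le> (SUP n. ?J n y)" by simp
      show "(SUP n. ?J n y) \<le> f y" by (rule SUP_least) (auto simp: indicator_def)
    qed
    then have "(\<integral>\<^sup>+y. f y \<partial>lborel) = (\<integral>\<^sup>+y. (SUP n. ?J n y) \<partial>lborel)" by (intro nn_integral_cong)
    also have "\<dots> = (SUP n. \<integral>\<^sup>+y. ?J n y \<partial>lborel)"
      by (rule nn_integral_monotone_convergence_SUP[OF inc]) measurable
    finally show ?thesis .
  qed
  ultimately show ?thesis by (simp add: SUP_least)
qed

subsection \<open>The equation along its flow\<close>

lemma real_mean_value: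
  fixes f f' :: "real \<Rightarrow> real"
  assumes "\<And>x. (f has_real_derivative f' x) (at x)"
  shows "\<exists>z. \<bar>z - a\<bar> \<le> \<bar>b - a\<bar> \<and> f b - f a = f' z * (b - a)"
proof -
  consider "a < b" | "a = b" | "b < a" by linarith
  then show ?thesis
  proof cases
    case 1
    from MVT2[OF 1, of f f'] assms obtain z where "a < z" "z < b" "f b - f a = (b - a) * f' z" by blast
    then show ?thesis by (intro exI[of _ z]) (auto simp: mult.commute)
  next
    case 2
    then show ?thesis by auto
  next
    case 3
    from MVT2[OF 3, of f f'] assms obtain z where "b < z" "z < a" "f a - f b = (a - b) * f' z" by blast
    then show ?thesis by (intro exI[of _ z]) (auto simp: algebra_simps)
  qed
qed

lemma difference_quotient_LIMSEQ:
  fixes f :: "real \<Rightarrow> real"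
  assumes "(f has_real_derivative d) (at a)" "X \<longlonglongrightarrow> a" "\<And>n. X n \<noteq> a"
  shows "(\<lambda>n. (f (X n) - f a) / (X n - a)) \<longlonglongrightarrow> d"
proof -
  have "filterlim X (at a) sequentially" using assms(2,3) by (simp add: filterlim_at)
  then show ?thesis using assms(1) unfolding has_field_derivative_iff by (rule filterlim_compose[rotated])
qed

text \<open>Squares are compared because |D| need not be differentiable where D vanishes; D^2
  changes at rate 2 D N, in modulus at most 2 M D^2. For two particles the lower bound says that
  they never meet.\<close>

lemma gronwall_two_sided:
  fixes D N :: "real \<Rightarrow> real"
  assumes D: "\<And>t. t \<in> {0..T} \<Longrightarrow> (D has_real_derivative N t) (at t within {0..T})"
    and N: "\<And>t. t \<in> {0..T} \<Longrightarrow> \<bar>N t\<bar> \<le> M * \<bar>D t\<bar>" and t: "t \<in> {0..T}"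
  shows "\<bar>D t\<bar> \<le> \<bar>D 0\<bar> * exp (M * t)" "\<bar>D 0\<bar> * exp (- (M * t)) \<le> \<bar>D t\<bar>"
proof -
  have cD: "continuous_on {0..t} D"
    by (rule continuous_on_subset[of "{0..T}"], rule DERIV_continuous_on, rule D) (use t in auto)
  have D': "(D has_real_derivative N s) (at s)" if "0 < s" "s < t" for s
    using D[of s] that t by (simp add: at_within_Icc_at)
  have DN: "\<bar>D s * N s\<bar> \<le> M * (D s)\<^sup>2" if "0 < s" "s < t" for s
  proof -
    have "\<bar>D s\<bar> * \<bar>N s\<bar> \<le> \<bar>D s\<bar> * (M * \<bar>D s\<bar>)" using N[of s] that t by (intro mult_left_mono) auto
    then show ?thesis by (simp add: abs_mult power2_eq_square mult_ac)
  qed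
  have "(D t)\<^sup>2 * exp (- 2 * M * t) \<le> (D 0)\<^sup>2 * exp (- 2 * M * 0)"
  proof (rule DERIV_nonpos_imp_decreasing_open[of 0 t "\<lambda>s. (D s)\<^sup>2 * exp (- 2 * M * s)"])
    show "0 \<le> t" using t by simp
    fix s assume s: "0 < s" "s < t"
    have "((\<lambda>s. (D s)\<^sup>2 * exp (- 2 * M * s)) has_real_derivative 2 * (D s * N s - M * (D s)\<^sup>2) * exp (- 2 * M * s)) (at s)"
      by (auto intro!: derivative_eq_intros D' s simp: algebra_simps power2_eq_square)
    moreover have "2 * (D s * N s - M * (D s)\<^sup>2) * exp (- 2 * M * s) \<le> 0"
    proof -
      have "D s * N s - M * (D s)\<^sup>2 \<le> 0" using DN[OF s] by linarith
      then show ?thesis by (simp add: mult_le_0_iff)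
    qed
    ultimately show "\<exists>y. ((\<lambda>s. (D s)\<^sup>2 * exp (- 2 * M * s)) has_real_derivative y) (at s) \<and> y \<le> 0" by blast
  qed (intro continuous_intros cD)
  then have "(D t)\<^sup>2 * exp (- 2 * M * t) * exp (2 * M * t) \<le> (D 0)\<^sup>2 * exp (2 * M * t)"
    by (intro mult_right_mono) auto
  then have "(D t)\<^sup>2 \<le> (\<bar>D 0\<bar> * exp (M * t))\<^sup>2"
    by (simp add: power_mult_distrib exp_double[symmetric] mult.assoc exp_minus)
  then show "\<bar>D t\<bar> \<le> \<bar>D 0\<bar> * exp (M * t)" using abs_le_square_iff[of "D t" "\<bar>D 0\<bar> * exp (M * t)"] by (simp add: abs_mult)
  have "(D 0)\<^sup>2 * exp (2 * M * 0) \<le> (D t)\<^sup>2 * exp (2 * M * t)"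
  proof (rule DERIV_nonneg_imp_increasing_open[of 0 t "\<lambda>s. (D s)\<^sup>2 * exp (2 * M * s)"])
    show "0 \<le> t" using t by simp
    fix s assume s: "0 < s" "s < t"
    have "((\<lambda>s. (D s)\<^sup>2 * exp (2 * M * s)) has_real_derivative 2 * (D s * N s + M * (D s)\<^sup>2) * exp (2 * M * s)) (at s)"
      by (auto intro!: derivative_eq_intros D' s simp: algebra_simps power2_eq_square)
    moreover have "0 \<le> 2 * (D s * N s + M * (D s)\<^sup>2) * exp (2 * M * s)"
    proof -
      have "0 \<le> D s * N s + M * (D s)\<^sup>2" using DN[OF s] by linarith
      then show ?thesis by simp
    qed
    ultimately show "\<exists>y. ((\<lambda>s. (D s)\<^sup>2 * exp (2 * M * s)) has_real_derivative y) (at s) \<and> 0 \<le> y" by blast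
  qed (intro continuous_intros cD)
  then have "(D 0)\<^sup>2 * exp (- 2 * M * t) \<le> (D t)\<^sup>2 * exp (2 * M * t) * exp (- 2 * M * t)"
    by (intro mult_right_mono) auto
  moreover have "exp (- 2 * M * t) = (exp (- (M * t)))\<^sup>2" by (simp add: exp_double[symmetric])
  moreover have "exp (2 * M * t) * exp (- 2 * M * t) = 1" by (simp add: exp_add[symmetric])
  ultimately have "(\<bar>D 0\<bar> * exp (- (M * t)))\<^sup>2 \<le> (D t)\<^sup>2"
    by (simp only: power_mult_distrib power2_abs mult.assoc mult_1_right)
  then show "\<bar>D 0\<bar> * exp (- (M * t)) \<le> \<bar>D t\<bar>" using abs_le_square_iff[of "\<bar>D 0\<bar> * exp (- (M * t))" "D t"] by (simp add: abs_mult)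
qed

text \<open>Everything the estimates use about the solution, free of H^s: a common bound M and
  continuity in time that is uniform in x. The nonlocal term enters through
  \<open>green_deriv\<close>, so the equation is stated without \<open>deriv\<close>.\<close>

locale camassa_holm =
  fixes T M :: real and u ux :: "real \<Rightarrow> real \<Rightarrow> real"
  assumes T: "T > 0" and M: "M > 0"
    and u_deriv: "\<And>t x. t \<in> {0..T} \<Longrightarrow> (u t has_real_derivative ux t x) (at x)"
    and ux_cont: "\<And>t. t \<in> {0..T} \<Longrightarrow> continuous_on UNIV (ux t)"
    and u_bound: "\<And>t x. t \<in> {0..T} \<Longrightarrow> \<bar>u t x\<bar> \<le> M"
    and ux_bound: "\<And>t x. t \<in> {0..T} \<Longrightarrow> \<bar>ux t x\<bar> \<le> M"
    and time_cont: "\<And>t e. t \<in> {0..T} \<Longrightarrow> e > 0 \<Longrightarrow> \<exists>\<delta>>0. \<forall>s\<in>{0..T}. \<bar>s - t\<bar> < \<delta> \<longrightarrow>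
        (\<forall>x. \<bar>u s x - u t x\<bar> \<le> e \<and> \<bar>ux s x - ux t x\<bar> \<le> e)"
    and evolution: "\<And>t x. t \<in> {0..T} \<Longrightarrow> ((\<lambda>\<tau>. u \<tau> x) has_real_derivative
        (- u t x * ux t x - green_deriv (\<lambda>y. (u t y)\<^sup>2 + (1/2) * (ux t y)\<^sup>2) x)) (at t within {0..T})"
begin

section \<open>Regularity of the nonlocal term\<close>

definition F :: "real \<Rightarrow> real \<Rightarrow> real" where "F t y = (u t y)\<^sup>2 + (1/2) * (ux t y)\<^sup>2"
text \<open>\<open>Q\<close> is the nonlocal term P and \<open>R\<close> is P_x.\<close>

abbreviation "Q t \<equiv> green (F t)"
abbreviation "R t \<equiv> green_deriv (F t)"

lemma u_cont: "t \<in> {0..T} \<Longrightarrow> continuous_on UNIV (u t)"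
  using u_deriv by (auto intro!: DERIV_isCont continuous_at_imp_continuous_on)

lemma F_cont: "t \<in> {0..T} \<Longrightarrow> continuous_on UNIV (F t)"
  unfolding F_def[abs_def] by (intro continuous_intros u_cont ux_cont)

lemma F_nonneg: "0 \<le> F t y" by (simp add: F_def)

lemma F_bound: assumes "t \<in> {0..T}" shows "\<bar>F t y\<bar> \<le> 2 * M\<^sup>2"
proof -
  have "(u t y)\<^sup>2 \<le> M\<^sup>2" "(ux t y)\<^sup>2 \<le> M\<^sup>2"
    using u_bound[OF assms, of y] ux_bound[OF assms, of y] M by (simp_all add: abs_le_square_iff[symmetric])
  then have "F t y \<le> 2 * M\<^sup>2" unfolding F_def using zero_le_power2[of M] by linarith
  then show ?thesis using F_nonneg[of t y] by simp
qed

lemma F_time_cont: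
  assumes t: "t \<in> {0..T}" and e: "e > 0"
  shows "\<exists>\<delta>>0. \<forall>s\<in>{0..T}. \<bar>s - t\<bar> < \<delta> \<longrightarrow> (\<forall>x. \<bar>F s x - F t x\<bar> \<le> e)"
proof -
  \<comment> \<open>Each square then moves by at most e/(3M) * 2M = 2e/3, and the weights 1 and 1/2
    in \<open>F\<close> add these up to e.\<close>
  obtain d where d: "d > 0" "\<And>s x. s \<in> {0..T} \<Longrightarrow> \<bar>s - t\<bar> < d \<Longrightarrow> \<bar>u s x - u t x\<bar> \<le> e / (3 * M) \<and> \<bar>ux s x - ux t x\<bar> \<le> e / (3 * M)"
    using time_cont[OF t, of "e / (3 * M)"] e M by auto
  have "\<bar>F s x - F t x\<bar> \<le> e" if s: "s \<in> {0..T}" "\<bar>s - t\<bar> < d" for s x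
  proof -
    have sq: "\<bar>a\<^sup>2 - b\<^sup>2\<bar> \<le> e / (3 * M) * (2 * M)" if "\<bar>a - b\<bar> \<le> e / (3 * M)" "\<bar>a\<bar> \<le> M" "\<bar>b\<bar> \<le> M" for a b :: real
    proof -
      have "\<bar>a\<^sup>2 - b\<^sup>2\<bar> = \<bar>a - b\<bar> * \<bar>a + b\<bar>" by (simp add: abs_mult[symmetric] power2_eq_square algebra_simps)
      also have "\<dots> \<le> e / (3 * M) * (2 * M)" using that e M by (intro mult_mono) auto
      finally show ?thesis .
    qed
    have "e / (3 * M) * (2 * M) = 2 * e / 3" using M by simp
    then have "\<bar>(u s x)\<^sup>2 - (u t x)\<^sup>2\<bar> \<le> 2 * e / 3" "\<bar>(ux s x)\<^sup>2 - (ux t x)\<^sup>2\<bar> \<le> 2 * e / 3"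
      using sq[of "u s x" "u t x"] sq[of "ux s x" "ux t x"] d(2)[OF s, of x] u_bound ux_bound s t by auto
    then show ?thesis unfolding F_def using e by linarith
  qed
  then show ?thesis using d(1) by blast
qed

lemma Q_cont: "t \<in> {0..T} \<Longrightarrow> continuous_on UNIV (Q t)"
  using green_has_derivative[OF F_cont F_bound] by (auto intro!: DERIV_isCont continuous_at_imp_continuous_on)

lemma u_cont2: "continuous_on ({0..T} \<times> UNIV) (\<lambda>(t, x). u t x)"
  by (rule continuous_on_prod_uniform[OF u_cont]) (use time_cont in meson)+

lemma ux_cont2: "continuous_on ({0..T} \<times> UNIV) (\<lambda>(t, x). ux t x)"
  by (rule continuous_on_prod_uniform[OF ux_cont]) (use time_cont in meson)+

lemma F_cont2: "continuous_on ({0..T} \<times> UNIV) (\<lambda>(t, x). F t x)"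
  by (rule continuous_on_prod_uniform[OF F_cont F_time_cont])

lemma Q_cont2: "continuous_on ({0..T} \<times> UNIV) (\<lambda>(t, x). Q t x)"
proof (rule continuous_on_prod_uniform[OF Q_cont])
  fix t e :: real assume t: "t \<in> {0..T}" and e: "e > 0"
  obtain d where d: "d > 0" "\<forall>s\<in>{0..T}. \<bar>s - t\<bar> < d \<longrightarrow> (\<forall>x. \<bar>F s x - F t x\<bar> \<le> e)"
    using F_time_cont[OF t e] by blast
  have "\<bar>Q s x - Q t x\<bar> \<le> e" if "s \<in> {0..T}" "\<bar>s - t\<bar> < d" for s x
    by (rule green_diff[OF F_cont F_bound F_cont F_bound]) (use that t d in auto)
  then show "\<exists>\<delta>>0. \<forall>s\<in>{0..T}. \<bar>s - t\<bar> < \<delta> \<longrightarrow> (\<forall>x. \<bar>Q s x - Q t x\<bar> \<le> e)" using d(1) by blast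
qed

lemma u_Lipschitz: "t \<in> {0..T} \<Longrightarrow> \<bar>u t x - u t y\<bar> \<le> M * \<bar>x - y\<bar>"
  using field_differentiable_bound[of UNIV "u t" "ux t" M x y] u_deriv ux_bound by auto

lemma Q_bound: "t \<in> {0..T} \<Longrightarrow> \<bar>Q t x\<bar> \<le> 2 * M\<^sup>2"
  by (rule green_abs_le[OF F_cont F_bound])

lemma R_deriv: "t \<in> {0..T} \<Longrightarrow> (R t has_real_derivative Q t x - F t x) (at x)"
  by (rule green_deriv_has_derivative[OF F_cont F_bound])

lemma R_Lipschitz:
  assumes t: "t \<in> {0..T}"
  shows "\<bar>R t x - R t y\<bar> \<le> 4 * M\<^sup>2 * \<bar>x - y\<bar>"
proof -
  have "\<bar>Q t z - F t z\<bar> \<le> 4 * M\<^sup>2" for z using Q_bound[OF t, of z] F_bound[OF t, of z] by linarith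
  then show ?thesis using field_differentiable_bound[of UNIV "R t" "\<lambda>z. Q t z - F t z" "4 * M\<^sup>2" x y] R_deriv[OF t] by auto
qed

section \<open>The flow and its Jacobian\<close>

lemma flow_exists:
  "\<exists>q. q 0 = x \<and> (\<forall>t\<in>{0..T}. (q has_real_derivative u t (q t)) (at t within {0..T}))"
proof -
  \<comment> \<open>\<open>picard_global\<close> asks for a field at every real time, so u is frozen
    outside {0..T}.\<close>
  define cl where "cl t = max 0 (min T t)" for t :: real
  have cl: "cl t \<in> {0..T}" for t using T by (auto simp: cl_def)
  have "continuous_on UNIV (\<lambda>p. (cl (fst p), snd p))"
    unfolding cl_def by (intro continuous_intros)
  moreover have "range (\<lambda>p. (cl (fst p), snd p)) \<subseteq> {0..T} \<times> UNIV" using cl by blast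
  ultimately have "continuous_on UNIV (\<lambda>p. case (cl (fst p), snd p) of (t, y) \<Rightarrow> u t y)"
    by (rule continuous_on_compose2[OF u_cont2])
  then have "continuous_on UNIV (\<lambda>(t, y). u (cl t) y)" by (simp add: case_prod_beta')
  from picard_global[OF this, of M M T x] u_bound[OF cl] u_Lipschitz[OF cl] M T
  obtain q where q: "q 0 = x" "\<forall>t\<in>{0..T}. (q has_real_derivative u (cl t) (q t)) (at t within {0..T})" by auto
  have "cl t = t" if "t \<in> {0..T}" for t using that by (auto simp: cl_def)
  then show ?thesis using q by auto
qed

definition flow :: "real \<Rightarrow> real \<Rightarrow> real" where
  "flow x = (SOME q. q 0 = x \<and> (\<forall>t\<in>{0..T}. (q has_real_derivative u t (q t)) (at t within {0..T})))"

lemma flow_0 [simp]: "flow x 0 = x"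
  and flow_deriv: "t \<in> {0..T} \<Longrightarrow> (flow x has_real_derivative u t (flow x t)) (at t within {0..T})"
  using someI_ex[OF flow_exists[of x]] unfolding flow_def[symmetric] by auto

lemma flow_cont: "continuous_on {0..T} (flow x)"
  by (rule DERIV_continuous_on) (rule flow_deriv)

lemma flow_displacement: assumes t: "t \<in> {0..T}" shows "\<bar>flow x t - x\<bar> \<le> M * T"
proof -
  have "norm (flow x t - flow x 0) \<le> M * norm (t - 0)"
    by (rule field_differentiable_bound[of "{0..T}" "flow x" "\<lambda>t. u t (flow x t)"])
      (use flow_deriv u_bound t T in auto)
  also have "\<dots> \<le> M * T" using t M by (intro mult_left_mono) auto
  finally show ?thesis by simp
qed

lemma flow_Lipschitz:
  assumes t: "t \<in> {0..T}"
  shows "\<bar>flow y t - flow x t\<bar> \<le> \<bar>y - x\<bar> * exp (M * T)"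
    and "\<bar>y - x\<bar> * exp (- (M * T)) \<le> \<bar>flow y t - flow x t\<bar>"
proof -
  let ?D = "\<lambda>t. flow y t - flow x t"
  have D: "(?D has_real_derivative u t (flow y t) - u t (flow x t)) (at t within {0..T})" if "t \<in> {0..T}" for t
    using that by (intro derivative_intros flow_deriv)
  have Mt: "M * t \<le> M * T" using t M by (intro mult_left_mono) auto
  have "\<bar>?D t\<bar> \<le> \<bar>?D 0\<bar> * exp (M * t)"
    by (rule gronwall_two_sided(1)[OF D u_Lipschitz t])
  also have "\<dots> \<le> \<bar>?D 0\<bar> * exp (M * T)" using Mt by (intro mult_left_mono) auto
  finally show "\<bar>flow y t - flow x t\<bar> \<le> \<bar>y - x\<bar> * exp (M * T)" by simp
  have "\<bar>?D 0\<bar> * exp (- (M * T)) \<le> \<bar>?D 0\<bar> * exp (- (M * t))" using Mt by (intro mult_left_mono) auto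
  also have "\<dots> \<le> \<bar>?D t\<bar>" by (rule gronwall_two_sided(2)[OF D u_Lipschitz t])
  finally show "\<bar>y - x\<bar> * exp (- (M * T)) \<le> \<bar>flow y t - flow x t\<bar>" by simp
qed

lemma flow_neq: "t \<in> {0..T} \<Longrightarrow> x \<noteq> y \<Longrightarrow> flow x t \<noteq> flow y t"
  using flow_Lipschitz(2)[of t x y] by (auto simp: mult_le_0_iff)

lemma flow_tendsto:
  assumes "t \<in> {0..T}" "X \<longlonglongrightarrow> x" shows "(\<lambda>n. flow (X n) t) \<longlonglongrightarrow> flow x t"
proof (rule LIM_zero_cancel, rule Lim_null_comparison)
  show "eventually (\<lambda>n. norm (flow (X n) t - flow x t) \<le> \<bar>X n - x\<bar> * exp (M * T)) sequentially"
    using flow_Lipschitz(1)[OF assms(1)] by simp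
  have "(\<lambda>n. \<bar>X n - x\<bar> * exp (M * T)) \<longlonglongrightarrow> \<bar>x - x\<bar> * exp (M * T)"
    using assms(2) by (intro tendsto_intros)
  then show "(\<lambda>n. \<bar>X n - x\<bar> * exp (M * T)) \<longlonglongrightarrow> 0" by simp
qed

lemma along_flow_cont:
  assumes "continuous_on ({0..T} \<times> UNIV) (\<lambda>(t, x). w t x)"
  shows "continuous_on {0..T} (\<lambda>t. w t (flow x t))"
proof -
  have "continuous_on {0..T} (\<lambda>t. (t, flow x t))" by (intro continuous_intros flow_cont)
  from continuous_on_compose2[OF assms this] show ?thesis by auto
qed

text \<open>Only partial derivatives of u are given, so the chain rule is redone by hand: the
  increment in space at time \<open>\<tau>\<close> comes from the mean value theorem, with an
  intermediate point that tends to the particle, and u_x is jointly continuous. The transport terms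
  u u_x then cancel.\<close>

lemma u_along_flow:
  assumes t: "t \<in> {0..T}"
  shows "((\<lambda>\<tau>. u \<tau> (flow x \<tau>)) has_real_derivative - R t (flow x t)) (at t within {0..T})"
proof -
  let ?q = "flow x" and ?A = "at t within {0..T}"
  have "\<forall>\<tau>\<in>{0..T}. \<exists>z. \<bar>z - ?q t\<bar> \<le> \<bar>?q \<tau> - ?q t\<bar> \<and> u \<tau> (?q \<tau>) - u \<tau> (?q t) = ux \<tau> z * (?q \<tau> - ?q t)"
    using real_mean_value[OF u_deriv] by blast
  then obtain z where z: "\<And>\<tau>. \<tau> \<in> {0..T} \<Longrightarrow> \<bar>z \<tau> - ?q t\<bar> \<le> \<bar>?q \<tau> - ?q t\<bar>"
    "\<And>\<tau>. \<tau> \<in> {0..T} \<Longrightarrow> u \<tau> (?q \<tau>) - u \<tau> (?q t) = ux \<tau> (z \<tau>) * (?q \<tau> - ?q t)"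
    by metis
  have in_T: "eventually (\<lambda>\<tau>. \<tau> \<in> {0..T}) ?A" by (simp add: eventually_at_filter)
  have q: "(?q \<longlongrightarrow> ?q t) ?A" using flow_cont[of x] t unfolding continuous_on by blast
  have "((\<lambda>\<tau>. z \<tau> - ?q t) \<longlongrightarrow> 0) ?A"
  proof (rule Lim_null_comparison)
    show "eventually (\<lambda>\<tau>. norm (z \<tau> - ?q t) \<le> \<bar>?q \<tau> - ?q t\<bar>) ?A"
      using in_T by eventually_elim (use z(1) in simp)
    show "((\<lambda>\<tau>. \<bar>?q \<tau> - ?q t\<bar>) \<longlongrightarrow> 0) ?A" using q by (intro tendsto_rabs_zero LIM_zero)
  qed
  then have "(z \<longlongrightarrow> ?q t) ?A" by (rule LIM_zero_cancel)
  then have "((\<lambda>\<tau>. (\<tau>, z \<tau>)) \<longlongrightarrow> (t, ?q t)) ?A" by (intro tendsto_Pair tendsto_ident_at)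
  from continuous_on_tendsto_compose[OF ux_cont2 this]
  have uz: "((\<lambda>\<tau>. ux \<tau> (z \<tau>)) \<longlongrightarrow> ux t (?q t)) ?A"
    using t in_T by (auto elim: eventually_mono)
  have qd: "((\<lambda>\<tau>. (?q \<tau> - ?q t) / (\<tau> - t)) \<longlongrightarrow> u t (?q t)) ?A"
    using flow_deriv[OF t, of x] by (simp add: has_field_derivative_iff)
  have ud: "((\<lambda>\<tau>. (u \<tau> (?q t) - u t (?q t)) / (\<tau> - t)) \<longlongrightarrow> - u t (?q t) * ux t (?q t) - R t (?q t)) ?A"
    using evolution[OF t, of "?q t"] by (simp add: has_field_derivative_iff F_def[abs_def])
  have "((\<lambda>\<tau>. ux \<tau> (z \<tau>) * ((?q \<tau> - ?q t) / (\<tau> - t)) + (u \<tau> (?q t) - u t (?q t)) / (\<tau> - t))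
     \<longlongrightarrow> ux t (?q t) * u t (?q t) + (- u t (?q t) * ux t (?q t) - R t (?q t))) ?A"
    by (intro tendsto_intros uz qd ud)
  then have "((\<lambda>\<tau>. ux \<tau> (z \<tau>) * ((?q \<tau> - ?q t) / (\<tau> - t)) + (u \<tau> (?q t) - u t (?q t)) / (\<tau> - t))
     \<longlongrightarrow> - R t (?q t)) ?A" by simp
  moreover have "eventually (\<lambda>\<tau>. ux \<tau> (z \<tau>) * ((?q \<tau> - ?q t) / (\<tau> - t)) + (u \<tau> (?q t) - u t (?q t)) / (\<tau> - t)
     = (u \<tau> (?q \<tau>) - u t (?q t)) / (\<tau> - t)) ?A"
    using in_T
  proof eventually_elim
    case (elim \<tau>)
    have "u \<tau> (?q \<tau>) - u t (?q t) = ux \<tau> (z \<tau>) * (?q \<tau> - ?q t) + (u \<tau> (?q t) - u t (?q t))"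
      using z(2)[OF elim] by simp
    then show ?case by (simp only: add_divide_distrib times_divide_eq_right)
  qed
  ultimately show ?thesis unfolding has_field_derivative_iff by (rule Lim_transform_eventually)
qed

text \<open>The relative rate at which the gap between two particles changes. It needs no derivative
  of u and tends to u_x when the particles merge.\<close>

definition quot :: "real \<Rightarrow> real \<Rightarrow> real \<Rightarrow> real" where
  "quot y x t = (u t (flow y t) - u t (flow x t)) / (flow y t - flow x t)"

lemma quot_bound: assumes "t \<in> {0..T}" "y \<noteq> x" shows "\<bar>quot y x t\<bar> \<le> M"
  using u_Lipschitz[OF assms(1), of "flow y t" "flow x t"] flow_neq[OF assms]
  by (simp add: quot_def divide_le_eq)

lemma quot_cont: assumes "y \<noteq> x" shows "continuous_on {0..T} (quot y x)"
  unfolding quot_def[abs_def] using flow_neq assms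
  by (intro continuous_intros along_flow_cont[OF u_cont2] flow_cont) auto

lemma quot_tendsto:
  assumes "t \<in> {0..T}" "X \<longlonglongrightarrow> x" "\<And>n. X n \<noteq> x"
  shows "(\<lambda>n. quot (X n) x t) \<longlonglongrightarrow> ux t (flow x t)"
  unfolding quot_def
  by (rule difference_quotient_LIMSEQ[OF u_deriv flow_tendsto]) (use assms flow_neq in auto)

text \<open>The gap D solves the linear equation D' = \<open>quot\<close> D. The integrating factor
  avoids a logarithm and with it a distinction by the sign of D.\<close>

lemma flow_diff_eq:
  assumes t: "t \<in> {0..T}" and n: "y \<noteq> x"
  shows "flow y t - flow x t = (y - x) * exp (integral {0..t} (quot y x))"
proof -
  let ?D = "\<lambda>t. flow y t - flow x t" and ?I = "\<lambda>t. integral {0..t} (quot y x)"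
  have "((\<lambda>t. ?D t * exp (- ?I t)) has_real_derivative 0) (at s within {0..T})" if s: "s \<in> {0..T}" for s
  proof -
    have I: "(?I has_real_derivative quot y x s) (at s within {0..T})"
      by (rule integral_has_real_derivative[OF quot_cont[OF n] s])
    have D: "(?D has_real_derivative quot y x s * ?D s) (at s within {0..T})"
      using flow_neq[OF s n] by (auto intro!: derivative_eq_intros flow_deriv s simp: quot_def)
    have "((\<lambda>t. exp (- ?I t)) has_real_derivative exp (- ?I s) * (- quot y x s)) (at s within {0..T})"
      by (auto intro!: derivative_eq_intros I)
    from DERIV_mult[OF D this] show ?thesis by (rule DERIV_cong) (simp add: algebra_simps)
  qed
  from has_field_derivative_zero_constant[OF convex_real_interval(5) this]
  obtain c where c: "\<And>s. s \<in> {0..T} \<Longrightarrow> ?D s * exp (- ?I s) = c" by blast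
  have "?D t * exp (- ?I t) = ?D 0 * exp (- ?I 0)" using c[OF t] c[of 0] T by simp
  then have "?D t * exp (- ?I t) * exp (?I t) = (y - x) * exp (?I t)" by simp
  then show ?thesis by (simp add: mult.assoc exp_add[symmetric])
qed

definition jac :: "real \<Rightarrow> real \<Rightarrow> real" where
  "jac t x = exp (integral {0..t} (\<lambda>\<tau>. ux \<tau> (flow x \<tau>)))"

text \<open>\<open>flow_diff_eq\<close> writes the difference quotient of the flow as an exponential
  of an integral of \<open>quot\<close>, and dominated convergence under the exponential gives the
  derivative directly, without solving a linearised equation.\<close>

lemma flow_has_jac:
  assumes t: "t \<in> {0..T}"
  shows "((\<lambda>x. flow x t) has_real_derivative jac t x) (at x)"
  unfolding has_field_derivative_iff tendsto_at_iff_sequentially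
proof (intro allI impI)
  fix X assume X: "\<forall>i. X i \<in> UNIV - {x}" "X \<longlonglongrightarrow> x"
  then have n: "X i \<noteq> x" for i by auto
  have sub: "s \<in> {0..T}" if "s \<in> {0..t}" for s using that t by auto
  have "(\<lambda>k. integral {0..t} (quot (X k) x)) \<longlonglongrightarrow> integral {0..t} (\<lambda>\<tau>. ux \<tau> (flow x \<tau>))"
  proof (rule dominated_convergence(2)[where h = "\<lambda>_. M"])
    show "quot (X k) x integrable_on {0..t}" for k
      by (rule integrable_continuous_interval, rule continuous_on_subset[OF quot_cont[OF n]]) (use t in auto)
  qed (use quot_bound n quot_tendsto X sub in auto)
  then have "(\<lambda>k. exp (integral {0..t} (quot (X k) x))) \<longlonglongrightarrow> jac t x"
    unfolding jac_def by (rule tendsto_exp)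
  moreover have "exp (integral {0..t} (quot (X k) x)) = (flow (X k) t - flow x t) / (X k - x)" for k
    using flow_diff_eq[OF t n, of k] n[of k] by simp
  ultimately show "((\<lambda>y. (flow y t - flow x t) / (y - x)) \<circ> X) \<longlonglongrightarrow> jac t x" by (simp add: o_def)
qed

lemma jac_bounds: assumes t: "t \<in> {0..T}" shows "0 \<le> jac t x" "jac t x \<le> exp (M * T)"
proof -
  show "0 \<le> jac t x" by (simp add: jac_def)
  have "\<bar>integral {0..t} (\<lambda>\<tau>. ux \<tau> (flow x \<tau>))\<bar> \<le> M * (t - 0)"
    unfolding real_norm_def[symmetric]
    by (rule integral_bound) (use t ux_bound in \<open>auto intro: continuous_on_subset[OF along_flow_cont[OF ux_cont2]]\<close>)
  also have "\<dots> \<le> M * T" using t M by (intro mult_left_mono) auto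
  finally show "jac t x \<le> exp (M * T)" unfolding jac_def by simp
qed

lemma jac_cont: assumes t: "t \<in> {0..T}" shows "continuous_on UNIV (jac t)"
  unfolding continuous_on_sequentially
proof (intro allI ballI impI)
  fix X and x :: real assume X: "(\<forall>n. X n \<in> UNIV) \<and> X \<longlonglongrightarrow> x"
  have sub: "s \<in> {0..T}" if "s \<in> {0..t}" for s using that t by auto
  have "(\<lambda>k. integral {0..t} (\<lambda>\<tau>. ux \<tau> (flow (X k) \<tau>))) \<longlonglongrightarrow> integral {0..t} (\<lambda>\<tau>. ux \<tau> (flow x \<tau>))"
  proof (rule dominated_convergence(2)[where h = "\<lambda>_. M"])
    show "(\<lambda>\<tau>. ux \<tau> (flow (X k) \<tau>)) integrable_on {0..t}" for k
      by (rule integrable_continuous_interval, rule continuous_on_subset[OF along_flow_cont[OF ux_cont2]]) (use t in auto)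
    show "(\<lambda>k. ux \<tau> (flow (X k) \<tau>)) \<longlonglongrightarrow> ux \<tau> (flow x \<tau>)" if "\<tau> \<in> {0..t}" for \<tau>
      by (rule continuous_on_tendsto_compose[OF ux_cont[OF sub[OF that]] flow_tendsto[OF sub[OF that]]]) (use X in auto)
  qed (use ux_bound sub in auto)
  then show "(jac t \<circ> X) \<longlonglongrightarrow> jac t x" unfolding o_def jac_def by (rule tendsto_exp)
qed

text \<open>The integrand equals u^2 - u_x^2 / 2 - P. The limit of merging particles is taken in the
  time-integrated identity for \<open>quot\<close>; \<open>R\<close> is Lipschitz, so its quotients
  are dominated, and they converge to R' = Q - F.\<close>

lemma ux_along_flow:
  assumes t: "t \<in> {0..T}"
  shows "((\<lambda>\<tau>. F \<tau> (flow x \<tau>) - Q \<tau> (flow x \<tau>) - (ux \<tau> (flow x \<tau>))\<^sup>2) has_integral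
    ux t (flow x t) - ux 0 x) {0..t}"
proof -
  have sub: "s \<in> {0..T}" if "s \<in> {0..t}" for s using that t by auto
  define X where "X k = x + 1 / real (Suc k)" for k
  have n: "X k \<noteq> x" for k by (simp add: X_def)
  have "X \<longlonglongrightarrow> x + 0" unfolding X_def by (intro tendsto_intros LIMSEQ_Suc lim_1_over_n)
  then have X: "X \<longlonglongrightarrow> x" by simp
  \<comment> \<open>The time derivative of \<open>quot (X k) x\<close> by the quotient rule: the
    numerator changes at minus the difference of \<open>R\<close>, and the denominator changes at
    the rate given by the numerator, whence the square.\<close>
  define g where "g k s = - ((R s (flow (X k) s) - R s (flow x s)) / (flow (X k) s - flow x s)) - (quot (X k) x s)\<^sup>2" for k s
  have I: "(g k has_integral quot (X k) x t - quot (X k) x 0) {0..t}" for k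
  proof (rule fundamental_theorem_of_calculus)
    show "0 \<le> t" using t by simp
    fix s assume "s \<in> {0..t}"
    then have s: "s \<in> {0..T}" by (rule sub)
    have "(quot (X k) x has_real_derivative g k s) (at s within {0..T})"
    proof -
      let ?d = "\<lambda>s. flow (X k) s - flow x s" and ?n = "\<lambda>s. u s (flow (X k) s) - u s (flow x s)"
      have d0: "?d s \<noteq> 0" using flow_neq[OF s n[of k]] by simp
      have nd: "(?n has_real_derivative - R s (flow (X k) s) - - R s (flow x s)) (at s within {0..T})"
        by (intro DERIV_diff u_along_flow s)
      have dd: "(?d has_real_derivative ?n s) (at s within {0..T})"
        by (intro DERIV_diff flow_deriv s)
      have alg: "((- b - - a) * d - m * m) / (d * d) = - ((b - a) / d) - (m / d)\<^sup>2" if "d \<noteq> 0" for a b d m :: real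
        using that by (simp add: field_simps power2_eq_square)
      show ?thesis unfolding quot_def[abs_def] g_def
        by (rule DERIV_cong[OF DERIV_divide[OF nd dd d0]]) (rule alg[OF d0])
    qed
    then have "(quot (X k) x has_real_derivative g k s) (at s within {0..t})"
      by (rule DERIV_subset) (use t in auto)
    then show "(quot (X k) x has_vector_derivative g k s) (at s within {0..t})"
      by (simp add: has_real_derivative_iff_has_vector_derivative)
  qed
  let ?g = "\<lambda>\<tau>. F \<tau> (flow x \<tau>) - Q \<tau> (flow x \<tau>) - (ux \<tau> (flow x \<tau>))\<^sup>2"
  have lim: "(\<lambda>k. g k s) \<longlonglongrightarrow> ?g s" if "s \<in> {0..t}" for s
  proof -
    note s = sub[OF that]
    have "(\<lambda>k. (R s (flow (X k) s) - R s (flow x s)) / (flow (X k) s - flow x s)) \<longlonglongrightarrow> Q s (flow x s) - F s (flow x s)"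
      by (rule difference_quotient_LIMSEQ[OF R_deriv flow_tendsto]) (use s X n flow_neq in auto)
    then have "(\<lambda>k. g k s) \<longlonglongrightarrow> - (Q s (flow x s) - F s (flow x s)) - (ux s (flow x s))\<^sup>2"
      unfolding g_def by (intro tendsto_intros quot_tendsto[OF s X n])
    then show ?thesis by simp
  qed
  have bound: "norm (g k s) \<le> 4 * M\<^sup>2 + M\<^sup>2" if "s \<in> {0..t}" for k s
  proof -
    note s = sub[OF that]
    have "\<bar>(R s (flow (X k) s) - R s (flow x s)) / (flow (X k) s - flow x s)\<bar> \<le> 4 * M\<^sup>2"
      using R_Lipschitz[OF s, of "flow (X k) s" "flow x s"] flow_neq[OF s n[of k]] by (simp add: divide_le_eq)
    moreover have "(quot (X k) x s)\<^sup>2 \<le> M\<^sup>2"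
      using quot_bound[OF s n, of k] M by (simp add: abs_le_square_iff[symmetric])
    moreover have "0 \<le> (quot (X k) x s)\<^sup>2" by simp
    ultimately show ?thesis unfolding g_def real_norm_def by linarith
  qed
  have "?g integrable_on {0..t} \<and> (\<lambda>k. integral {0..t} (g k)) \<longlonglongrightarrow> integral {0..t} ?g"
    using dominated_convergence[of g "{0..t}" "\<lambda>_. 4 * M\<^sup>2 + M\<^sup>2" ?g] I bound lim by (auto intro: has_integral_integrable)
  moreover have "(\<lambda>k. integral {0..t} (g k)) \<longlonglongrightarrow> ux t (flow x t) - ux 0 (flow x 0)"
    unfolding integral_unique[OF I] by (intro tendsto_diff quot_tendsto t X n) (use T in auto)
  ultimately have "?g integrable_on {0..t}" "integral {0..t} ?g = ux t (flow x t) - ux 0 x"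
    using LIMSEQ_unique by auto
  then show ?thesis using has_integral_integral by metis
qed

section \<open>Growth of u and u_x along particles\<close>

definition W :: "real \<Rightarrow> real \<Rightarrow> real" where
  "W t x = \<bar>u t (flow x t)\<bar> + \<bar>ux t (flow x t)\<bar>"

lemma W_nonneg: "0 \<le> W t x" by (simp add: W_def)

lemma QF_integrable:
  assumes t: "t \<in> {0..T}"
  shows "(\<lambda>\<tau>. 2 * Q \<tau> (flow x \<tau>) + F \<tau> (flow x \<tau>)) integrable_on {0..t}"
proof -
  have "continuous_on {0..T} (\<lambda>\<tau>. 2 * Q \<tau> (flow x \<tau>) + F \<tau> (flow x \<tau>))"
    using along_flow_cont[OF Q_cont2, of x] along_flow_cont[OF F_cont2, of x]
    by (intro continuous_on_add continuous_on_mult_left)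
  then show ?thesis
    by (intro integrable_continuous_interval, rule continuous_on_subset) (use t in auto)
qed

text \<open>u changes at rate at most |R| <= Q, and u_x at rate |F - Q - u_x^2| <= Q + F because
  u_x^2 <= 2 F. Comparing the integrated identities avoids differentiating absolute values.\<close>

lemma W_integral_inequality:
  assumes t: "t \<in> {0..T}"
  shows "W t x \<le> W 0 x + integral {0..t} (\<lambda>\<tau>. 2 * Q \<tau> (flow x \<tau>) + F \<tau> (flow x \<tau>))"
proof -
  let ?f = "\<lambda>w \<tau>. w \<tau> (flow x \<tau>)"
  have sub: "s \<in> {0..T}" if "s \<in> {0..t}" for s using that t by auto
  have Qi: "?f Q integrable_on {0..t}" and Fi: "?f F integrable_on {0..t}"
    by (rule integrable_continuous_interval, rule continuous_on_subset[OF along_flow_cont[OF Q_cont2]]; use t in simp)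
      (rule integrable_continuous_interval, rule continuous_on_subset[OF along_flow_cont[OF F_cont2]]; use t in simp)
  have RQ: "\<bar>R s y\<bar> \<le> Q s y" if "s \<in> {0..t}" for s y
    by (rule green_deriv_abs_le[OF F_cont F_bound F_nonneg]) (use sub[OF that] in auto)
  have "((\<lambda>\<tau>. - R \<tau> (flow x \<tau>)) has_integral u t (flow x t) - u 0 (flow x 0)) {0..t}"
  proof (rule fundamental_theorem_of_calculus)
    fix s assume s: "s \<in> {0..t}"
    have "((\<lambda>\<tau>. u \<tau> (flow x \<tau>)) has_real_derivative - R s (flow x s)) (at s within {0..t})"
      by (rule DERIV_subset[OF u_along_flow[OF sub[OF s]]]) (use t in auto)
    then show "((\<lambda>\<tau>. u \<tau> (flow x \<tau>)) has_vector_derivative - R s (flow x s)) (at s within {0..t})"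
      by (simp add: has_real_derivative_iff_has_vector_derivative)
  qed (use t in simp)
  then have "\<bar>u t (flow x t) - u 0 x\<bar> \<le> integral {0..t} (?f Q)"
    using integral_norm_bound_integral[of "\<lambda>\<tau>. - R \<tau> (flow x \<tau>)" "{0..t}" "?f Q"] Qi RQ
    by (auto simp: has_integral_iff)
  moreover have "\<bar>ux t (flow x t) - ux 0 x\<bar> \<le> integral {0..t} (\<lambda>\<tau>. Q \<tau> (flow x \<tau>) + F \<tau> (flow x \<tau>))"
  proof -
    let ?g = "\<lambda>\<tau>. F \<tau> (flow x \<tau>) - Q \<tau> (flow x \<tau>) - (ux \<tau> (flow x \<tau>))\<^sup>2"
    have "norm (?g s) \<le> Q s (flow x s) + F s (flow x s)" if "s \<in> {0..t}" for s
    proof -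
      have "0 \<le> Q s (flow x s)" using RQ[OF that, of "flow x s"] by linarith
      then show ?thesis by (auto simp: F_def abs_le_iff)
    qed
    then show ?thesis
      using integral_norm_bound_integral[of ?g "{0..t}" "\<lambda>\<tau>. Q \<tau> (flow x \<tau>) + F \<tau> (flow x \<tau>)"]
        integrable_add[OF Qi Fi] ux_along_flow[OF t, of x]
      by (auto simp: has_integral_iff)
  qed
  moreover have "integral {0..t} (\<lambda>\<tau>. 2 * Q \<tau> (flow x \<tau>) + F \<tau> (flow x \<tau>)) =
     integral {0..t} (?f Q) + integral {0..t} (\<lambda>\<tau>. Q \<tau> (flow x \<tau>) + F \<tau> (flow x \<tau>))"
    using integral_add[OF Qi integrable_add[OF Qi Fi]] by (simp add: add.assoc[symmetric])
  ultimately show ?thesis unfolding W_def by simp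
qed

end

subsection \<open>Comparison and convolution\<close>

text \<open>Iterating the inequality from the crude bound \<open>m\<close> needs no measurability of \<open>f\<close> in time.\<close>
lemma gronwall_family:
  fixes f g :: "real \<Rightarrow> 'a \<Rightarrow> real" and a b :: "'a \<Rightarrow> real"
  assumes m: "\<And>t x. t \<in> {0..T} \<Longrightarrow> f t x \<le> m" and nn: "0 \<le> m" "0 \<le> k" "0 \<le> \<kappa>"
    and ab: "\<And>x. a x \<le> b x" and b: "\<And>x. 0 \<le> b x"
    and gi: "\<And>t x. t \<in> {0..T} \<Longrightarrow> (\<lambda>\<tau>. g \<tau> x) integrable_on {0..t}"
    and ineq: "\<And>t x. t \<in> {0..T} \<Longrightarrow> f t x \<le> a x + integral {0..t} (\<lambda>\<tau>. g \<tau> x)"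
    and step: "\<And>\<tau> \<sigma> e x. \<tau> \<in> {0..T} \<Longrightarrow> 1 \<le> \<sigma> \<Longrightarrow> 0 \<le> e \<Longrightarrow> (\<And>y. f \<tau> y \<le> \<sigma> * b y + e) \<Longrightarrow>
      g \<tau> x \<le> \<kappa> * \<sigma> * b x + k * e"
    and t: "t \<in> {0..T}"
  shows "f t x \<le> exp (\<kappa> * t) * b x"
proof -
  \<comment> \<open>Feeding the n-th bound into \<open>step\<close> with \<open>\<sigma>\<close> =
    exp(\<open>\<kappa>\<close> t) and e = m (k t)^n / n! and integrating in time turns the error
    into its successor and the first term into exp(\<open>\<kappa>\<close> t) b - b. The missing b
    is what pays for a.\<close>
  have claim: "f t x \<le> exp (\<kappa> * t) * b x + m * ((k * t) ^ n / fact n)" if "t \<in> {0..T}" for n t x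
    using that
  proof (induction n arbitrary: t x)
    case 0
    then show ?case using m[of t x] b[of x] by (simp add: add_increasing)
  next
    case (Suc n)
    let ?r = "\<lambda>\<tau>. \<kappa> * exp (\<kappa> * \<tau>) * b x + k * (m * ((k * \<tau>) ^ n / fact n))"
    let ?S = "\<lambda>\<tau>. exp (\<kappa> * \<tau>) * b x + m * ((k * \<tau>) ^ Suc n / fact (Suc n))"
    have I: "(?r has_integral ?S t - ?S 0) {0..t}"
    proof (rule fundamental_theorem_of_calculus)
      fix \<tau>
      have "((\<lambda>\<tau>. (k * \<tau>) ^ Suc n) has_real_derivative real (Suc n) * (k * (k * \<tau>) ^ (Suc n - Suc 0))) (at \<tau> within {0..t})"
        by (rule DERIV_power) (auto intro!: derivative_eq_intros)
      from DERIV_cdivide[OF this, of "fact (Suc n)"]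
      have "((\<lambda>\<tau>. (k * \<tau>) ^ Suc n / fact (Suc n)) has_real_derivative k * ((k * \<tau>) ^ n / fact n)) (at \<tau> within {0..t})"
        by (rule DERIV_cong) (simp add: field_simps del: of_nat_Suc)
      note P = DERIV_cmult[OF this, of m]
      have e: "((\<lambda>\<tau>. exp (\<kappa> * \<tau>) * b x) has_real_derivative \<kappa> * exp (\<kappa> * \<tau>) * b x) (at \<tau> within {0..t})"
        by (auto intro!: derivative_eq_intros)
      have "(?S has_real_derivative ?r \<tau>) (at \<tau> within {0..t})"
        using DERIV_add[OF e P] by (rule DERIV_cong) (simp only: mult_ac)
      then show "(?S has_vector_derivative ?r \<tau>) (at \<tau> within {0..t})"
        by (simp only: has_real_derivative_iff_has_vector_derivative)
    qed (use Suc.prems in simp)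
    have "integral {0..t} (\<lambda>\<tau>. g \<tau> x) \<le> integral {0..t} ?r"
    proof (rule integral_le[OF gi[OF Suc.prems] has_integral_integrable[OF I]])
      fix \<tau> assume "\<tau> \<in> {0..t}"
      then have \<tau>: "\<tau> \<in> {0..T}" "0 \<le> \<tau>" using Suc.prems by auto
      have "g \<tau> x \<le> \<kappa> * exp (\<kappa> * \<tau>) * b x + k * (m * ((k * \<tau>) ^ n / fact n))"
        by (rule step[OF \<tau>(1) _ _ Suc.IH[OF \<tau>(1)]]) (use nn \<tau> in auto)
      then show "g \<tau> x \<le> ?r \<tau>" .
    qed
    also have "\<dots> = ?S t - b x" unfolding integral_unique[OF I] by simp
    finally show ?case using ineq[OF Suc.prems, of x] ab[of x] by linarith
  qed
  have "(\<lambda>n. inverse (fact n) * (k * t) ^ n) \<longlonglongrightarrow> 0"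
    by (rule summable_LIMSEQ_zero[OF summable_exp])
  then have "(\<lambda>n. exp (\<kappa> * t) * b x + m * ((k * t) ^ n / fact n)) \<longlonglongrightarrow> exp (\<kappa> * t) * b x + m * 0"
    by (intro tendsto_intros) (simp add: field_simps)
  then show ?thesis
    by (intro tendsto_lowerbound[of _ _ sequentially "f t x"]) (use claim[OF t] in auto)
qed

section \<open>Convolution with two-sided exponentials\<close>

definition conv_exp :: "real \<Rightarrow> (real \<Rightarrow> real) \<Rightarrow> real \<Rightarrow> real" where
  "conv_exp a w x = (\<integral>y. exp (- a * \<bar>x - y\<bar>) * w y \<partial>lborel)"

lemma conv_exp_integrable:
  fixes w :: "real \<Rightarrow> real"
  assumes "a > 0" "w \<in> borel_measurable borel" "\<And>y. \<bar>w y\<bar> \<le> m"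
  shows "integrable lborel (\<lambda>y. exp (- a * \<bar>x - y\<bar>) * w y)"
  using has_bochner_integral_exp_abs[OF assms(1), of x] assms(2,3)
  by (intro integrable_mult_bounded) (auto simp: has_bochner_integral_iff)

lemma conv_exp_const:
  assumes "a > 0" shows "conv_exp a (\<lambda>_. c) x = 2 * c / a"
  using has_bochner_integral_exp_abs[OF assms, of x] by (simp add: conv_exp_def has_bochner_integral_iff)

lemma conv_exp_measurable [measurable]:
  assumes [measurable]: "w \<in> borel_measurable borel"
  shows "conv_exp a w \<in> borel_measurable borel"
  unfolding conv_exp_def[abs_def] by measurable

lemma conv_exp_nonneg: "(\<And>y. 0 \<le> w y) \<Longrightarrow> 0 \<le> conv_exp a w x"
  unfolding conv_exp_def by (intro Bochner_Integration.integral_nonneg) auto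

lemma conv_exp_mono:
  fixes w w' :: "real \<Rightarrow> real"
  assumes "a > 0" "w \<in> borel_measurable borel" "\<And>y. \<bar>w y\<bar> \<le> m" "w' \<in> borel_measurable borel" "\<And>y. \<bar>w' y\<bar> \<le> m'"
    and le: "\<And>y. w y \<le> w' y"
  shows "conv_exp a w x \<le> conv_exp a w' x"
  unfolding conv_exp_def
  by (intro integral_mono conv_exp_integrable[OF assms(1-3)] conv_exp_integrable[OF assms(1,4,5)] mult_left_mono le) auto

lemma conv_exp_add:
  fixes w w' :: "real \<Rightarrow> real"
  assumes "a > 0" "w \<in> borel_measurable borel" "\<And>y. \<bar>w y\<bar> \<le> m" "w' \<in> borel_measurable borel" "\<And>y. \<bar>w' y\<bar> \<le> m'"
  shows "conv_exp a (\<lambda>y. w y + w' y) x = conv_exp a w x + conv_exp a w' x"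
  unfolding conv_exp_def distrib_left
  by (intro Bochner_Integration.integral_add conv_exp_integrable[OF assms(1-3)] conv_exp_integrable[OF assms(1,4,5)])

lemma conv_exp_cmult: "conv_exp a (\<lambda>y. c * w y) x = c * conv_exp a w x"
proof -
  have "conv_exp a (\<lambda>y. c * w y) x = (\<integral>y. c * (exp (- a * \<bar>x - y\<bar>) * w y) \<partial>lborel)"
    unfolding conv_exp_def by (simp add: mult_ac)
  then show ?thesis by (simp add: conv_exp_def)
qed

lemma conv_exp_bound:
  fixes w :: "real \<Rightarrow> real"
  assumes a: "a > 0" and w: "w \<in> borel_measurable borel" and b: "\<And>y. \<bar>w y\<bar> \<le> m"
  shows "\<bar>conv_exp a w x\<bar> \<le> 2 * m / a"
proof -
  have "\<bar>conv_exp a w x\<bar> \<le> conv_exp a (\<lambda>_. m) x"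
    unfolding conv_exp_def
  proof (rule order_trans[OF integral_abs_bound], rule integral_mono)
    show "integrable lborel (\<lambda>y. \<bar>exp (- a * \<bar>x - y\<bar>) * w y\<bar>)"
      using conv_exp_integrable[OF assms] by (rule integrable_abs)
    show "integrable lborel (\<lambda>y. exp (- a * \<bar>x - y\<bar>) * m)"
      by (rule conv_exp_integrable[OF a, of _ "\<bar>m\<bar>"]) auto
    fix y show "\<bar>exp (- a * \<bar>x - y\<bar>) * w y\<bar> \<le> exp (- a * \<bar>x - y\<bar>) * m"
      using b[of y] by (simp add: abs_mult)
  qed
  then show ?thesis using conv_exp_const[OF a] by simp
qed

lemma nn_integral_conv_exp:
  fixes w :: "real \<Rightarrow> real"
  assumes "a > 0" "w \<in> borel_measurable borel" "\<And>y. \<bar>w y\<bar> \<le> m" and nn: "\<And>y. 0 \<le> w y"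
  shows "(\<integral>\<^sup>+y. ennreal (exp (- a * \<bar>x - y\<bar>) * w y) \<partial>lborel) = ennreal (conv_exp a w x)"
  unfolding conv_exp_def
  by (rule nn_integral_eq_integral[OF conv_exp_integrable[OF assms(1-3)]]) (use nn in auto)

lemma conv_exp_antimono:
  fixes w :: "real \<Rightarrow> real"
  assumes a: "0 < a" "a \<le> a'" and w: "w \<in> borel_measurable borel" "\<And>y. \<bar>w y\<bar> \<le> m" and nn: "\<And>y. 0 \<le> w y"
  shows "conv_exp a' w x \<le> conv_exp a w x"
  unfolding conv_exp_def
proof (rule integral_mono)
  show "integrable lborel (\<lambda>y. exp (- a' * \<bar>x - y\<bar>) * w y)" "integrable lborel (\<lambda>y. exp (- a * \<bar>x - y\<bar>) * w y)"
    using a conv_exp_integrable[OF _ w, of a' x] conv_exp_integrable[OF _ w, of a x] by auto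
  show "exp (- a' * \<bar>x - y\<bar>) * w y \<le> exp (- a * \<bar>x - y\<bar>) * w y" for y
    using a nn[of y] by (intro mult_right_mono) (auto intro!: mult_right_mono)
qed

text \<open>By the triangle inequality, exp(-a'|x-y|) exp(-a|y-z|) is at most exp(-a|x-z|)
  exp(-(a'-a)|x-y|), and the second factor has integral 2 / (a' - a) in y. The gap between the
  exponents is what makes the slower exponential reproduce itself.\<close>

lemma conv_exp_iterated:
  fixes w :: "real \<Rightarrow> real"
  assumes a: "0 < a" "a < a'" and [measurable]: "w \<in> borel_measurable borel" and b: "\<And>y. \<bar>w y\<bar> \<le> m" and nn: "\<And>y. 0 \<le> w y"
  shows "conv_exp a' (conv_exp a w) x \<le> 2 / (a' - a) * conv_exp a w x"
proof -
  have a': "0 < a'" using a by simp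
  let ?J = "\<lambda>y z. ennreal (exp (- a' * \<bar>x - y\<bar>)) * ennreal (exp (- a * \<bar>y - z\<bar>) * w z)"
  have cb: "\<bar>conv_exp a w y\<bar> \<le> 2 * m / a" for y by (rule conv_exp_bound[OF a(1) _ b]) simp
  have "ennreal (conv_exp a' (conv_exp a w) x) = (\<integral>\<^sup>+y. ennreal (exp (- a' * \<bar>x - y\<bar>) * conv_exp a w y) \<partial>lborel)"
    by (rule nn_integral_conv_exp[OF a' _ cb, symmetric]) (use conv_exp_nonneg[OF nn] in auto)
  also have "\<dots> = (\<integral>\<^sup>+y. \<integral>\<^sup>+z. ?J y z \<partial>lborel \<partial>lborel)"
  proof (rule nn_integral_cong)
    fix y
    show "ennreal (exp (- a' * \<bar>x - y\<bar>) * conv_exp a w y) = (\<integral>\<^sup>+z. ?J y z \<partial>lborel)"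
      unfolding ennreal_mult[OF exp_ge_zero conv_exp_nonneg[OF nn]] nn_integral_conv_exp[OF a(1) assms(3) b nn, symmetric]
      by (rule nn_integral_cmult[symmetric]) measurable
  qed
  also have "\<dots> = (\<integral>\<^sup>+z. \<integral>\<^sup>+y. ?J y z \<partial>lborel \<partial>lborel)"
    by (rule lborel_pair.Fubini') measurable
  also have "\<dots> \<le> (\<integral>\<^sup>+z. ennreal (2 / (a' - a)) * ennreal (exp (- a * \<bar>x - z\<bar>) * w z) \<partial>lborel)"
  proof (rule nn_integral_mono)
    fix z
    have "(\<integral>\<^sup>+y. ?J y z \<partial>lborel)
      \<le> (\<integral>\<^sup>+y. ennreal (exp (- a * \<bar>x - z\<bar>) * w z) * ennreal (exp (- (a' - a) * \<bar>x - y\<bar>)) \<partial>lborel)"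
    proof (rule nn_integral_mono)
      fix y
      have "a * \<bar>x - z\<bar> \<le> a * (\<bar>x - y\<bar> + \<bar>y - z\<bar>)" using a by (intro mult_left_mono) auto
      then have "exp (- a' * \<bar>x - y\<bar> + - a * \<bar>y - z\<bar>) \<le> exp (- a * \<bar>x - z\<bar> + - (a' - a) * \<bar>x - y\<bar>)"
        by (simp add: algebra_simps)
      then have "exp (- a' * \<bar>x - y\<bar> + - a * \<bar>y - z\<bar>) * w z \<le> exp (- a * \<bar>x - z\<bar> + - (a' - a) * \<bar>x - y\<bar>) * w z"
        using nn by (rule mult_right_mono)
      then show "?J y z
        \<le> ennreal (exp (- a * \<bar>x - z\<bar>) * w z) * ennreal (exp (- (a' - a) * \<bar>x - y\<bar>))"
        using nn[of z] unfolding exp_add by (simp add: ennreal_mult[symmetric] mult_ac)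
    qed
    also have "\<dots> = ennreal (exp (- a * \<bar>x - z\<bar>) * w z) * (\<integral>\<^sup>+y. ennreal (exp (- (a' - a) * \<bar>x - y\<bar>)) \<partial>lborel)"
      by (rule nn_integral_cmult) measurable
    also have "(\<integral>\<^sup>+y. ennreal (exp (- (a' - a) * \<bar>x - y\<bar>)) \<partial>lborel) = ennreal (2 / (a' - a))"
      using nn_integral_conv_exp[of "a' - a" "\<lambda>_. 1" 1 x] conv_exp_const[of "a' - a" 1 x] a by simp
    finally show "(\<integral>\<^sup>+y. ?J y z \<partial>lborel)
      \<le> ennreal (2 / (a' - a)) * ennreal (exp (- a * \<bar>x - z\<bar>) * w z)" by (simp add: mult.commute)
  qed
  also have "\<dots> = ennreal (2 / (a' - a)) * ennreal (conv_exp a w x)"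
    unfolding nn_integral_conv_exp[OF a(1) assms(3) b nn, symmetric] by (rule nn_integral_cmult) measurable
  also have "\<dots> = ennreal (2 / (a' - a) * conv_exp a w x)"
    using a by (intro ennreal_mult[symmetric] conv_exp_nonneg nn) auto
  finally show ?thesis
    using a conv_exp_nonneg[of w a x, OF nn] by (subst (asm) ennreal_le_iff) auto
qed

section \<open>Pointwise comparison along the flow\<close>

context camassa_holm begin

lemma flow_cont_space: "t \<in> {0..T} \<Longrightarrow> continuous_on UNIV (\<lambda>x. flow x t)"
  using flow_has_jac by (auto intro!: DERIV_isCont continuous_at_imp_continuous_on)

lemma W_measurable: "t \<in> {0..T} \<Longrightarrow> W t \<in> borel_measurable borel"
  unfolding W_def[abs_def]
  by (intro borel_measurable_continuous_onI continuous_intros continuous_on_compose2[OF u_cont] continuous_on_compose2[OF ux_cont] flow_cont_space) auto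

lemma W_bound: "t \<in> {0..T} \<Longrightarrow> W t x \<le> 2 * M"
  using u_bound[of t "flow x t"] ux_bound[of t "flow x t"] by (simp add: W_def)

lemma W_abs_bound: "t \<in> {0..T} \<Longrightarrow> \<bar>W t x\<bar> \<le> 2 * M"
  using W_bound W_nonneg by simp

lemma W_sq_bound: "t \<in> {0..T} \<Longrightarrow> \<bar>(W t x)\<^sup>2\<bar> \<le> (2 * M)\<^sup>2"
  using power_mono[OF W_bound[of t x] W_nonneg, of 2] by simp

lemma F_le_W: "F t (flow x t) \<le> (W t x)\<^sup>2"
proof -
  have "0 \<le> \<bar>u t (flow x t)\<bar> * \<bar>ux t (flow x t)\<bar>" "0 \<le> (ux t (flow x t))\<^sup>2" by auto
  then show ?thesis unfolding F_def W_def power2_sum power2_abs by linarith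
qed

lemma nn_integral_le_flow:
  assumes "f \<in> borel_measurable borel" "t \<in> {0..T}"
  shows "(\<integral>\<^sup>+y. f y \<partial>lborel) \<le> ennreal (exp (M * T)) * (\<integral>\<^sup>+x. f (flow x t) \<partial>lborel)"
  using assms(2) by (intro nn_integral_le_comp[OF assms(1) flow_has_jac jac_cont]) (auto intro: jac_bounds flow_displacement)

text \<open>Passing from positions to labels costs one factor exp(M T) for the Jacobian and two more
  in the kernel, because both ends of the distance are displaced by at most M T.\<close>

lemma Q_le_conv:
  assumes t: "t \<in> {0..T}"
  shows "2 * Q t (flow x t) \<le> exp (3 * (M * T)) * conv_exp 1 (\<lambda>z. (W t z)\<^sup>2) x"
proof -
  have [measurable]: "F t \<in> borel_measurable borel" "W t \<in> borel_measurable borel"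
    using borel_measurable_continuous_onI[OF F_cont[OF t]] W_measurable[OF t] by auto
  have W2: "\<bar>(W t z)\<^sup>2\<bar> \<le> (2 * M)\<^sup>2" for z
    by (rule W_sq_bound) fact
  let ?e = "exp (2 * (M * T))"
  \<comment> \<open>\<open>conv_exp\<close> lacks the factor 1/2 of the Green kernel.\<close>
  have "2 * Q t (flow x t) = conv_exp 1 (F t) (flow x t)"
  proof -
    have "Q t (flow x t) = (\<integral>y. (1/2) * (exp (- 1 * \<bar>flow x t - y\<bar>) * F t y) \<partial>lborel)"
      unfolding green_def by (simp add: mult.assoc)
    then show ?thesis by (simp add: conv_exp_def)
  qed
  then have "ennreal (2 * Q t (flow x t)) = (\<integral>\<^sup>+y. ennreal (exp (- 1 * \<bar>flow x t - y\<bar>) * F t y) \<partial>lborel)"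
    by (simp only: nn_integral_conv_exp[OF zero_less_one \<open>F t \<in> borel_measurable borel\<close> F_bound[OF t] F_nonneg])
  also have "\<dots> \<le> ennreal (exp (M * T)) * (\<integral>\<^sup>+z. ennreal (exp (- 1 * \<bar>flow x t - flow z t\<bar>) * F t (flow z t)) \<partial>lborel)"
    by (rule nn_integral_le_flow) (use t in measurable)
  also have "\<dots> \<le> ennreal (exp (M * T)) * (\<integral>\<^sup>+z. ennreal ?e * ennreal (exp (- 1 * \<bar>x - z\<bar>) * (W t z)\<^sup>2) \<partial>lborel)"
  proof (intro mult_left_mono nn_integral_mono)
    fix z
    have "\<bar>x - z\<bar> \<le> \<bar>flow x t - flow z t\<bar> + 2 * (M * T)"
      using flow_displacement[OF t, of x] flow_displacement[OF t, of z] by linarith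
    then have "exp (- 1 * \<bar>flow x t - flow z t\<bar>) \<le> ?e * exp (- 1 * \<bar>x - z\<bar>)" unfolding exp_add[symmetric] by simp
    then have "exp (- 1 * \<bar>flow x t - flow z t\<bar>) * F t (flow z t) \<le> ?e * exp (- 1 * \<bar>x - z\<bar>) * (W t z)\<^sup>2"
      by (intro mult_mono F_le_W) (auto simp: F_nonneg)
    then show "ennreal (exp (- 1 * \<bar>flow x t - flow z t\<bar>) * F t (flow z t)) \<le> ennreal ?e * ennreal (exp (- 1 * \<bar>x - z\<bar>) * (W t z)\<^sup>2)"
      by (simp add: ennreal_mult[symmetric] mult.assoc ennreal_leI)
  qed simp
  also have "\<dots> = ennreal (exp (M * T)) * (ennreal ?e * ennreal (conv_exp 1 (\<lambda>z. (W t z)\<^sup>2) x))"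
    by (subst nn_integral_cmult, measurable) (simp only: nn_integral_conv_exp[OF zero_less_one _ W2 zero_le_power2] borel_measurable_power \<open>W t \<in> borel_measurable borel\<close>)
  also have "\<dots> = ennreal (exp (3 * (M * T)) * conv_exp 1 (\<lambda>z. (W t z)\<^sup>2) x)"
  proof -
    have "exp (3 * (M * T)) = exp (M * T) * ?e" by (simp add: exp_add[symmetric])
    then show ?thesis using conv_exp_nonneg[of "\<lambda>z. (W t z)\<^sup>2" 1 x]
      by (simp add: ennreal_mult mult.assoc)
  qed
  finally show ?thesis
    using conv_exp_nonneg[of "\<lambda>z. (W t z)\<^sup>2" 1 x] by (subst (asm) ennreal_le_iff) auto
qed

text \<open>In the local term one factor W is traded for its bound 2 M, while the convolution keeps
  its square, so that both the linear and the quadratic comparison can start from here. The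
  exponential is at least 1 and serves as a common factor.\<close>

lemma QF_le:
  assumes t: "t \<in> {0..T}"
  shows "2 * Q t (flow x t) + F t (flow x t) \<le> exp (3 * (M * T)) * (2 * M * W t x + conv_exp 1 (\<lambda>z. (W t z)\<^sup>2) x)"
proof -
  have MT: "0 \<le> M * T" using M T by simp
  have "F t (flow x t) \<le> 1 * (W t x * W t x)" using F_le_W[of t x] by (simp add: power2_eq_square)
  also have "\<dots> \<le> exp (3 * (M * T)) * (2 * M * W t x)"
    using W_bound[OF t, of x] W_nonneg[of t x] MT by (intro mult_mono) auto
  finally show ?thesis using Q_le_conv[OF t, of x] by (simp add: distrib_left)
qed

text \<open>The quadratic source is linearised by W <= 2 M. Constants: with h the added convolution,
  exp(-|.|) * h <= 2/(1 - 3/4) h = 8 h, so W 0 + h is carried to at most 9 h; with the local term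
  this makes 10, and 2 M turns it into 20. An error e contributes 1 + 2 = 3, the 2 being the mass of
  exp(-|.|), hence 6.\<close>

lemma W_le_linear:
  assumes t: "t \<in> {0..T}"
  shows "W t x \<le> exp (20 * (M * exp (3 * (M * T))) * t) * (W 0 x + conv_exp (3/4) (W 0) x)"
proof (rule gronwall_family[where f = W and t = t and x = x and b = "\<lambda>x. W 0 x + conv_exp (3/4) (W 0) x"
    and \<kappa> = "20 * (M * exp (3 * (M * T)))" and a = "W 0" and m = "2 * M" and k = "6 * (M * exp (3 * (M * T)))"
    and g = "\<lambda>\<tau> x. 2 * Q \<tau> (flow x \<tau>) + F \<tau> (flow x \<tau>)" and T = T])
  have T0: "0 \<in> {0..T}" using T by simp
  note w0 = W_measurable[OF T0] W_abs_bound[OF T0] W_nonneg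
  let ?h = "conv_exp (3/4) (W 0)"
  have h: "?h \<in> borel_measurable borel" "\<And>y. \<bar>?h y\<bar> \<le> 16 / 3 * M" "\<And>y. 0 \<le> ?h y"
    using w0(1) conv_exp_bound[OF _ w0(1,2), of "3/4"] conv_exp_nonneg[OF w0(3)] by auto
  show "W 0 x \<le> W 0 x + ?h x" for x using h(3)[of x] by simp
  show "0 \<le> W 0 x + ?h x" for x using h(3)[of x] W_nonneg[of 0 x] by simp
  fix \<tau> \<sigma> e x assume \<tau>: "\<tau> \<in> {0..T}" and \<sigma>: "1 \<le> \<sigma>" and e: "0 \<le> e"
    and hyp: "\<And>y. W \<tau> y \<le> \<sigma> * (W 0 y + ?h y) + e"
  have wt: "W \<tau> \<in> borel_measurable borel" using W_measurable[OF \<tau>] .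
  have W2: "\<bar>(W \<tau> z)\<^sup>2\<bar> \<le> (2 * M)\<^sup>2" for z
    by (rule W_sq_bound) fact
  have "conv_exp 1 (\<lambda>z. (W \<tau> z)\<^sup>2) x \<le> conv_exp 1 (\<lambda>z. 2 * M * W \<tau> z) x"
  proof (rule conv_exp_mono[OF _ _ W2])
    show "\<bar>2 * M * W \<tau> y\<bar> \<le> 2 * M * (2 * M)" for y
      using W_abs_bound[OF \<tau>, of y] M by (simp add: abs_mult)
    show "(W \<tau> y)\<^sup>2 \<le> 2 * M * W \<tau> y" for y
      unfolding power2_eq_square using W_bound[OF \<tau>] W_nonneg by (intro mult_right_mono)
  qed (use wt in auto)
  then have c1: "conv_exp 1 (\<lambda>z. (W \<tau> z)\<^sup>2) x \<le> 2 * M * conv_exp 1 (W \<tau>) x" by (simp only: conv_exp_cmult)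
  have "conv_exp 1 (W \<tau>) x \<le> conv_exp 1 (\<lambda>y. \<sigma> * (W 0 y + ?h y) + e) x"
  proof (rule conv_exp_mono[OF _ wt W_abs_bound[OF \<tau>] _ _ hyp])
    show "\<bar>\<sigma> * (W 0 y + ?h y) + e\<bar> \<le> \<sigma> * (2 * M + 16 / 3 * M) + e" for y
    proof -
      have "\<bar>W 0 y + ?h y\<bar> \<le> 2 * M + 16 / 3 * M" using w0(2)[of y] h(2)[of y] by linarith
      then have "\<sigma> * \<bar>W 0 y + ?h y\<bar> \<le> \<sigma> * (2 * M + 16 / 3 * M)" using \<sigma> by (intro mult_left_mono) auto
      then have "\<bar>\<sigma> * (W 0 y + ?h y)\<bar> \<le> \<sigma> * (2 * M + 16 / 3 * M)" using \<sigma> by (simp add: abs_mult)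
      then show ?thesis using e by linarith
    qed
  qed (use w0 h in auto)
  also have "\<dots> = \<sigma> * (conv_exp 1 (W 0) x + conv_exp 1 ?h x) + 2 * e"
  proof -
    have b: "\<bar>\<sigma> * (W 0 y + ?h y)\<bar> \<le> \<bar>\<sigma>\<bar> * (2 * M + 16 / 3 * M)" for y
    proof -
      have "\<bar>W 0 y + ?h y\<bar> \<le> 2 * M + 16 / 3 * M" using w0(2)[of y] h(2)[of y] by linarith
      then show ?thesis unfolding abs_mult by (intro mult_left_mono) auto
    qed
    have "conv_exp 1 (\<lambda>y. \<sigma> * (W 0 y + ?h y) + e) x = conv_exp 1 (\<lambda>y. \<sigma> * (W 0 y + ?h y)) x + conv_exp 1 (\<lambda>_. e) x"
      by (rule conv_exp_add[OF _ _ b _ order_refl]) (use w0 h in auto)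
    also have "conv_exp 1 (\<lambda>y. \<sigma> * (W 0 y + ?h y)) x = \<sigma> * (conv_exp 1 (W 0) x + conv_exp 1 ?h x)"
      unfolding conv_exp_cmult by (subst conv_exp_add[OF zero_less_one w0(1,2) h(1,2)]) simp
    finally show ?thesis by (simp add: conv_exp_const)
  qed
  also have "\<dots> \<le> \<sigma> * (?h x + 8 * ?h x) + 2 * e"
  proof -
    have "conv_exp 1 (W 0) x \<le> ?h x" by (rule conv_exp_antimono) (use w0 in auto)
    moreover have "conv_exp 1 ?h x \<le> 2 / (1 - 3/4) * ?h x" by (rule conv_exp_iterated) (use w0 in auto)
    ultimately show ?thesis using \<sigma> by (intro add_right_mono mult_left_mono) auto
  qed
  finally have c2: "conv_exp 1 (W \<tau>) x \<le> 9 * (\<sigma> * ?h x) + 2 * e" by (simp add: algebra_simps)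
  have "W \<tau> x + conv_exp 1 (W \<tau>) x \<le> 10 * (\<sigma> * (W 0 x + ?h x)) + 3 * e"
  proof -
    have "0 \<le> \<sigma> * W 0 x" using \<sigma> W_nonneg by simp
    then show ?thesis using c2 hyp[of x] unfolding distrib_left by linarith
  qed
  then have "2 * M * W \<tau> x + 2 * M * conv_exp 1 (W \<tau>) x \<le> 2 * M * (10 * (\<sigma> * (W 0 x + ?h x)) + 3 * e)"
    using M unfolding distrib_left[symmetric] by (intro mult_left_mono) auto
  then have "2 * M * W \<tau> x + conv_exp 1 (\<lambda>z. (W \<tau> z)\<^sup>2) x \<le> 2 * M * (10 * (\<sigma> * (W 0 x + ?h x)) + 3 * e)"
    using c1 by linarith
  then have "exp (3 * (M * T)) * (2 * M * W \<tau> x + conv_exp 1 (\<lambda>z. (W \<tau> z)\<^sup>2) x)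
    \<le> exp (3 * (M * T)) * (2 * M * (10 * (\<sigma> * (W 0 x + ?h x)) + 3 * e))"
    by (intro mult_left_mono) auto
  with QF_le[OF \<tau>, of x]
  show "2 * Q \<tau> (flow x \<tau>) + F \<tau> (flow x \<tau>) \<le> 20 * (M * exp (3 * (M * T))) * \<sigma> * (W 0 x + ?h x) + 6 * (M * exp (3 * (M * T))) * e"
    by (simp add: algebra_simps)
qed (use M T t W_bound QF_integrable W_integral_inequality in auto)

text \<open>The function \<open>B\<close> of the overview: the linear bound with its exponential
  evaluated at the final time.\<close>

definition lin_bound :: "real \<Rightarrow> real" where
  "lin_bound x = exp (20 * (M * exp (3 * (M * T))) * T) * (W 0 x + conv_exp (3/4) (W 0) x)"

lemma lin_bound_measurable [measurable]: "lin_bound \<in> borel_measurable borel"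
proof -
  have [measurable]: "W 0 \<in> borel_measurable borel" using W_measurable[of 0] T by simp
  show ?thesis unfolding lin_bound_def[abs_def] by measurable
qed

lemma lin_bound_bounded: "0 \<le> lin_bound x" "lin_bound x \<le> exp (20 * (M * exp (3 * (M * T))) * T) * (8 * M)"
proof -
  have T0: "0 \<in> {0..T}" using T by simp
  have "0 \<le> conv_exp (3/4) (W 0) x" by (rule conv_exp_nonneg[OF W_nonneg])
  then show "0 \<le> lin_bound x" unfolding lin_bound_def using W_nonneg[of 0 x] by simp
  have "\<bar>conv_exp (3/4) (W 0) x\<bar> \<le> 2 * (2 * M) / (3/4)"
    by (rule conv_exp_bound) (use W_measurable[OF T0] W_abs_bound[OF T0] in auto)
  then have "conv_exp (3/4) (W 0) x \<le> 16 / 3 * M" by simp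
  \<comment> \<open>2 + 16/3 rounded up.\<close>
  then have "W 0 x + conv_exp (3/4) (W 0) x \<le> 8 * M" using W_bound[OF T0, of x] M by linarith
  then show "lin_bound x \<le> exp (20 * (M * exp (3 * (M * T))) * T) * (8 * M)"
    unfolding lin_bound_def by (intro mult_left_mono) auto
qed

lemma W_le_lin_bound:
  assumes t: "t \<in> {0..T}" shows "W t x \<le> lin_bound x"
proof -
  have "0 \<le> W 0 x + conv_exp (3/4) (W 0) x" using conv_exp_nonneg[OF W_nonneg] W_nonneg by (simp add: add_nonneg_nonneg)
  moreover have "20 * (M * exp (3 * (M * T))) * t \<le> 20 * (M * exp (3 * (M * T))) * T" using t M by (intro mult_left_mono) auto
  ultimately have "exp (20 * (M * exp (3 * (M * T))) * t) * (W 0 x + conv_exp (3/4) (W 0) x) \<le> lin_bound x"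
    unfolding lin_bound_def by (intro mult_right_mono) auto
  then show ?thesis using W_le_linear[OF t, of x] by linarith
qed

text \<open>Here the convolution is not compared with itself again: \<open>W_le_lin_bound\<close>
  replaces it by a fixed source that is already part of b. Only the local term feeds back, which is
  why k has the factor 2 M alone and \<open>\<kappa>\<close> has 2 M + 1.\<close>

lemma W_le_quadratic:
  assumes t: "t \<in> {0..T}"
  shows "W t x \<le> exp (exp (3 * (M * T)) * (2 * M + 1) * t) * (W 0 x + conv_exp 1 (\<lambda>z. (lin_bound z)\<^sup>2) x)"
proof (rule gronwall_family[where f = W and t = t and x = x
    and b = "\<lambda>x. W 0 x + conv_exp 1 (\<lambda>z. (lin_bound z)\<^sup>2) x"
    and \<kappa> = "exp (3 * (M * T)) * (2 * M + 1)" and a = "W 0" and m = "2 * M" and k = "exp (3 * (M * T)) * (2 * M)"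
    and g = "\<lambda>\<tau> x. 2 * Q \<tau> (flow x \<tau>) + F \<tau> (flow x \<tau>)" and T = T])
  let ?h = "conv_exp 1 (\<lambda>z. (lin_bound z)\<^sup>2)"
  have h: "0 \<le> ?h x" for x by (rule conv_exp_nonneg) simp
  show "W 0 x \<le> W 0 x + ?h x" for x using h[of x] by simp
  show "0 \<le> W 0 x + ?h x" for x using h[of x] W_nonneg[of 0 x] by simp
  fix \<tau> \<sigma> e x assume \<tau>: "\<tau> \<in> {0..T}" and \<sigma>: "1 \<le> \<sigma>" and e: "0 \<le> e"
    and hyp: "\<And>y. W \<tau> y \<le> \<sigma> * (W 0 y + ?h y) + e"
  have W2: "\<bar>(W \<tau> z)\<^sup>2\<bar> \<le> (2 * M)\<^sup>2" for z
    by (rule W_sq_bound) fact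
  have L2: "\<bar>(lin_bound z)\<^sup>2\<bar> \<le> (exp (20 * (M * exp (3 * (M * T))) * T) * (8 * M))\<^sup>2" for z
    unfolding abs_power2 using lin_bound_bounded[of z] by (rule power_mono[rotated])
  have "conv_exp 1 (\<lambda>z. (W \<tau> z)\<^sup>2) x \<le> ?h x"
    by (rule conv_exp_mono[OF _ _ W2 _ L2]) (use W_measurable[OF \<tau>] W_le_lin_bound[OF \<tau>] W_nonneg in \<open>auto intro: power_mono\<close>)
  \<comment> \<open>The source carries no factor \<open>\<sigma>\<close> of its own;
    \<open>1 \<le> \<sigma>\<close> supplies it.\<close>
  also have "\<dots> \<le> \<sigma> * (W 0 x + ?h x)"
    using mult_mono[OF \<sigma>, of "?h x" "W 0 x + ?h x"] h[of x] W_nonneg[of 0 x] \<sigma> by simp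
  finally have c: "conv_exp 1 (\<lambda>z. (W \<tau> z)\<^sup>2) x \<le> \<sigma> * (W 0 x + ?h x)" .
  have "2 * M * W \<tau> x \<le> 2 * M * (\<sigma> * (W 0 x + ?h x) + e)" using hyp[of x] M by (intro mult_left_mono) auto
  with c have "2 * M * W \<tau> x + conv_exp 1 (\<lambda>z. (W \<tau> z)\<^sup>2) x \<le> 2 * M * (\<sigma> * (W 0 x + ?h x) + e) + \<sigma> * (W 0 x + ?h x)" by linarith
  then have "exp (3 * (M * T)) * (2 * M * W \<tau> x + conv_exp 1 (\<lambda>z. (W \<tau> z)\<^sup>2) x) \<le> exp (3 * (M * T)) * (2 * M * (\<sigma> * (W 0 x + ?h x) + e) + \<sigma> * (W 0 x + ?h x))"
    by (intro mult_left_mono) auto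
  with QF_le[OF \<tau>, of x]
  show "2 * Q \<tau> (flow x \<tau>) + F \<tau> (flow x \<tau>) \<le> exp (3 * (M * T)) * (2 * M + 1) * \<sigma> * (W 0 x + ?h x) + exp (3 * (M * T)) * (2 * M) * e"
    by (simp add: algebra_simps)
qed (use M T t W_bound QF_integrable W_integral_inequality in auto)

end

subsection \<open>Weighted Lebesgue norms\<close>

lemma memLp_finite_iff:
  "p \<noteq> top \<Longrightarrow> memLp p f \<longleftrightarrow> f \<in> borel_measurable borel \<and> (\<integral>\<^sup>+x. ennreal (\<bar>f x\<bar> powr enn2real p) \<partial>lborel) < \<infinity>"
  unfolding memLp_def by (auto simp: integrable_iff_bounded)

lemma memLp_measurable: "memLp p f \<Longrightarrow> f \<in> borel_measurable borel"
  by (simp add: memLp_def)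

lemma memLp_mono:
  assumes g: "memLp p g" and [measurable]: "f \<in> borel_measurable borel" and le: "\<And>x. \<bar>f x\<bar> \<le> \<bar>g x\<bar>"
  shows "memLp p f"
proof (cases "p = top")
  case True
  then obtain C where "AE x in lborel. \<bar>g x\<bar> \<le> C" using g by (auto simp: memLp_def)
  then have "AE x in lborel. \<bar>f x\<bar> \<le> C" by eventually_elim (use le in \<open>auto intro: order_trans\<close>)
  then show ?thesis using True by (auto simp: memLp_def)
next
  case False
  have "(\<integral>\<^sup>+x. ennreal (\<bar>f x\<bar> powr enn2real p) \<partial>lborel) \<le> (\<integral>\<^sup>+x. ennreal (\<bar>g x\<bar> powr enn2real p) \<partial>lborel)"
    by (intro nn_integral_mono ennreal_leI powr_mono2 le) auto
  then show ?thesis using g False by (auto simp: memLp_finite_iff intro: le_less_trans)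
qed

lemma memLp_cmult:
  assumes f: "memLp p f" shows "memLp p (\<lambda>x. c * f x)"
proof (cases "p = top")
  case True
  then obtain C where C: "AE x in lborel. \<bar>f x\<bar> \<le> C" using f by (auto simp: memLp_def)
  have "AE x in lborel. \<bar>c * f x\<bar> \<le> \<bar>c\<bar> * C"
    using C by eventually_elim (auto simp: abs_mult intro: mult_left_mono)
  then show ?thesis using True f by (auto simp: memLp_def)
next
  case False
  have [measurable]: "f \<in> borel_measurable borel" using f by (rule memLp_measurable)
  show ?thesis using False f by (simp add: memLp_def abs_mult powr_mult)
qed

lemma memLp_add_abs:
  assumes f: "memLp p f" and g: "memLp p g" shows "memLp p (\<lambda>x. \<bar>f x\<bar> + \<bar>g x\<bar>)"
proof -
  have [measurable]: "f \<in> borel_measurable borel" "g \<in> borel_measurable borel" using f g by (auto dest: memLp_measurable)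
  show ?thesis
  proof (cases "p = top")
    case True
    then obtain C D where "AE x in lborel. \<bar>f x\<bar> \<le> C" "AE x in lborel. \<bar>g x\<bar> \<le> D" using f g by (auto simp: memLp_def)
    then have "AE x in lborel. \<bar>\<bar>f x\<bar> + \<bar>g x\<bar>\<bar> \<le> C + D" by eventually_elim simp
    then show ?thesis using True by (auto simp: memLp_def)
  next
    case False
    let ?r = "enn2real p"
    have i: "integrable lborel (\<lambda>x. 2 powr ?r * (\<bar>f x\<bar> powr ?r + \<bar>g x\<bar> powr ?r))"
      using f g False by (simp add: memLp_def)
    have "(a + b) powr ?r \<le> 2 powr ?r * (a powr ?r + b powr ?r)" if "0 \<le> a" "0 \<le> b" for a b :: real
    proof -
      have "(a + b) powr ?r \<le> (2 * max a b) powr ?r" using that by (intro powr_mono2) auto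
      also have "\<dots> = 2 powr ?r * max a b powr ?r" using that by (simp add: powr_mult)
      also have "\<dots> \<le> 2 powr ?r * (a powr ?r + b powr ?r)" by (intro mult_left_mono) (auto simp: max_def)
      finally show ?thesis .
    qed
    then have "integrable lborel (\<lambda>x. \<bar>\<bar>f x\<bar> + \<bar>g x\<bar>\<bar> powr ?r)"
      by (intro Bochner_Integration.integrable_bound[OF i]) auto
    then show ?thesis using False by (simp add: memLp_def)
  qed
qed

lemma memLp_nn_integral_bound:
  assumes p: "p \<noteq> top" "2 \<le> p" and [measurable]: "f \<in> borel_measurable borel"
    and K: "(\<integral>\<^sup>+x. ennreal (\<bar>f x\<bar> powr enn2real p) \<partial>lborel) \<le> ennreal K" "0 \<le> K"
  shows "memLp p f" "Lp_norm p f \<le> K powr (1 / enn2real p)"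
proof -
  show "memLp p f" using p K by (auto simp: memLp_finite_iff intro: le_less_trans)
  then have i: "integrable lborel (\<lambda>x. \<bar>f x\<bar> powr enn2real p)" using p by (simp add: memLp_def)
  then have "ennreal (\<integral>x. \<bar>f x\<bar> powr enn2real p \<partial>lborel) \<le> ennreal K"
    using K(1) by (subst (asm) nn_integral_eq_integral) auto
  then have "(\<integral>x. \<bar>f x\<bar> powr enn2real p \<partial>lborel) \<le> K" using K(2) by simp
  then show "Lp_norm p f \<le> K powr (1 / enn2real p)"
    unfolding Lp_norm_def using p by (auto intro!: powr_mono2)
qed

text \<open>\<open>Inf\<close> lies below a member only when the set is bounded below. Every
  essential bound is nonnegative, since a negative one would make the whole line a null set.\<close>

lemma Lp_norm_top_le:
  assumes "AE x in lborel. \<bar>f x\<bar> \<le> C" shows "Lp_norm top f \<le> C"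
proof -
  have "0 \<le> D" if D: "AE x in lborel. \<bar>f x\<bar> \<le> D" for D
  proof (rule ccontr)
    assume neg: "\<not> 0 \<le> D"
    have "AE x in lborel. \<bar>f x\<bar> \<le> D \<longrightarrow> False"
      using neg order_trans[OF abs_ge_zero] by (intro AE_I2 impI notI) blast
    with D have "AE x::real in lborel. False" by (rule AE_mp)
    then show False by (simp add: AE_iff_measurable[OF _ refl] emeasure_lborel_UNIV)
  qed
  then have bdd: "bdd_below {C. AE x in lborel. \<bar>f x\<bar> \<le> C}"
    by (intro bdd_belowI[where m = 0]) (simp only: mem_Collect_eq)
  have "C \<in> {C. AE x in lborel. \<bar>f x\<bar> \<le> C}" using assms by (simp only: mem_Collect_eq)
  from cInf_lower[OF this bdd] show ?thesis unfolding Lp_norm_def by (simp only: if_True simp_thms)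
qed

lemma AE_lborel_continuous_le:
  fixes f :: "real \<Rightarrow> real"
  assumes c: "continuous_on UNIV f" and ae: "AE x in lborel. f x \<le> C"
  shows "f x \<le> C"
proof (rule ccontr)
  assume "\<not> f x \<le> C"
  then have e: "0 < f x - C" by simp
  have "isCont f x" using c by (simp add: continuous_on_eq_continuous_at)
  from this[unfolded continuous_at_eps_delta, rule_format, OF e]
  obtain d where d: "d > 0" "\<And>y. \<bar>y - x\<bar> < d \<Longrightarrow> \<bar>f y - f x\<bar> < f x - C" by (auto simp: dist_real_def)
  have [measurable]: "f \<in> borel_measurable borel" using c by (rule borel_measurable_continuous_onI)
  have "{x - d<..<x + d} \<subseteq> {y \<in> space lborel. \<not> f y \<le> C}"
  proof
    fix y assume "y \<in> {x - d<..<x + d}"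
    then have "\<bar>y - x\<bar> < d" by auto
    from d(2)[OF this] show "y \<in> {y \<in> space lborel. \<not> f y \<le> C}" by auto
  qed
  then have "emeasure lborel {x - d<..<x + d} \<le> emeasure lborel {y \<in> space lborel. \<not> f y \<le> C}"
    by (rule emeasure_mono) measurable
  also have "\<dots> = 0" using ae by (subst (asm) AE_iff_measurable[OF _ refl]) auto
  finally show False using d(1) by simp
qed

text \<open>From \<open>v x \<le> v (x - y) * v y\<close> and boundedness of v on {0..1}, the value
  at x is controlled by every value on {x - 1..x}; integrating over this unit interval bounds it by
  the L^p norm. So integrability forces pointwise growth at rate at most 1. For p = top a bound
  almost everywhere of a continuous function holds everywhere.\<close>

lemma submultiplicative_exp_bound:
  assumes v: "submultiplicative v" and p: "2 \<le> p" and L: "memLp p (\<lambda>x. v x * exp (- \<bar>x\<bar>))"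
  obtains C where "C > 0" "\<And>x. v x * exp (- \<bar>x\<bar>) \<le> C"
proof -
  let ?k = "\<lambda>x. v x * exp (- \<bar>x\<bar>)"
  have v0: "0 \<le> v x" and vc: "continuous_on UNIV v" and vm: "v (x + y) \<le> v x * v y" for x y
    using v by (auto simp: submultiplicative_def)
  have kc: "continuous_on UNIV ?k" by (intro continuous_intros vc)
  have k0: "0 \<le> ?k x" for x using v0 by simp
  have "\<exists>C. \<forall>x. ?k x \<le> C"
  proof (cases "p = top")
    case True
    then obtain C where "AE x in lborel. \<bar>?k x\<bar> \<le> C" using L by (auto simp: memLp_def)
    then have "AE x in lborel. ?k x \<le> C" by eventually_elim simp
    from AE_lborel_continuous_le[OF kc this] show ?thesis by blast
  next
    case False
    define r where "r = enn2real p"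
    have r: "2 \<le> r" unfolding r_def using enn2real_mono[OF p] False by (simp add: top.not_eq_extremum)
    let ?g = "\<lambda>x. ?k x powr r"
    have gi: "integrable lborel ?g" using L False k0 by (simp add: memLp_def r_def)
    have "compact (v ` {0..1})" by (intro compact_continuous_image continuous_on_subset[OF vc]) auto
    then have "bounded (v ` {0..1})" by (rule compact_imp_bounded)
    then obtain S where S: "S > 0" "\<And>h. h \<in> {0..1} \<Longrightarrow> \<bar>v h\<bar> \<le> S" unfolding bounded_pos by auto
    \<comment> \<open>S comes from v on {0..1}, and exp 1 from moving exp(-|x|) by at most one
      unit.\<close>
    define D where "D = (S * exp 1) powr r"
    have g: "?g x \<le> D * ?g y" if "y \<in> {x - 1..x}" for x y
    proof -
      have "v x \<le> v (x - y) * v y" using vm[of "x - y" y] by simp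
      also have "\<dots> \<le> S * v y" using S(2)[of "x - y"] that v0 by (intro mult_right_mono) auto
      finally have "v x * exp (- \<bar>x\<bar>) \<le> (S * v y) * (exp 1 * exp (- \<bar>y\<bar>))"
      proof (intro mult_mono)
        show "exp (- \<bar>x\<bar>) \<le> exp 1 * exp (- \<bar>y\<bar>)" unfolding exp_add[symmetric] using that by auto
      qed (use S v0 in auto)
      then have "?k x \<le> (S * exp 1) * ?k y" by (simp add: mult_ac)
      then have "?g x \<le> ((S * exp 1) * ?k y) powr r" using k0 r by (intro powr_mono2) auto
      also have "\<dots> = D * ?g y" unfolding D_def using S k0 by (intro powr_mult) 
      finally show ?thesis .
    qed
    have gx: "?g x \<le> D * (\<integral>y. ?g y \<partial>lborel)" for x
    proof -
      have ii: "integrable lborel (\<lambda>y. indicator {x - 1..x} y * ?g x)"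
        by (simp add: integrable_indicator_iff emeasure_lborel_Icc_eq)
      have "?g x = (\<integral>y. indicator {x - 1..x} y * ?g x \<partial>lborel)" by simp
      also have "\<dots> \<le> (\<integral>y. D * ?g y \<partial>lborel)"
      proof (rule integral_mono[OF ii])
        show "integrable lborel (\<lambda>y. D * ?g y)" using gi by simp
        fix y
        show "indicator {x - 1..x} y * ?g x \<le> D * ?g y"
          using g[of y x] by (cases "y \<in> {x - 1..x}") (auto simp: D_def)
      qed
      finally show ?thesis by simp
    qed
    \<comment> \<open>Where k exceeds 1 it is at most its r-th power; the summand 1 covers the other
      points.\<close>
    have "?k x \<le> 1 + D * (\<integral>y. ?g y \<partial>lborel)" for x
    proof (cases "?k x \<le> 1")
      case True
      moreover have "0 \<le> D * (\<integral>y. ?g y \<partial>lborel)" by (simp add: D_def)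
      ultimately show ?thesis by linarith
    next
      case False
      then have "?k x powr 1 \<le> ?k x powr r" using r by (intro powr_mono) auto
      then show ?thesis using gx[of x] False by simp
    qed
    then show ?thesis by blast
  qed
  then obtain C where "\<And>x. ?k x \<le> C" by blast
  then have "?k x \<le> \<bar>C\<bar> + 1" for x by (rule order_trans) simp
  then show thesis by (rule that[rotated]) simp
qed

text \<open>Convexity in tangent form. At a = 1 it is Young's inequality for the product of
  (t^r)^(1/r) and 1^(1 - 1/r); scaling by a gives the general case.\<close>

lemma powr_tangent:
  fixes x a r :: real
  assumes r: "1 \<le> r" and x: "0 \<le> x" and a: "0 < a"
  shows "a powr r + r * a powr (r - 1) * (x - a) \<le> x powr r"
proof -
  have b: "1 + r * (t - 1) \<le> t powr r" if t: "0 \<le> t" for t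
  proof (cases "t = 0")
    case True
    then show ?thesis using r by simp
  next
    case False
    have "(t powr r) powr (1 / r) * 1 powr (1 - 1 / r) \<le> 1 / r * t powr r + (1 - 1 / r) * 1"
      by (rule Youngs_inequality_0) (use r t False in auto)
    then have "t \<le> 1 / r * t powr r + (1 - 1 / r)" using r t by (simp add: powr_powr)
    then have "r * t \<le> r * (1 / r * t powr r + (1 - 1 / r))" using r by (intro mult_left_mono) auto
    then show ?thesis using r by (simp add: algebra_simps)
  qed
  have "a powr r * (1 + r * (x / a - 1)) \<le> a powr r * (x / a) powr r"
    using b[of "x / a"] x a by (intro mult_left_mono) auto
  also have "\<dots> = x powr r" using x a by (simp add: powr_divide)
  finally show ?thesis using a by (simp add: powr_diff field_simps)
qed

text \<open>Jensen's inequality for the measure with density \<open>\<mu>\<close>, whose mass is not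
  normalised; this accounts for the power r - 1 of the mass. The tangent of t^r is taken at the mean
  of k and integrated.\<close>

lemma jensen_weighted:
  fixes k \<mu> :: "real \<Rightarrow> real" and r :: real
  assumes r: "1 \<le> r" and [measurable]: "k \<in> borel_measurable borel" and k: "\<And>y. 0 \<le> k y" "\<And>y. k y \<le> c"
    and \<mu>: "integrable lborel \<mu>" "\<And>y. 0 \<le> \<mu> y"
  shows "(\<integral>y. k y * \<mu> y \<partial>lborel) powr r \<le> (\<integral>y. \<mu> y \<partial>lborel) powr (r - 1) * (\<integral>y. k y powr r * \<mu> y \<partial>lborel)"
proof -
  define m A where "m = (\<integral>y. \<mu> y \<partial>lborel)" and "A = (\<integral>y. k y * \<mu> y \<partial>lborel)"
  have [measurable]: "\<mu> \<in> borel_measurable borel" using \<mu>(1) by simp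
  have ki: "integrable lborel (\<lambda>y. k y * \<mu> y)"
    using integrable_mult_bounded[OF \<mu>(1), of k c] k by (simp add: mult.commute)
  have kri: "integrable lborel (\<lambda>y. k y powr r * \<mu> y)"
  proof -
    have "k y powr r \<le> c powr r" for y using k r by (intro powr_mono2) auto
    then show ?thesis using integrable_mult_bounded[OF \<mu>(1), of "\<lambda>y. k y powr r" "c powr r"] by (simp add: mult.commute)
  qed
  have m0: "0 \<le> m" and A0: "0 \<le> A" unfolding m_def A_def using \<mu> k by (auto intro!: Bochner_Integration.integral_nonneg)
  have I0: "0 \<le> (\<integral>y. k y powr r * \<mu> y \<partial>lborel)" using \<mu> by (auto intro!: Bochner_Integration.integral_nonneg)
  \<comment> \<open>Serves to conclude that the mass is positive when A is, so that the mean A / m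
    makes sense.\<close>
  have "A \<le> c * m"
  proof -
    have "A \<le> (\<integral>y. c * \<mu> y \<partial>lborel)" unfolding A_def
      by (rule integral_mono[OF ki]) (use \<mu> k in \<open>auto intro: mult_right_mono\<close>)
    then show ?thesis by (simp add: m_def)
  qed
  have "A powr r \<le> m powr (r - 1) * (\<integral>y. k y powr r * \<mu> y \<partial>lborel)"
  proof (cases "A = 0")
    case True
    then show ?thesis using I0 by simp
  next
    case False
    then have pos: "0 < A" "0 < m" using A0 m0 \<open>A \<le> c * m\<close> by (auto simp: less_le)
    define a where "a = A / m"
    have a: "0 < a" using pos by (simp add: a_def)
    have "(\<integral>y. (a powr r - r * a powr (r - 1) * a) * \<mu> y + r * a powr (r - 1) * (k y * \<mu> y) \<partial>lborel)
       \<le> (\<integral>y. k y powr r * \<mu> y \<partial>lborel)"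
    proof (rule integral_mono[OF _ kri])
      show "integrable lborel (\<lambda>y. (a powr r - r * a powr (r - 1) * a) * \<mu> y + r * a powr (r - 1) * (k y * \<mu> y))"
        using \<mu> ki by simp
      fix y
      have "(a powr r + r * a powr (r - 1) * (k y - a)) * \<mu> y \<le> k y powr r * \<mu> y"
        by (intro mult_right_mono powr_tangent r k a \<mu>)
      then show "(a powr r - r * a powr (r - 1) * a) * \<mu> y + r * a powr (r - 1) * (k y * \<mu> y) \<le> k y powr r * \<mu> y"
        by (simp add: algebra_simps)
    qed
    also have "(\<integral>y. (a powr r - r * a powr (r - 1) * a) * \<mu> y + r * a powr (r - 1) * (k y * \<mu> y) \<partial>lborel)
      = (a powr r - r * a powr (r - 1) * a) * m + r * a powr (r - 1) * A"
      using \<mu> ki by (simp add: m_def A_def)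
    also have "\<dots> = a powr r * m" using pos by (simp add: a_def algebra_simps)
    finally have "m powr (r - 1) * (a powr r * m) \<le> m powr (r - 1) * (\<integral>y. k y powr r * \<mu> y \<partial>lborel)"
      by (intro mult_left_mono) auto
    moreover have "m powr (r - 1) * (a powr r * m) = A powr r"
      using pos by (simp add: a_def powr_divide powr_diff)
    ultimately show ?thesis by simp
  qed
  then show ?thesis by (simp add: m_def A_def)
qed

text \<open>The Sobolev bound for differences gives time continuity uniform in x, and compactness of
  {0..T} then gives one bound M for all times. Differentiating the Green convolution identifies
  \<open>deriv (CH_P u t)\<close>.\<close>

lemma CH_strong_solution_imp_camassa_holm:
  assumes s: "s > 3/2" and T: "T > 0" and sol: "CH_strong_solution T s u0 u"
  shows "\<exists>M. camassa_holm T M u (\<lambda>t. deriv (u t))"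
proof -
  have Hs: "in_Hs s (u t)" and C1: "(u t) C1_differentiable_on UNIV" if "t \<in> {0..T}" for t
    using sol that by (auto simp: CH_strong_solution_def C_Hs_def)
  have lim: "((\<lambda>t. Hs_norm s (\<lambda>x. u t x - u t0 x)) \<longlongrightarrow> 0) (at t0 within {0..T})" if "t0 \<in> {0..T}" for t0
    using sol that by (auto simp: CH_strong_solution_def C_Hs_def)
  have ev: "((\<lambda>\<tau>. u \<tau> x) has_real_derivative (- u t x * deriv (u t) x - deriv (CH_P u t) x)) (at t within {0..T})"
    if "t \<in> {0..T}" for t x using sol that by (auto simp: CH_strong_solution_def)
  have D: "(u t has_real_derivative deriv (u t) x) (at x)" if "t \<in> {0..T}" for t x
    using C1[OF that] by (simp add: C1_differentiable_on_eq DERIV_deriv_iff_real_differentiable)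
  have cu: "continuous_on UNIV (u t)" if "t \<in> {0..T}" for t
    using C1_differentiable_imp_continuous_on[OF C1[OF that]] .
  have cux: "continuous_on UNIV (\<lambda>x. deriv (u t) x)" if "t \<in> {0..T}" for t
    using C1[OF that] by (simp add: C1_differentiable_on_eq field_derivative_eq_vector_derivative)
  obtain C where C: "C \<ge> 0" "\<And>f x. f C1_differentiable_on UNIV \<Longrightarrow> in_Hs s f \<Longrightarrow> \<bar>f x\<bar> \<le> C * Hs_norm s f"
    "\<And>f x. f C1_differentiable_on UNIV \<Longrightarrow> in_Hs s f \<Longrightarrow> \<bar>deriv f x\<bar> \<le> C * Hs_norm s f"
    using sobolev_C1_bound[OF s] by blast
  have tc: "\<exists>\<delta>>0. \<forall>r\<in>{0..T}. \<bar>r - t\<bar> < \<delta> \<longrightarrow> (\<forall>x. \<bar>u r x - u t x\<bar> \<le> e \<and> \<bar>deriv (u r) x - deriv (u t) x\<bar> \<le> e)"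
    if t: "t \<in> {0..T}" and e: "e > 0" for t e
  proof -
    have "((\<lambda>r. C * Hs_norm s (\<lambda>x. u r x - u t x)) \<longlongrightarrow> C * 0) (at t within {0..T})"
      by (intro tendsto_intros lim t)
    then have "eventually (\<lambda>r. C * Hs_norm s (\<lambda>x. u r x - u t x) < e) (at t within {0..T})"
      by (rule order_tendstoD) (use e in simp)
    then obtain \<delta> where \<delta>: "\<delta> > 0" "\<And>r. r \<in> {0..T} \<Longrightarrow> r \<noteq> t \<Longrightarrow> \<bar>r - t\<bar> < \<delta> \<Longrightarrow> C * Hs_norm s (\<lambda>x. u r x - u t x) < e"
      unfolding eventually_at dist_real_def by blast
    have "\<bar>u r x - u t x\<bar> \<le> e \<and> \<bar>deriv (u r) x - deriv (u t) x\<bar> \<le> e" if r: "r \<in> {0..T}" "\<bar>r - t\<bar> < \<delta>" for r x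
    \<comment> \<open>The filter at t says nothing about t itself.\<close>
    proof (cases "r = t")
      case True
      then show ?thesis using e by simp
    next
      case False
      note c = \<delta>(2)[OF r(1) False r(2)]
      have d: "(\<lambda>x. u r x - u t x) C1_differentiable_on UNIV"
        by (rule C1_differentiable_on_diff[OF C1 C1]) (use r t in auto)
      have h: "in_Hs s (\<lambda>x. u r x - u t x)"
        by (rule in_Hs_diff[OF cu cu Hs Hs]) (use r t in auto)
      have "deriv (\<lambda>x. u r x - u t x) x = deriv (u r) x - deriv (u t) x"
        by (rule DERIV_imp_deriv) (intro DERIV_diff D r t)
      then show ?thesis using C(2)[OF d h, of x] C(3)[OF d h, of x] c by simp
    qed
    then show ?thesis using \<delta>(1) by blast
  qed
  have "\<forall>t\<in>{0..T}. \<exists>\<delta>>0. \<forall>r\<in>{0..T}. \<bar>r - t\<bar> < \<delta> \<longrightarrow> (\<forall>x. \<bar>u r x - u t x\<bar> \<le> 1 \<and> \<bar>deriv (u r) x - deriv (u t) x\<bar> \<le> 1)"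
    using tc zero_less_one by blast
  then obtain \<delta> where \<delta>: "\<And>t. t \<in> {0..T} \<Longrightarrow> \<delta> t > 0"
    "\<And>t r x. t \<in> {0..T} \<Longrightarrow> r \<in> {0..T} \<Longrightarrow> \<bar>r - t\<bar> < \<delta> t \<Longrightarrow> \<bar>u r x - u t x\<bar> \<le> 1 \<and> \<bar>deriv (u r) x - deriv (u t) x\<bar> \<le> 1"
    by metis
  \<comment> \<open>Near each centre u and u_x vary by at most 1; hence M is 1 plus the sum of the
    Sobolev bounds at the finitely many centres.\<close>
  obtain I where I: "I \<subseteq> {0..T}" "finite I" "{0..T} \<subseteq> (\<Union>t\<in>I. ball t (\<delta> t))"
  proof (rule compactE_image[of "{0..T}" "{0..T}" "\<lambda>t. ball t (\<delta> t)"])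
    show "{0..T} \<subseteq> (\<Union>t\<in>{0..T}. ball t (\<delta> t))" using \<delta>(1) by force
  qed auto
  define N where "N t = \<bar>C * Hs_norm s (u t)\<bar>" for t
  define M where "M = 1 + (\<Sum>t\<in>I. N t)"
  have M: "M > 0" unfolding M_def by (simp add: N_def sum_nonneg add_pos_nonneg)
  have bound: "\<bar>u r x\<bar> \<le> M \<and> \<bar>deriv (u r) x\<bar> \<le> M" if r: "r \<in> {0..T}" for r x
  proof -
    obtain t where t: "t \<in> I" "\<bar>r - t\<bar> < \<delta> t" using I(3) r by (force simp: dist_real_def)
    then have tT: "t \<in> {0..T}" using I(1) by blast
    have "N t \<le> (\<Sum>t\<in>I. N t)" by (rule member_le_sum[OF t(1)]) (use I(2) in \<open>auto simp: N_def\<close>)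
    moreover have "\<bar>u t x\<bar> \<le> N t" "\<bar>deriv (u t) x\<bar> \<le> N t"
      using C(2,3)[OF C1[OF tT] Hs[OF tT], of x] by (simp_all add: N_def)
    ultimately show ?thesis using \<delta>(2)[OF tT r t(2), of x] unfolding M_def by linarith
  qed
  have "camassa_holm T M u (\<lambda>t. deriv (u t))"
  proof
    fix t x assume t: "t \<in> {0..T}"
    let ?F = "\<lambda>y. (u t y)\<^sup>2 + (1/2) * (deriv (u t) y)\<^sup>2"
    have cF: "continuous_on UNIV ?F" by (intro continuous_intros cu cux t)
    have bF: "\<bar>?F y\<bar> \<le> M\<^sup>2 + (1/2) * M\<^sup>2" for y
    proof -
      have "(u t y)\<^sup>2 \<le> M\<^sup>2" "(deriv (u t) y)\<^sup>2 \<le> M\<^sup>2"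
        using bound[OF t, of y] M by (auto simp: abs_le_square_iff[symmetric])
      then show ?thesis by simp
    qed
    have "CH_P u t = green ?F" unfolding CH_P_def[abs_def] green_def[abs_def] ..
    then have "deriv (CH_P u t) x = green_deriv ?F x"
      using DERIV_imp_deriv[OF green_has_derivative[OF cF bF]] by simp
    then show "((\<lambda>\<tau>. u \<tau> x) has_real_derivative (- u t x * deriv (u t) x - green_deriv ?F x)) (at t within {0..T})"
      using ev[OF t, of x] by simp
  qed (use T M D cux bound tc in auto)
  then show ?thesis ..
qed

text \<open>Splitting 3/4 = 1/8 + 5/8, Cauchy-Schwarz produces exp(-|.|/4), of mass 8, and
  exp(-5|.|/4) against w^2. Moving \<open>\<phi>\<close> from x to y costs exp|.|, which leaves
  exp(-|.|/4), again of mass 8; together 64. Twice the exponent has to exceed the growth rate 1 of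
  \<open>\<phi>\<close>.\<close>

lemma conv_exp_weighted_L2:
  fixes w \<phi> :: "real \<Rightarrow> real"
  assumes [measurable]: "w \<in> borel_measurable borel" "\<phi> \<in> borel_measurable borel"
    and w: "\<And>y. 0 \<le> w y" "\<And>y. w y \<le> m" and \<phi>: "\<And>x. 0 \<le> \<phi> x" "\<And>x y. \<phi> x \<le> C * exp \<bar>x - y\<bar> * \<phi> y"
    and i: "integrable lborel (\<lambda>x. (w x)\<^sup>2 * \<phi> x)"
  shows "integrable lborel (\<lambda>x. (conv_exp (3/4) w x)\<^sup>2 * \<phi> x)"
proof (rule integrableI_nonneg)
  let ?J = "\<lambda>x y. ennreal (8 * \<bar>C\<bar>) * (ennreal ((w y)\<^sup>2 * \<phi> y) * ennreal (exp (- (1/4) * \<bar>y - x\<bar>)))"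
  have wb: "\<bar>w y\<bar> \<le> m" for y using w by simp
  have w2b: "\<bar>(w y)\<^sup>2\<bar> \<le> m\<^sup>2" for y using w by (simp add: power_mono)
  have sq: "(conv_exp (3/4) w x)\<^sup>2 \<le> 8 * conv_exp (5/4) (\<lambda>y. (w y)\<^sup>2) x" for x
  proof -
    let ?f = "\<lambda>y. exp (- (1/8) * \<bar>x - y\<bar>)" and ?g = "\<lambda>y. exp (- (5/8) * \<bar>x - y\<bar>) * w y"
    have f2: "(?f y)\<^sup>2 = exp (- (1/4) * \<bar>x - y\<bar>) * 1" for y by (simp add: exp_double[symmetric])
    have g2: "(?g y)\<^sup>2 = exp (- (5/4) * \<bar>x - y\<bar>) * (w y)\<^sup>2" for y
      by (simp add: power_mult_distrib exp_double[symmetric])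
    have fg: "?f y * ?g y = exp (- (3/4) * \<bar>x - y\<bar>) * w y" for y
      by (simp add: mult.assoc[symmetric] exp_add[symmetric] algebra_simps)
    have "(\<integral>y. ?f y * ?g y \<partial>lborel)\<^sup>2 \<le> (\<integral>y. (?f y)\<^sup>2 \<partial>lborel) * (\<integral>y. (?g y)\<^sup>2 \<partial>lborel)"
    proof (rule Cauchy_Schwarz_integral)
      show "integrable lborel (\<lambda>y. (?f y)\<^sup>2)" unfolding f2 by (rule conv_exp_integrable[of _ _ 1]) auto
      show "integrable lborel (\<lambda>y. (?g y)\<^sup>2)" unfolding g2 by (rule conv_exp_integrable[OF _ _ w2b]) auto
    qed measurable
    then show ?thesis
      unfolding fg f2 g2 using conv_exp_const[of "1/4" 1 x] by (simp add: conv_exp_def)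
  qed
  have "(\<integral>\<^sup>+x. ennreal ((conv_exp (3/4) w x)\<^sup>2 * \<phi> x) \<partial>lborel)
    \<le> (\<integral>\<^sup>+x. \<integral>\<^sup>+y. ?J x y \<partial>lborel \<partial>lborel)"
  proof (rule nn_integral_mono)
    fix x
    have "ennreal ((conv_exp (3/4) w x)\<^sup>2 * \<phi> x) \<le> ennreal ((8 * \<phi> x) * conv_exp (5/4) (\<lambda>y. (w y)\<^sup>2) x)"
      using mult_right_mono[OF sq[of x] \<phi>(1)[of x]] by (intro ennreal_leI) (simp add: mult_ac)
    also have "\<dots> = ennreal (8 * \<phi> x) * ennreal (conv_exp (5/4) (\<lambda>y. (w y)\<^sup>2) x)"
      using \<phi>(1)[of x] by (intro ennreal_mult conv_exp_nonneg) auto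
    also have "ennreal (conv_exp (5/4) (\<lambda>y. (w y)\<^sup>2) x) = (\<integral>\<^sup>+y. ennreal (exp (- (5/4) * \<bar>x - y\<bar>) * (w y)\<^sup>2) \<partial>lborel)"
      by (rule nn_integral_conv_exp[OF _ _ w2b, symmetric]) auto
    also have "ennreal (8 * \<phi> x) * \<dots> = (\<integral>\<^sup>+y. ennreal (8 * \<phi> x) * ennreal (exp (- (5/4) * \<bar>x - y\<bar>) * (w y)\<^sup>2) \<partial>lborel)"
      by (rule nn_integral_cmult[symmetric]) measurable
    also have "\<dots> \<le> (\<integral>\<^sup>+y. ?J x y \<partial>lborel)"
    proof (rule nn_integral_mono)
      fix y
      have C': "C * (exp \<bar>x - y\<bar> * \<phi> y) \<le> \<bar>C\<bar> * (exp \<bar>x - y\<bar> * \<phi> y)" using \<phi>(1)[of y] by (intro mult_right_mono) auto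
      have "\<phi> x \<le> \<bar>C\<bar> * exp \<bar>x - y\<bar> * \<phi> y"
        using order_trans[OF \<phi>(2)[of x y, unfolded mult.assoc] C'] by (simp only: mult.assoc)
      then have "8 * \<phi> x * (exp (- (5/4) * \<bar>x - y\<bar>) * (w y)\<^sup>2) \<le> 8 * (\<bar>C\<bar> * exp \<bar>x - y\<bar> * \<phi> y) * (exp (- (5/4) * \<bar>x - y\<bar>) * (w y)\<^sup>2)"
        by (intro mult_right_mono) auto
      also have "\<dots> = 8 * \<bar>C\<bar> * ((w y)\<^sup>2 * \<phi> y * (exp \<bar>x - y\<bar> * exp (- (5/4) * \<bar>x - y\<bar>)))" by (simp add: mult_ac)
      also have "exp \<bar>x - y\<bar> * exp (- (5/4) * \<bar>x - y\<bar>) = exp (- (1/4) * \<bar>y - x\<bar>)"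
        by (simp add: exp_add[symmetric] abs_minus_commute)
      finally show "ennreal (8 * \<phi> x) * ennreal (exp (- (5/4) * \<bar>x - y\<bar>) * (w y)\<^sup>2) \<le>
        ?J x y"
        using \<phi>(1) by (simp add: ennreal_mult[symmetric] ennreal_leI)
    qed
    finally show "ennreal ((conv_exp (3/4) w x)\<^sup>2 * \<phi> x) \<le>
      (\<integral>\<^sup>+y. ?J x y \<partial>lborel)" .
  qed
  also have "\<dots> = (\<integral>\<^sup>+y. \<integral>\<^sup>+x. ?J x y \<partial>lborel \<partial>lborel)"
    by (rule lborel_pair.Fubini') measurable
  also have "\<dots> = (\<integral>\<^sup>+y. ennreal (8 * \<bar>C\<bar>) * (ennreal ((w y)\<^sup>2 * \<phi> y) * ennreal 8) \<partial>lborel)"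
  proof (rule nn_integral_cong)
    fix y
    have "(\<integral>\<^sup>+x. ennreal (exp (- (1/4) * \<bar>y - x\<bar>)) \<partial>lborel) = ennreal 8"
      using nn_integral_conv_exp[of "1/4" "\<lambda>_. 1" 1 y] conv_exp_const[of "1/4" 1 y] by simp
    then show "(\<integral>\<^sup>+x. ?J x y \<partial>lborel)
      = ennreal (8 * \<bar>C\<bar>) * (ennreal ((w y)\<^sup>2 * \<phi> y) * ennreal 8)"
      by (simp add: nn_integral_cmult)
  qed
  also have "\<dots> = (\<integral>\<^sup>+y. ennreal (64 * \<bar>C\<bar> * ((w y)\<^sup>2 * \<phi> y)) \<partial>lborel)"
  proof (rule nn_integral_cong)
    fix y
    have "0 \<le> (w y)\<^sup>2 * \<phi> y" using \<phi>(1) by simp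
    then show "ennreal (8 * \<bar>C\<bar>) * (ennreal ((w y)\<^sup>2 * \<phi> y) * ennreal 8) = ennreal (64 * \<bar>C\<bar> * ((w y)\<^sup>2 * \<phi> y))"
      by (simp only: ennreal_mult[symmetric] mult_nonneg_nonneg abs_ge_zero zero_le_numeral) (simp add: mult_ac)
  qed
  also have "\<dots> < \<infinity>"
    using i \<phi>(1) by (subst nn_integral_eq_integral) auto
  finally show "(\<integral>\<^sup>+x. ennreal ((conv_exp (3/4) w x)\<^sup>2 * \<phi> x) \<partial>lborel) < \<infinity>" .
qed (use \<phi> in auto)

text \<open>Young's inequality for L^p * L^1, by \<open>jensen_weighted\<close> at each x and then
  Fubini with translation invariance. Boundedness of k makes the convolution exist at every
  point.\<close>

lemma conv_L1_Lp:
  fixes k \<mu> :: "real \<Rightarrow> real"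
  assumes p: "2 \<le> p" and k: "memLp p k" "\<And>y. 0 \<le> k y" "\<And>y. k y \<le> c"
    and \<mu>: "integrable lborel \<mu>" "\<And>y. 0 \<le> \<mu> y"
  shows "memLp p (\<lambda>x. \<integral>y. k (x - y) * \<mu> y \<partial>lborel)"
proof -
  have [measurable]: "k \<in> borel_measurable borel" using k(1) by (rule memLp_measurable)
  have [measurable]: "\<mu> \<in> borel_measurable borel" using \<mu>(1) by simp
  let ?A = "\<lambda>x. \<integral>y. k (x - y) * \<mu> y \<partial>lborel" and ?m = "\<integral>y. \<mu> y \<partial>lborel"
  have A0: "0 \<le> ?A x" for x using k \<mu> by (intro Bochner_Integration.integral_nonneg) auto
  show ?thesis
  proof (cases "p = top")
    case True
    have "\<bar>?A x\<bar> \<le> c * ?m" for x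
    proof -
      have "?A x \<le> (\<integral>y. c * \<mu> y \<partial>lborel)"
      proof (rule integral_mono)
        show "integrable lborel (\<lambda>y. k (x - y) * \<mu> y)"
          using integrable_mult_bounded[OF \<mu>(1), of "\<lambda>y. k (x - y)" c] k by (simp add: mult.commute)
        show "k (x - y) * \<mu> y \<le> c * \<mu> y" for y using k \<mu> by (intro mult_right_mono) auto
      qed (use \<mu> in simp)
      then show ?thesis using A0[of x] by simp
    qed
    then show ?thesis using True by (auto simp: memLp_def)
  next
    case False
    define r where "r = enn2real p"
    let ?J = "\<lambda>x y. ennreal (?m powr (r - 1)) * (ennreal (k (x - y) powr r) * ennreal (\<mu> y))"
    have r: "2 \<le> r" unfolding r_def using enn2real_mono[OF p] False by (simp add: top.not_eq_extremum)
    have kr: "integrable lborel (\<lambda>y. k y powr r)" using k(1,2) False by (simp add: memLp_def r_def)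
    have kb: "k y powr r \<le> c powr r" for y using k r by (intro powr_mono2) auto
    have "(\<integral>\<^sup>+x. ennreal (\<bar>?A x\<bar> powr r) \<partial>lborel) \<le> (\<integral>\<^sup>+x. \<integral>\<^sup>+y. ?J x y \<partial>lborel \<partial>lborel)"
    proof (rule nn_integral_mono)
      fix x
      have i: "integrable lborel (\<lambda>y. k (x - y) powr r * \<mu> y)"
        using integrable_mult_bounded[OF \<mu>(1), of "\<lambda>y. k (x - y) powr r" "c powr r"] kb by (simp add: mult.commute)
      have "ennreal (\<bar>?A x\<bar> powr r) \<le> ennreal (?m powr (r - 1) * (\<integral>y. k (x - y) powr r * \<mu> y \<partial>lborel))"
        using jensen_weighted[of r "\<lambda>y. k (x - y)" c \<mu>] r k \<mu> A0[of x] by (intro ennreal_leI) auto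
      also have "\<dots> = ennreal (?m powr (r - 1)) * (\<integral>\<^sup>+y. ennreal (k (x - y) powr r * \<mu> y) \<partial>lborel)"
        using nn_integral_eq_integral[OF i] \<mu>(2) by (simp add: ennreal_mult')
      also have "\<dots> = (\<integral>\<^sup>+y. ?J x y \<partial>lborel)"
        using \<mu>(2) by (subst nn_integral_cmult) (simp_all add: ennreal_mult)
      finally show "ennreal (\<bar>?A x\<bar> powr r) \<le> (\<integral>\<^sup>+y. ?J x y \<partial>lborel)" .
    qed
    also have "\<dots> = (\<integral>\<^sup>+y. \<integral>\<^sup>+x. ?J x y \<partial>lborel \<partial>lborel)"
      by (rule lborel_pair.Fubini') measurable
    also have "\<dots> = (\<integral>\<^sup>+y. ennreal (?m powr (r - 1)) * ((\<integral>\<^sup>+x. ennreal (k x powr r) \<partial>lborel) * ennreal (\<mu> y)) \<partial>lborel)"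
    proof (rule nn_integral_cong)
      fix y
      have "(\<integral>\<^sup>+x. ennreal (k x powr r) \<partial>lborel) = (\<integral>\<^sup>+x. ennreal (k (x - y) powr r) \<partial>lborel)"
        using nn_integral_real_affine[of "\<lambda>x. ennreal (k x powr r)" 1 "-y"] by simp
      then show "(\<integral>\<^sup>+x. ?J x y \<partial>lborel)
        = ennreal (?m powr (r - 1)) * ((\<integral>\<^sup>+x. ennreal (k x powr r) \<partial>lborel) * ennreal (\<mu> y))"
        by (simp add: nn_integral_cmult nn_integral_multc)
    qed
    also have "\<dots> = ennreal (?m powr (r - 1)) * ((\<integral>\<^sup>+x. ennreal (k x powr r) \<partial>lborel) * (\<integral>\<^sup>+y. ennreal (\<mu> y) \<partial>lborel))"
      by (simp add: nn_integral_cmult)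
    also have "\<dots> < \<infinity>"
      using nn_integral_eq_integral[OF kr] nn_integral_eq_integral[OF \<mu>(1)] \<mu>(2)
      by (simp add: ennreal_mult_less_top)
    finally show ?thesis using False by (simp add: memLp_finite_iff r_def)
  qed
qed

section \<open>From pointwise bounds to weighted norms\<close>

context camassa_holm begin

text \<open>\<open>G\<close> is a function of position and \<open>H\<close> one of the particle
  label. The change of variables costs exp(M T) whatever t is, so a bound by one fixed
  \<open>H\<close> is uniform in time.\<close>

lemma transport_Lp:
  assumes p: "2 \<le> p" and H: "memLp p H" and G: "\<And>t. t \<in> {0..T} \<Longrightarrow> G t \<in> borel_measurable borel"
    and le: "\<And>t z. t \<in> {0..T} \<Longrightarrow> \<bar>G t (flow z t)\<bar> \<le> c * \<bar>H z\<bar>"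
  shows "\<exists>K. \<forall>t\<in>{0..T}. memLp p (G t) \<and> Lp_norm p (G t) \<le> K"
proof -
  have [measurable]: "H \<in> borel_measurable borel" using H by (rule memLp_measurable)
  have le': "\<bar>G t (flow z t)\<bar> \<le> \<bar>c * H z\<bar>" if "t \<in> {0..T}" for t z
    using order_trans[OF le[OF that, of z] mult_right_mono[OF abs_ge_self abs_ge_zero]] by (simp add: abs_mult)
  note cH = memLp_cmult[OF H, of c]
  show ?thesis
  proof (cases "p = top")
    case True
    then obtain C where C: "AE x in lborel. \<bar>c * H x\<bar> \<le> C" using cH by (auto simp: memLp_def)
    have "memLp top (G t) \<and> Lp_norm top (G t) \<le> C" if t: "t \<in> {0..T}" for t
    proof -
      have [measurable]: "G t \<in> borel_measurable borel" "(\<lambda>z. flow z t) \<in> borel_measurable borel"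
        using G[OF t] borel_measurable_continuous_onI[OF flow_cont_space[OF t]] by auto
      \<comment> \<open>For p = top the change of variables is applied to the indicator of the set
        where the bound fails: its pullback is null, hence so is the set.\<close>
      let ?f = "\<lambda>y. indicator {y. C < \<bar>G t y\<bar>} y :: ennreal"
      have fm: "?f \<in> borel_measurable borel" by measurable
      have "AE z in lborel. ?f (flow z t) = 0"
        using C by eventually_elim (use le'[OF t] in \<open>auto simp: indicator_def not_less intro: order_trans\<close>)
      then have "(\<integral>\<^sup>+z. ?f (flow z t) \<partial>lborel) = 0" by (subst nn_integral_0_iff_AE) auto
      then have "(\<integral>\<^sup>+y. ?f y \<partial>lborel) = 0" using nn_integral_le_flow[OF fm t] by simp
      then have "AE y in lborel. ?f y = 0" using fm by (subst (asm) nn_integral_0_iff_AE) auto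
      then have "AE y in lborel. \<bar>G t y\<bar> \<le> C" by eventually_elim (auto simp: indicator_def not_less split: if_splits)
      then show ?thesis using Lp_norm_top_le by (auto simp: memLp_def)
    qed
    then show ?thesis using True by blast
  next
    case False
    let ?r = "enn2real p"
    let ?K = "exp (M * T) * (\<integral>x. \<bar>c * H x\<bar> powr ?r \<partial>lborel)"
    have i: "integrable lborel (\<lambda>x. \<bar>c * H x\<bar> powr ?r)" using cH False by (simp add: memLp_def)
    have "memLp p (G t) \<and> Lp_norm p (G t) \<le> ?K powr (1 / ?r)" if t: "t \<in> {0..T}" for t
    proof -
      have [measurable]: "G t \<in> borel_measurable borel" using G[OF t] .
      have "(\<integral>\<^sup>+y. ennreal (\<bar>G t y\<bar> powr ?r) \<partial>lborel) \<le> ennreal (exp (M * T)) * (\<integral>\<^sup>+z. ennreal (\<bar>G t (flow z t)\<bar> powr ?r) \<partial>lborel)"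
        by (rule nn_integral_le_flow[OF _ t]) measurable
      also have "\<dots> \<le> ennreal (exp (M * T)) * (\<integral>\<^sup>+z. ennreal (\<bar>c * H z\<bar> powr ?r) \<partial>lborel)"
        by (intro mult_left_mono nn_integral_mono ennreal_leI powr_mono2 le' t) auto
      also have "\<dots> = ennreal ?K" using nn_integral_eq_integral[OF i] by (simp add: ennreal_mult)
      finally have "(\<integral>\<^sup>+y. ennreal (\<bar>G t y\<bar> powr ?r) \<partial>lborel) \<le> ennreal ?K" .
      then show ?thesis using memLp_nn_integral_bound[OF False p, of "G t" ?K] by simp
    qed
    then show ?thesis by blast
  qed
qed

text \<open>The L^2 majorant comes first, because its square is the L^1 density against which the
  kernel of the L^p majorant is convolved. Both depend on the label only, as
  \<open>transport_Lp\<close> requires.\<close>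

lemma weighted_persistence:
  fixes p :: ennreal and \<phi> v :: "real \<Rightarrow> real"
  assumes p: "2 \<le> p" and v: "submultiplicative v" and \<phi>: "moderate v \<phi>"
    and vL: "memLp p (\<lambda>x. v x * exp (- \<bar>x\<bar>))"
    and up: "memLp p (\<lambda>x. u 0 x * \<phi> x)" "memLp p (\<lambda>x. ux 0 x * \<phi> x)"
    and u2: "memLp 2 (\<lambda>x. u 0 x * sqrt (\<phi> x))" "memLp 2 (\<lambda>x. ux 0 x * sqrt (\<phi> x))"
  defines "H2 \<equiv> \<lambda>z. lin_bound z * sqrt (\<phi> z)"
    and "Hp \<equiv> \<lambda>z. (W 0 z + conv_exp 1 (\<lambda>y. (lin_bound y)\<^sup>2) z) * \<phi> z"
  shows "memLp 2 H2" "memLp p Hp"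
    "\<exists>c. \<forall>t\<in>{0..T}. \<forall>z. W t z * sqrt (\<phi> (flow z t)) \<le> c * \<bar>H2 z\<bar> \<and> W t z * \<phi> (flow z t) \<le> c * \<bar>Hp z\<bar>"
proof -
  have T0: "0 \<in> {0..T}" using T by simp
  obtain C0 where \<phi>0: "\<And>x. 0 < \<phi> x" and cont: "continuous_on UNIV \<phi>" and C0: "C0 > 0" "\<And>x y. \<phi> (x + y) \<le> C0 * v x * \<phi> y"
    using \<phi> by (auto simp: moderate_def)
  have \<phi>n: "0 \<le> \<phi> x" for x using \<phi>0[of x] by simp
  have v0: "0 \<le> v x" for x using v by (auto simp: submultiplicative_def)
  have [measurable]: "v \<in> borel_measurable borel" using v by (auto simp: submultiplicative_def intro: borel_measurable_continuous_onI)
  have [measurable]: "\<phi> \<in> borel_measurable borel" using cont by (rule borel_measurable_continuous_onI)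
  have [measurable]: "W 0 \<in> borel_measurable borel" by (rule W_measurable[OF T0])
  obtain c where c: "c > 0" "\<And>x. v x * exp (- \<bar>x\<bar>) \<le> c" using submultiplicative_exp_bound[OF v p vL] by blast
  \<comment> \<open>Moderateness in the explicit rate exp|x - y|; it serves the weighted L^2
    convolution and the comparison of \<open>\<phi>\<close> at a particle with \<open>\<phi>\<close>
    at its label.\<close>
  have \<phi>C: "\<phi> x \<le> (C0 * c) * exp \<bar>x - y\<bar> * \<phi> y" for x y
  proof -
    have "v (x - y) * exp (- \<bar>x - y\<bar>) * exp \<bar>x - y\<bar> \<le> c * exp \<bar>x - y\<bar>" using c(2) by (intro mult_right_mono) auto
    then have "v (x - y) \<le> c * exp \<bar>x - y\<bar>" by (simp add: mult.assoc exp_add[symmetric])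
    then have "C0 * v (x - y) * \<phi> y \<le> C0 * (c * exp \<bar>x - y\<bar>) * \<phi> y"
      using C0 \<phi>n by (intro mult_right_mono mult_left_mono) auto
    then show ?thesis using C0(2)[of "x - y" y] by (simp add: mult.assoc)
  qed
  have W0: "W 0 x = \<bar>u 0 x\<bar> + \<bar>ux 0 x\<bar>" for x by (simp add: W_def)
  have "memLp 2 (\<lambda>x. W 0 x * sqrt (\<phi> x))"
    by (rule memLp_mono[OF memLp_add_abs[OF u2]], measurable) (use \<phi>n in \<open>auto simp: W0 abs_mult distrib_right\<close>)
  then have w2: "integrable lborel (\<lambda>x. (W 0 x)\<^sup>2 * \<phi> x)"
    using \<phi>n by (simp add: memLp_2_iff power_mult_distrib)
  have h2: "integrable lborel (\<lambda>x. (conv_exp (3/4) (W 0) x)\<^sup>2 * \<phi> x)"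
    by (rule conv_exp_weighted_L2[OF _ _ W_nonneg W_bound[OF T0] \<phi>n \<phi>C w2]) measurable
  have hL: "memLp 2 (\<lambda>x. conv_exp (3/4) (W 0) x * sqrt (\<phi> x))"
    using h2 \<phi>n by (simp add: memLp_2_iff power_mult_distrib)
  define E where "E = exp (20 * (M * exp (3 * (M * T))) * T)"
  show H2: "memLp 2 H2"
    by (rule memLp_mono[OF memLp_cmult[OF memLp_add_abs[OF \<open>memLp 2 (\<lambda>x. W 0 x * sqrt (\<phi> x))\<close> hL], of E]], unfold H2_def, measurable)
      (use \<phi>n W_nonneg conv_exp_nonneg[OF W_nonneg] in \<open>auto simp: lin_bound_def E_def abs_mult algebra_simps\<close>)
  \<comment> \<open>The L^2 estimate, squared, is read as integrability of a density.\<close>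
  have \<mu>: "integrable lborel (\<lambda>y. (lin_bound y)\<^sup>2 * \<phi> y)"
    using H2 \<phi>n by (simp add: H2_def memLp_2_iff power_mult_distrib)
  let ?A = "\<lambda>x. \<integral>y. v (x - y) * exp (- \<bar>x - y\<bar>) * ((lin_bound y)\<^sup>2 * \<phi> y) \<partial>lborel"
  have A: "memLp p ?A"
    by (rule conv_L1_Lp[OF p vL _ c(2) \<mu>]) (use v0 \<phi>n in auto)
  have lb: "\<bar>(lin_bound y)\<^sup>2\<bar> \<le> (E * (8 * M))\<^sup>2" for y
    unfolding abs_power2 E_def using lin_bound_bounded[of y] by (intro power_mono)
  \<comment> \<open>Moderateness moves \<open>\<phi>\<close> under the integral from x to y and
    leaves v(x - y) on the kernel, so that exp(-|x - y|) becomes the kernel assumed to be in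
    L^p.\<close>
  have conv_le: "conv_exp 1 (\<lambda>y. (lin_bound y)\<^sup>2) x * \<phi> x \<le> C0 * ?A x" for x
  proof -
    have i1: "integrable lborel (\<lambda>y. exp (- 1 * \<bar>x - y\<bar>) * (lin_bound y)\<^sup>2)"
      by (rule conv_exp_integrable[OF _ _ lb]) auto
    have i2: "integrable lborel (\<lambda>y. v (x - y) * exp (- \<bar>x - y\<bar>) * ((lin_bound y)\<^sup>2 * \<phi> y))"
      using integrable_mult_bounded[OF \<mu>, of "\<lambda>y. v (x - y) * exp (- \<bar>x - y\<bar>)" c] v0 c(2)[of "x - _"]
      by (simp add: mult_ac)
    have "conv_exp 1 (\<lambda>y. (lin_bound y)\<^sup>2) x * \<phi> x = (\<integral>y. exp (- 1 * \<bar>x - y\<bar>) * (lin_bound y)\<^sup>2 * \<phi> x \<partial>lborel)"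
      unfolding conv_exp_def by simp
    also have "\<dots> \<le> (\<integral>y. C0 * (v (x - y) * exp (- \<bar>x - y\<bar>) * ((lin_bound y)\<^sup>2 * \<phi> y)) \<partial>lborel)"
    proof (rule integral_mono)
      show "integrable lborel (\<lambda>y. exp (- 1 * \<bar>x - y\<bar>) * (lin_bound y)\<^sup>2 * \<phi> x)" using i1 by (rule integrable_mult_left)
      show "integrable lborel (\<lambda>y. C0 * (v (x - y) * exp (- \<bar>x - y\<bar>) * ((lin_bound y)\<^sup>2 * \<phi> y)))"
        using i2 by (rule integrable_mult_right)
      fix y
      have "exp (- 1 * \<bar>x - y\<bar>) * (lin_bound y)\<^sup>2 * \<phi> x \<le> exp (- 1 * \<bar>x - y\<bar>) * (lin_bound y)\<^sup>2 * (C0 * v (x - y) * \<phi> y)"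
        using C0(2)[of "x - y" y] by (intro mult_left_mono) auto
      then show "exp (- 1 * \<bar>x - y\<bar>) * (lin_bound y)\<^sup>2 * \<phi> x \<le> C0 * (v (x - y) * exp (- \<bar>x - y\<bar>) * ((lin_bound y)\<^sup>2 * \<phi> y))"
        by (simp add: mult_ac)
    qed
    finally show ?thesis by simp
  qed
  have conv0: "0 \<le> conv_exp 1 (\<lambda>y. (lin_bound y)\<^sup>2) x" for x by (rule conv_exp_nonneg) simp
  have cp: "memLp p (\<lambda>x. conv_exp 1 (\<lambda>y. (lin_bound y)\<^sup>2) x * \<phi> x)"
    by (rule memLp_mono[OF memLp_cmult[OF A, of C0]], measurable)
      (use conv_le conv0 \<phi>n in \<open>auto intro: order_trans[OF _ abs_ge_self]\<close>)
  have wp: "memLp p (\<lambda>x. W 0 x * \<phi> x)"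
    by (rule memLp_mono[OF memLp_add_abs[OF up]], measurable) (use \<phi>n in \<open>auto simp: W0 abs_mult distrib_right\<close>)
  show "memLp p Hp"
    by (rule memLp_mono[OF memLp_add_abs[OF wp cp]], unfold Hp_def, measurable)
      (use \<phi>n W_nonneg conv0 in \<open>auto simp: distrib_right\<close>)
  \<comment> \<open>B carries \<open>\<phi>\<close> from a label to the particle, which is at
    distance at most M T; D below is the growth factor of \<open>W_le_quadratic\<close> at the final
    time.\<close>
  define B where "B = C0 * c * exp (M * T)"
  define D where "D = exp (exp (3 * (M * T)) * (2 * M + 1) * T)"
  have B0: "0 \<le> B" using C0 c by (simp add: B_def)
  have \<phi>f: "\<phi> (flow z t) \<le> B * \<phi> z" if t: "t \<in> {0..T}" for t z
  proof -
    have "\<phi> (flow z t) \<le> (C0 * c) * exp \<bar>flow z t - z\<bar> * \<phi> z" by (rule \<phi>C)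
    also have "\<dots> \<le> (C0 * c) * exp (M * T) * \<phi> z"
      using flow_displacement[OF t, of z] C0 c \<phi>n by (intro mult_right_mono mult_left_mono) auto
    finally show ?thesis by (simp add: B_def)
  qed
  \<comment> \<open>The L^2 estimate needs the constant sqrt B, the L^p estimate D * B; their sum
    serves both.\<close>
  show "\<exists>c. \<forall>t\<in>{0..T}. \<forall>z. W t z * sqrt (\<phi> (flow z t)) \<le> c * \<bar>H2 z\<bar> \<and> W t z * \<phi> (flow z t) \<le> c * \<bar>Hp z\<bar>"
  proof (intro exI ballI allI conjI)
    fix t z assume t: "t \<in> {0..T}"
    have s0: "0 \<le> sqrt B" "0 \<le> D * B" using B0 by (auto simp: D_def)
    have "sqrt (\<phi> (flow z t)) \<le> sqrt B * sqrt (\<phi> z)"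
      using \<phi>f[OF t, of z] by (simp add: real_sqrt_mult[symmetric])
    then have "W t z * sqrt (\<phi> (flow z t)) \<le> lin_bound z * (sqrt B * sqrt (\<phi> z))"
      using W_le_lin_bound[OF t, of z] W_nonneg lin_bound_bounded(1)[of z] \<phi>n by (intro mult_mono) auto
    also have "\<dots> = sqrt B * H2 z" by (simp add: H2_def)
    also have "\<dots> \<le> (sqrt B + D * B) * H2 z"
      using s0 lin_bound_bounded(1)[of z] \<phi>n[of z] by (intro mult_right_mono) (auto simp: H2_def)
    also have "\<dots> \<le> (sqrt B + D * B) * \<bar>H2 z\<bar>" using s0 by (intro mult_left_mono) auto
    finally show "W t z * sqrt (\<phi> (flow z t)) \<le> (sqrt B + D * B) * \<bar>H2 z\<bar>" .
    let ?S = "W 0 z + conv_exp 1 (\<lambda>y. (lin_bound y)\<^sup>2) z"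
    have S0: "0 \<le> ?S" using W_nonneg conv0 by (simp add: add_nonneg_nonneg)
    have "exp (3 * (M * T)) * (2 * M + 1) * t \<le> exp (3 * (M * T)) * (2 * M + 1) * T"
      using t M by (intro mult_left_mono) auto
    then have "exp (exp (3 * (M * T)) * (2 * M + 1) * t) * ?S \<le> D * ?S" unfolding D_def using S0 by (intro mult_right_mono) auto
    then have "W t z \<le> D * ?S" using W_le_quadratic[OF t, of z] by linarith
    then have "W t z * \<phi> (flow z t) \<le> D * ?S * (B * \<phi> z)"
      using \<phi>f[OF t, of z] \<phi>n S0 by (intro mult_mono) (auto simp: D_def)
    also have "\<dots> = D * B * Hp z" by (simp add: Hp_def)
    also have "\<dots> \<le> (sqrt B + D * B) * Hp z"
      using s0 S0 \<phi>n[of z] by (intro mult_right_mono) (auto simp: Hp_def)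
    also have "\<dots> \<le> (sqrt B + D * B) * \<bar>Hp z\<bar>" using s0 by (intro mult_left_mono) auto
    finally show "W t z * \<phi> (flow z t) \<le> (sqrt B + D * B) * \<bar>Hp z\<bar>" .
  qed
qed

end

section \<open>The weighted estimates for strong solutions\<close>

theorem theorem5p1:
  fixes p :: ennreal and T s A :: real
    and \<phi> v u0 :: "real \<Rightarrow> real" and u :: "real \<Rightarrow> real \<Rightarrow> real"
  assumes p: "2 \<le> p"
    and T: "T > 0"
    and s: "s > 3/2"
    and A: "A > 0"
    and phi_ac: "loc_abs_cont \<phi>"
    and phi_deriv: "AE x in lborel. \<phi> differentiable (at x) \<and> \<bar>deriv \<phi> x\<bar> \<le> A * \<bar>\<phi> x\<bar>"
    and v_sub: "submultiplicative v"
    and phi_mod: "moderate v \<phi>"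
    and v_inf: "\<exists>c>0. \<forall>x. c \<le> v x"
    and v_Lp: "memLp p (\<lambda>x. v x * exp (- \<bar>x\<bar>))"
    and u0_1: "memLp p (\<lambda>x. u0 x * \<phi> x)"
    and u0_2: "memLp 2 (\<lambda>x. u0 x * sqrt (\<phi> x))"
    and u0_3: "memLp p (\<lambda>x. deriv u0 x * \<phi> x)"
    and u0_4: "memLp 2 (\<lambda>x. deriv u0 x * sqrt (\<phi> x))"
    and sol: "CH_strong_solution T s u0 u"
  shows "(\<exists>C. \<forall>t\<in>{0..T}.
            memLp p (\<lambda>x. u t x * \<phi> x) \<and> memLp p (\<lambda>x. deriv (u t) x * \<phi> x) \<and>
            Lp_norm p (\<lambda>x. u t x * \<phi> x) + Lp_norm p (\<lambda>x. deriv (u t) x * \<phi> x) \<le> C) \<and>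
         (\<exists>C. \<forall>t\<in>{0..T}.
            memLp 2 (\<lambda>x. u t x * sqrt (\<phi> x)) \<and> memLp 2 (\<lambda>x. deriv (u t) x * sqrt (\<phi> x)) \<and>
            Lp_norm 2 (\<lambda>x. u t x * sqrt (\<phi> x)) + Lp_norm 2 (\<lambda>x. deriv (u t) x * sqrt (\<phi> x)) \<le> C)"
proof -
  obtain M where "camassa_holm T M u (\<lambda>t. deriv (u t))"
    using CH_strong_solution_imp_camassa_holm[OF s T sol] by blast
  then interpret camassa_holm T M u "\<lambda>t. deriv (u t)" .
  have u0: "u 0 = u0" using sol by (simp add: CH_strong_solution_def)
  note persist = weighted_persistence[OF p v_sub phi_mod v_Lp, unfolded u0, OF u0_1 u0_3 u0_2 u0_4]
  from persist(3) obtain c where c: "\<And>t z. t \<in> {0..T} \<Longrightarrow>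
      W t z * sqrt (\<phi> (flow z t)) \<le> c * \<bar>lin_bound z * sqrt (\<phi> z)\<bar> \<and>
      W t z * \<phi> (flow z t) \<le> c * \<bar>(W 0 z + conv_exp 1 (\<lambda>y. (lin_bound y)\<^sup>2) z) * \<phi> z\<bar>"
    by blast
  have \<phi>0: "0 \<le> \<phi> x" for x using phi_mod by (auto simp: moderate_def intro: less_imp_le)
  have cont: "continuous_on UNIV \<phi>" using phi_mod by (simp add: moderate_def)
  have meas: "(\<lambda>x. u t x * \<phi> x) \<in> borel_measurable borel" "(\<lambda>x. deriv (u t) x * \<phi> x) \<in> borel_measurable borel"
    "(\<lambda>x. u t x * sqrt (\<phi> x)) \<in> borel_measurable borel" "(\<lambda>x. deriv (u t) x * sqrt (\<phi> x)) \<in> borel_measurable borel"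
    if "t \<in> {0..T}" for t
    by (intro borel_measurable_continuous_onI continuous_intros u_cont ux_cont cont that)+
  have le: "\<bar>u t (flow z t)\<bar> \<le> W t z" "\<bar>deriv (u t) (flow z t)\<bar> \<le> W t z" for t z
    by (simp_all add: W_def)
  \<comment> \<open>Bounds on \<open>W\<close> at a label become bounds on u or u_x times the weight
    at the particle, the form that \<open>transport_Lp\<close> takes in the four applications that
    follow.\<close>
  have ptw: "\<bar>f * w\<bar> \<le> b" if "\<bar>f\<bar> \<le> W t z" "0 \<le> w" "W t z * w \<le> b" for f w b t z
    using mult_right_mono[OF that(1,2)] that(2,3) by (simp add: abs_mult)
  obtain K1 where K1: "\<And>t. t \<in> {0..T} \<Longrightarrow> memLp p (\<lambda>x. u t x * \<phi> x) \<and> Lp_norm p (\<lambda>x. u t x * \<phi> x) \<le> K1"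
    using transport_Lp[OF p persist(2), OF meas(1) ptw[OF le(1) \<phi>0 conjunct2[OF c]]] by blast
  obtain K2 where K2: "\<And>t. t \<in> {0..T} \<Longrightarrow> memLp p (\<lambda>x. deriv (u t) x * \<phi> x) \<and> Lp_norm p (\<lambda>x. deriv (u t) x * \<phi> x) \<le> K2"
    using transport_Lp[OF p persist(2), OF meas(2) ptw[OF le(2) \<phi>0 conjunct2[OF c]]] by blast
  obtain K3 where K3: "\<And>t. t \<in> {0..T} \<Longrightarrow> memLp 2 (\<lambda>x. u t x * sqrt (\<phi> x)) \<and> Lp_norm 2 (\<lambda>x. u t x * sqrt (\<phi> x)) \<le> K3"
    using transport_Lp[OF order_refl persist(1), OF meas(3) ptw[OF le(1) real_sqrt_ge_zero[OF \<phi>0] conjunct1[OF c]]] by blast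
  obtain K4 where K4: "\<And>t. t \<in> {0..T} \<Longrightarrow> memLp 2 (\<lambda>x. deriv (u t) x * sqrt (\<phi> x)) \<and> Lp_norm 2 (\<lambda>x. deriv (u t) x * sqrt (\<phi> x)) \<le> K4"
    using transport_Lp[OF order_refl persist(1), OF meas(4) ptw[OF le(2) real_sqrt_ge_zero[OF \<phi>0] conjunct1[OF c]]] by blast
  show ?thesis
    by (intro conjI exI[of _ "K1 + K2"] exI[of _ "K3 + K4"] ballI)
      (use K1 K2 K3 K4 in \<open>auto intro: add_mono\<close>)
qed

end
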